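(* Let $C$ and $D$ be two convex bodies in $\mathbb{R}^2$ of bounded description complexity. For every packing $S$ of $n$ positive homothets of $C$ in $D$, where each element of $S$ touches the boundary of $D$, we have $$\mathrm{per}(S)\le\rho(C,D)\,\log n,$$ where $\rho(C,D)$ depends on $C$ and $D$ (and not on $n$ or $S$). Apart from the factor $\rho(C,D)$, this bound is the best possible unless $D$ is a convex polygon parallel to $C$; that is, if $D$ is not a convex polygon parallel to $C$, then there is a constant $\sigma(C,D)>0$, depending only on $C$ and $D$, such that for every $n$ there is a packing $S$ of $n$ positive homothets of $C$ in $D$, each touching the boundary of $D$, with $\mathrm{per}(S)\ge\sigma(C,D)\log n$.
   Context: A convex body is a compact convex subset of $\mathbb{R}^2$ with nonempty interior. A planar set has bounded description complexity if its boundary consists of a finite number of algebraic curves of bounded degrees. A positive homothet of $C$ is a set of the form $\mu C + v$ with $\mu>0$ and $v\in\mathbb{R}^2$. A finite set $S=\{C_1,\dots,C_n\}$ of convex bodies is a packing in a convex body $D$ if all $C_i$ are contained in $D$ and the $C_i$ have pairwise disjoint interiors. An element $C_i$ touches the boundary of $D$ if $C_i\cap\partial D\ne\emptyset$. $\mathrm{per}(C)$ denotes the perimeter of a convex body $C$, and $\mathrm{per}(S)=\sum_{i=1}^n\mathrm{per}(C_i)$. $\log$ denotes the logarithm to base 2. Parallel: for a unit direction vector $\mathbf{d}\in\mathbb{S}^1$ and a convex body $K$, the supporting line $\ell_{\mathbf d}(K)$ is the directed line of direction $\mathbf d$ tangent to $K$ such that the closed halfplane on the left of $\ell_{\mathbf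 d}(K)$ contains $K$. If $\ell_{\mathbf d}(K)\cap K$ is a nondegenerate line segment, it is called a side of $K$. A convex polygon $D$ is parallel to a convex body $C$ if for every direction $\mathbf d\in\mathbb{S}^1$, whenever $\ell_{\mathbf d}(D)\cap D$ is a side of $D$, then $\ell_{\mathbf d}(C)\cap C$ is also a side of $C$.
   Formalization: The upper bound per(S) ≤ ρ(C,D) log n is stated for n ≥ 2 only, since for n = 1 the right side is 0 while the perimeter of a single homothet is positive. *)

theory Defs
  imports "HOL-Analysis.Analysis" "HOL-Computational_Algebra.Polynomial"
begin

definition convex_body :: "(real^2) set \<Rightarrow> bool" where
  "convex_body K \<longleftrightarrow> compact K \<and> convex K \<and> interior K \<noteq> {}"

(* A bivariate polynomial is a polynomial in Y whose coefficients are polynomials in X. *)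
definition poly_zero_set :: "real poly poly \<Rightarrow> (real^2) set" where
  "poly_zero_set P = {z. poly (poly P [:z $ 2:]) (z $ 1) = 0}"

definition algebraic_arc :: "(real^2) set \<Rightarrow> bool" where
  "algebraic_arc A \<longleftrightarrow>
     (\<exists>g. arc g \<and> path_image g = A) \<and> (\<exists>P. P \<noteq> 0 \<and> A \<subseteq> poly_zero_set P)"

(* For a single set, a bound on the degrees of the curves is implied by their number being finite. *)
definition bounded_description_complexity :: "(real^2) set \<Rightarrow> bool" where
  "bounded_description_complexity K \<longleftrightarrow>
     (\<exists>\<A>. finite \<A> \<and> (\<forall>A\<in>\<A>. algebraic_arc A) \<and> frontier K = \<Union>\<A>)"

(* Supremum of the lengths of inscribed polygonal chains; meaningful for rectifiable paths only. *)
definition path_length :: "(real \<Rightarrow> real^2) \<Rightarrow> real" where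
  "path_length g =
     Sup {(\<Sum>i<k. dist (g (t i)) (g (t (Suc i)))) | k t.
            (\<forall>i\<le>k. t i \<in> {0..1}) \<and> (\<forall>i<k. t i \<le> t (Suc i))}"

(* The boundary of a convex body in the plane is a rectifiable Jordan curve, and all its simple
   closed parametrizations have the same length; the outer supremum just picks this value. *)
definition perimeter :: "(real^2) set \<Rightarrow> real" where
  "perimeter K =
     Sup {path_length g | g. simple_path g \<and> pathfinish g = pathstart g \<and> path_image g = frontier K}"

definition total_perimeter :: "(real^2) set set \<Rightarrow> real" where
  "total_perimeter S = (\<Sum>K\<in>S. perimeter K)"

definition positive_homothet :: "(real^2) set \<Rightarrow> (real^2) set \<Rightarrow> bool" where
  "positive_homothet C K \<longleftrightarrow> (\<exists>\<mu> v. \<mu> > 0 \<and> K = (\<lambda>x. \<mu> *\<^sub>R x + v) ` C)"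

definition packing_in :: "(real^2) set \<Rightarrow> (real^2) set set \<Rightarrow> bool" where
  "packing_in D S \<longleftrightarrow>
     finite S \<and> (\<forall>K\<in>S. convex_body K \<and> K \<subseteq> D) \<and>
     (\<forall>K\<in>S. \<forall>L\<in>S. K \<noteq> L \<longrightarrow> interior K \<inter> interior L = {})"

definition touches_boundary :: "(real^2) set \<Rightarrow> (real^2) set \<Rightarrow> bool" where
  "touches_boundary D K \<longleftrightarrow> K \<inter> frontier D \<noteq> {}"

definition boundary_homothet_packing ::
  "(real^2) set \<Rightarrow> (real^2) set \<Rightarrow> nat \<Rightarrow> (real^2) set set \<Rightarrow> bool" where
  "boundary_homothet_packing C D n S \<longleftrightarrow>
     packing_in D S \<and> card S = n \<and>
     (\<forall>K\<in>S. positive_homothet C K \<and> touches_boundary D K)"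

definition directed_line :: "real^2 \<Rightarrow> real^2 \<Rightarrow> (real^2) set" where
  "directed_line p d = {p + t *\<^sub>R d | t. True}"

(* x lies to the left of the line through p directed along d iff det (d, x - p) is nonnegative. *)
definition left_halfplane :: "real^2 \<Rightarrow> real^2 \<Rightarrow> (real^2) set" where
  "left_halfplane p d = {x. d $ 1 * (x - p) $ 2 - d $ 2 * (x - p) $ 1 \<ge> 0}"

definition supporting_line :: "real^2 \<Rightarrow> (real^2) set \<Rightarrow> (real^2) set \<Rightarrow> bool" where
  "supporting_line d K l \<longleftrightarrow>
     (\<exists>p\<in>K. l = directed_line p d \<and> K \<subseteq> left_halfplane p d)"

(* The supporting line of a convex body in a given direction exists and is unique. *)
definition has_side :: "real^2 \<Rightarrow> (real^2) set \<Rightarrow> bool" where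
  "has_side d K \<longleftrightarrow>
     (\<exists>l. supporting_line d K l \<and> (\<exists>a b. a \<noteq> b \<and> l \<inter> K = closed_segment a b))"

definition convex_polygon :: "(real^2) set \<Rightarrow> bool" where
  "convex_polygon D \<longleftrightarrow> polytope D \<and> interior D \<noteq> {}"

definition parallel_to :: "(real^2) set \<Rightarrow> (real^2) set \<Rightarrow> bool" where
  "parallel_to D C \<longleftrightarrow> (\<forall>d. norm d = 1 \<longrightarrow> has_side d D \<longrightarrow> has_side d C)"

end

theory Submission
  imports Defs
begin

text \<open>
  \<^emph>\<open>Upper bound.\<close> Shrink every homothet of ratio at least \<open>r\<close> towards a point where it touches the boundary
  of \<open>D\<close> until its ratio is \<open>r\<close>. The shrunken copies are still disjoint and lie within distance \<open>O(r)\<close> of the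
  boundary, a region of area \<open>O(r)\<close>; hence there are only \<open>O(1/r)\<close> of them. So the \<open>j\<close>-th largest ratio is
  \<open>O(1/j)\<close>, and the sum of the ratios is at most a harmonic sum.

  \<^emph>\<open>Lower bound.\<close> Suppose that along an arc of the boundary of \<open>D\<close> there are copies of \<open>C\<close> of all small ratios
  that touch the arc, and that a copy of ratio \<open>\<mu>\<close> leaves a gap of order at least \<open>\<mu> x\<^sup>k\<close> between itself and the
  arc at distance \<open>\<mu> x\<close> from the point of contact. Then on the levels of ratio \<open>\<mu>\<^sub>0 q\<^sup>-\<^sup>j\<close> with \<open>q = 13\<^sup>k\<close>, the coarser
  copies block only a small fraction of the arc for the finer ones, so that each of the logarithmically many
  levels contributes a constant to the perimeter.

  If \<open>D\<close> has a side in a direction in which \<open>C\<close> has none, then \<open>C\<close> meets its supporting line in a single point,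
  and the gap is given by a Lojasiewicz inequality for the polynomial that vanishes on the boundary of \<open>C\<close>. If
  \<open>D\<close> is not a polygon, then some boundary arc contains no segment, because the zero set of a polynomial
  contains only finitely many lines. A subarc of it has curvature bounded away from zero and infinity. Among
  the tangent directions of this subarc there is an interval in which the support points of \<open>C\<close> are either a
  single vertex or points of positive curvature, and the gap is quadratic.
\<close>

section \<open>Plane algebraic curves\<close>

text \<open>The exponent \<open>k\<close> dictates the scales. A copy of ratio \<open>\<mu>\<close>
  and a copy smaller by the factor \<open>x ^ k\<close> can meet only if their points of contact are
  within a constant times \<open>\<mu> * x\<close>. For \<open>x = 1 / 13 ^ d\<close> the smaller
  copy is \<open>d\<close> levels finer, and the blocked stretch amounts to \<open>X ^ d\<close>
  steps of the finer grid, where \<open>X = 13 ^ (k - 1)\<close>. Blocking on both sides, all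
  coarser levels together remove at most the fraction 2 (1/13 + 1/13^2 + ...) = 1/6 of a level.

  A curved \<open>D\<close> itself leaves its tangent, by up to
  \<open>b * \<bar>u - t\<bar> ^ k\<close>. The copy leaves it by
  \<open>c * \<mu> * (\<bar>u - t\<bar> / \<mu>) ^ k\<close>, and as \<open>k \<ge> 2\<close> this
  dominates once \<open>\<mu>\<close> is small.

  The constant \<open>c\<close> has to serve all points of contact at once. On a side of
  \<open>D\<close> one support point of \<open>C\<close> serves throughout. On a curved arc every
  slope asks for its own support point, and \<open>C\<close> may behave badly for some of the
  slopes. Since the slope along the arc is strictly increasing and continuous, the interval of
  slopes may be cut down to one where \<open>C\<close> behaves uniformly, and the arc is cut down
  with it.

  Both bodies are treated as graphs over a common axis of direction \<open>d\<close>, with lower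
  boundaries \<open>low d C\<close> and \<open>low d D\<close>.\<close>

definition ev :: "real poly poly \<Rightarrow> real \<Rightarrow> real \<Rightarrow> real" where
  "ev P x y = poly (poly P [:y:]) x"

lemma ev_0 [simp]: "ev 0 x y = 0" by (simp add: ev_def)
lemma ev_pCons [simp]: "ev (pCons p P) x y = poly p x + y * ev P x y" by (simp add: ev_def)
lemma ev_add [simp]: "ev (P + Q) x y = ev P x y + ev Q x y" by (simp add: ev_def)
lemma ev_mult [simp]: "ev (P * Q) x y = ev P x y * ev Q x y" by (simp add: ev_def)
lemma ev_smult [simp]: "ev (smult p P) x y = poly p x * ev P x y" by (simp add: ev_def)
lemma ev_power [simp]: "ev (P ^ n) x y = ev P x y ^ n" by (simp add: ev_def poly_power)
lemma ev_prod [simp]: "ev (prod f A) x y = (\<Prod>a\<in>A. ev (f a) x y)" by (simp add: ev_def poly_prod)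

lemma poly_zero_set_iff: "z \<in> poly_zero_set P \<longleftrightarrow> ev P (z $ 1) (z $ 2) = 0"
  by (simp add: poly_zero_set_def ev_def)

lemma infinite_range_const_poly: "infinite (range (\<lambda>y::real. [:y:]))"
  using finite_imageD[of "\<lambda>y::real. [:y:]" UNIV] infinite_UNIV_char_0[where 'a=real] by (auto simp: inj_def)

text \<open>If all values vanished, every constant \<open>[:y:]\<close> would be a root of
  \<open>P\<close> in the ring of polynomials in X, and a nonzero \<open>P\<close> has only finitely
  many roots there.\<close>

lemma ev_nonzero:
  assumes "P \<noteq> 0"
  shows "\<exists>x y. ev P x y \<noteq> 0"
proof (rule ccontr)
  assume "\<not> ?thesis"
  then have "poly (poly P [:y:]) x = 0" for x y by (simp add: ev_def)
  then have "poly P [:y:] = 0" for y using poly_all_0_iff_0 by blast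
  then have "range (\<lambda>y::real. [:y:]) \<subseteq> {r. poly P r = 0}" by auto
  moreover have "finite {r. poly P r = 0}" using assms poly_roots_finite by blast
  ultimately show False using infinite_range_const_poly finite_subset by blast
qed

lemma poly_affine_substitution:
  "\<exists>Q. \<forall>x y. ev Q x y = poly p (a * x + b * y + e)"
proof (induction p)
  case 0
  show ?case by (rule exI[of _ 0]) simp
next
  case (pCons c p)
  then obtain Q where Q: "\<And>x y. ev Q x y = poly p (a * x + b * y + e)" by blast
  have "ev ([:[:c:]:] + [:[:e, a:], [:b:]:] * Q) x y = poly (pCons c p) (a * x + b * y + e)" for x y
    by (simp add: Q algebra_simps)
  then show ?case by blast
qed

lemma ev_affine_substitution:
  "\<exists>Q. \<forall>x y. ev Q x y = ev P (a * x + b * y + e) (c * x + d * y + h)"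
proof (induction P)
  case 0
  show ?case by (rule exI[of _ 0]) simp
next
  case (pCons p P)
  then obtain Q where Q: "\<And>x y. ev Q x y = ev P (a * x + b * y + e) (c * x + d * y + h)" by blast
  obtain R where R: "\<And>x y. ev R x y = poly p (a * x + b * y + e)"
    using poly_affine_substitution by blast
  have "ev (R + [:[:h, c:], [:d:]:] * Q) x y = ev (pCons p P) (a * x + b * y + e) (c * x + d * y + h)" for x y
    by (simp add: Q R algebra_simps)
  then show ?case by blast
qed

text \<open>An invertible affine map is onto: Cramer's rule gives a preimage \<open>(x, y)\<close>
  of a point where \<open>P\<close> does not vanish, and \<open>Q\<close> does not vanish at this
  preimage.\<close>

lemma ev_affine_substitution_nonzero:
  assumes "P \<noteq> 0" "a * d - b * c \<noteq> 0"
  shows "\<exists>Q. Q \<noteq> 0 \<and> (\<forall>x y. ev Q x y = ev P (a * x + b * y + e) (c * x + d * y + h))"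
proof -
  obtain Q where Q: "\<And>x y. ev Q x y = ev P (a * x + b * y + e) (c * x + d * y + h)"
    using ev_affine_substitution by blast
  obtain u v where uv: "ev P u v \<noteq> 0" using ev_nonzero[OF assms(1)] by blast
  define D where "D = a * d - b * c"
  define x where "x = (d * (u - e) - b * (v - h)) / D"
  define y where "y = (a * (v - h) - c * (u - e)) / D"
  have D0: "D \<noteq> 0" using assms by (simp add: D_def)
  have "a * (d * (u - e) - b * (v - h)) + b * (a * (v - h) - c * (u - e)) = (u - e) * D"
    by (simp add: D_def algebra_simps)
  then have "a * x + b * y = u - e" using D0 by (simp add: x_def y_def add_divide_distrib[symmetric])
  moreover have "c * (d * (u - e) - b * (v - h)) + d * (a * (v - h) - c * (u - e)) = (v - h) * D"
    by (simp add: D_def algebra_simps)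
  then have "c * x + d * y = v - h" using D0 by (simp add: x_def y_def add_divide_distrib[symmetric])
  ultimately have "ev Q x y \<noteq> 0" using uv by (simp add: Q)
  then have "Q \<noteq> 0" by auto
  with Q show ?thesis by blast
qed

text \<open>The formal partial derivative in X. The one in Y is \<open>pderiv P\<close>, because the
  outer variable is Y.\<close>

definition pdx :: "real poly poly \<Rightarrow> real poly poly" where "pdx P = map_poly pderiv P"

lemma pdx_0 [simp]: "pdx 0 = 0" by (simp add: pdx_def)
lemma pdx_pCons [simp]: "pdx (pCons p P) = pCons (pderiv p) (pdx P)"
  by (cases "P = 0"; cases "p = 0") (auto simp: pdx_def map_poly_pCons)

lemma ev_has_derivative:
  assumes "(g has_real_derivative m) (at x)"
  shows "((\<lambda>x. ev P x (g x)) has_real_derivative (ev (pdx P) x (g x) + ev (pderiv P) x (g x) * m)) (at x)"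
proof (induction P)
  case 0
  show ?case by simp
next
  case (pCons p P)
  show ?case
    by (simp add: pderiv_pCons) (rule derivative_eq_intros poly_DERIV pCons assms refl | simp add: algebra_simps)+
qed

lemma ev_continuous:
  assumes "continuous_on S g"
  shows "continuous_on S (\<lambda>x. ev P x (g x))"
  by (induction P) (auto intro!: continuous_intros assms)

lemma ev_isCont:
  assumes "isCont f x" "isCont g x"
  shows "isCont (\<lambda>x. ev P (f x) (g x)) x"
  by (induction P) (auto intro!: continuous_intros assms)

lemma ev_pdx_const: "ev (pdx P) x y = poly (pderiv (poly P [:y:])) x"
  by (induction P) (auto simp: pderiv_add pderiv_smult)

text \<open>No implicit function theorem is needed: \<open>g\<close> is given, so dividing
  \<open>P(x, g x) - P(x\<^sub>0, g x\<^sub>0)\<close> by \<open>Y - g x\<^sub>0\<close> expresses the difference quotient of \<open>g\<close> directly.\<close>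

lemma implicit_derivative:
  assumes S: "open S" "x0 \<in> S" and cont: "isCont g x0"
    and zero: "\<And>x. x \<in> S \<Longrightarrow> ev P x (g x) = 0"
    and nz: "ev (pderiv P) x0 (g x0) \<noteq> 0"
  shows "(g has_real_derivative (- ev (pdx P) x0 (g x0) / ev (pderiv P) x0 (g x0))) (at x0)"
proof -
  define y0 where "y0 = g x0"
  define Q where "Q = synthetic_div P [:y0:]"
  define p where "p = poly P [:y0:]"
  have P: "P = [:- [:y0:], 1:] * Q + [:p:]"
    unfolding Q_def p_def by (rule synthetic_div_correct'[symmetric])
  have evP: "ev P x y = (y - y0) * ev Q x y + poly p x" for x y
    by (subst P) (simp add: algebra_simps)
  have Q0: "ev Q x0 y0 = ev (pderiv P) x0 y0"
    by (subst P) (simp add: pderiv_add pderiv_mult pderiv_pCons pderiv_smult)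
  have p0: "poly p x0 = 0" using evP[of x0 y0] zero[OF S(2)] by (simp add: y0_def)
  have dp: "((\<lambda>x. (poly p x - poly p x0) / (x - x0)) \<longlongrightarrow> ev (pdx P) x0 y0) (at x0)"
    using poly_DERIV[of p x0] unfolding has_field_derivative_iff p_def ev_pdx_const by simp
  have cQ: "((\<lambda>x. ev Q x (g x)) \<longlongrightarrow> ev Q x0 y0) (at x0)"
    using ev_isCont[OF _ cont, of "\<lambda>x. x" Q] unfolding isCont_def y0_def by simp
  have evQ: "\<forall>\<^sub>F x in at x0. ev Q x (g x) \<noteq> 0"
    using tendsto_imp_eventually_ne[OF cQ] nz Q0 y0_def by simp
  have evS: "\<forall>\<^sub>F x in at x0. x \<in> S" using S by (simp add: eventually_at_topological) blast
  have "\<forall>\<^sub>F x in at x0. - ((poly p x - poly p x0) / (x - x0)) / ev Q x (g x) = (g x - g x0) / (x - x0)"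
    using evQ evS
  proof eventually_elim
    case (elim x)
    have "(g x - y0) * ev Q x (g x) + poly p x = 0" using zero[OF elim(2)] evP by simp
    then have "g x - y0 = - poly p x / ev Q x (g x)" using elim(1) by (simp add: field_simps)
    then show ?case by (simp add: p0 y0_def)
  qed
  moreover have "((\<lambda>x. - ((poly p x - poly p x0) / (x - x0)) / ev Q x (g x)) \<longlongrightarrow>
      - ev (pdx P) x0 y0 / ev Q x0 y0) (at x0)"
    by (intro tendsto_intros dp cQ) (use nz Q0 y0_def in simp)
  ultimately have "((\<lambda>x. (g x - g x0) / (x - x0)) \<longlongrightarrow> - ev (pdx P) x0 y0 / ev Q x0 y0) (at x0)"
    by (rule Lim_transform_eventually[rotated])
  then show ?thesis using Q0 unfolding y0_def by (simp add: has_field_derivative_iff)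
qed

text \<open>The pairs encode the lines y = a x + b contained in the zero set. Read as roots of
  \<open>P\<close> in the ring of polynomials in X, they are finite in number without any
  factorization of \<open>P\<close>.\<close>

definition affine_roots :: "real poly poly \<Rightarrow> (real \<times> real) set" where
  "affine_roots P = {(a, b). poly P [:b, a:] = 0}"

lemma finite_affine_roots:
  assumes "P \<noteq> 0"
  shows "finite (affine_roots P)"
proof -
  have "inj_on (\<lambda>(a, b). [:b, a:]) (affine_roots P)" by (auto simp: inj_on_def)
  moreover have "(\<lambda>(a, b). [:b, a:]) ` affine_roots P \<subseteq> {r. poly P r = 0}"
    by (auto simp: affine_roots_def)
  ultimately show ?thesis using poly_roots_finite[OF assms] finite_subset finite_imageD by metis
qed

text \<open>On a line, \<open>P\<close> restricts to a polynomial in one variable, which is zero as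
  soon as it has infinitely many roots.\<close>

lemma affine_rootI:
  assumes "infinite {x. ev P x (a * x + b) = 0}"
  shows "(a, b) \<in> affine_roots P"
proof -
  have "ev P x (a * x + b) = poly (poly P [:b, a:]) x" for x
    by (induction P) (auto simp: algebra_simps)
  then have "infinite {x. poly (poly P [:b, a:]) x = 0}" using assms by simp
  then show ?thesis using poly_roots_finite by (auto simp: affine_roots_def)
qed

text \<open>Dividing \<open>P\<close> by the highest power of Y gives a \<open>Q\<close> that still
  vanishes on \<open>A\<close>, since y > 0 there, and whose restriction to y = 0 is a nonzero
  polynomial \<open>x ^ k * w\<close> with \<open>poly w 0 \<noteq> 0\<close>. Writing
  \<open>Q\<close> as Y times \<open>R\<close> plus this restriction,
  \<open>\<bar>x ^ k * poly w x\<bar>\<close> equals y times the absolute value of \<open>R\<close>,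
  and \<open>R\<close> is bounded on the bounded set \<open>A\<close>.\<close>

lemma lojasiewicz_near_zero:
  assumes "P \<noteq> 0" "\<And>x y. (x, y) \<in> A \<Longrightarrow> ev P x y = 0" "\<And>x y. (x, y) \<in> A \<Longrightarrow> y > 0" "bounded A"
  shows "\<exists>c r k. c > 0 \<and> r > 0 \<and> (\<forall>(x, y)\<in>A. \<bar>x\<bar> \<le> r \<longrightarrow> y \<ge> c * \<bar>x\<bar> ^ k)"
proof -
  obtain m Q where Q: "P = [:0,1:] ^ m * Q" and Q0: "\<not> [:0,1:] dvd Q"
    using order_decomp[OF assms(1), of 0] by auto
  define p where "p = poly Q 0"
  have p0: "p \<noteq> 0" using Q0 poly_eq_0_iff_dvd[of Q 0] by (auto simp: p_def)
  obtain k w where w: "p = [:0,1:] ^ k * w" and w0: "\<not> [:0,1:] dvd w"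
    using order_decomp[OF p0, of 0] by auto
  have w0: "poly w 0 \<noteq> 0" using w0 poly_eq_0_iff_dvd[of w 0] by auto
  define R where "R = synthetic_div Q 0"
  have QR: "Q = [:0,1:] * R + [:p:]"
    using synthetic_div_correct'[of 0 Q] by (simp add: R_def p_def)
  have evQ: "ev Q x y = y * ev R x y + x ^ k * poly w x" for x y
    by (subst QR) (simp add: w poly_power)
  obtain M where M: "M > 0" "\<And>z. z \<in> A \<Longrightarrow> norm (ev R (fst z) (snd z)) \<le> M"
  proof -
    have "continuous_on UNIV (\<lambda>z. ev R (fst z) (snd z))"
      by (induction R) (auto intro!: continuous_intros)
    then have "bounded ((\<lambda>z. ev R (fst z) (snd z)) ` closure A)"
      by (intro compact_imp_bounded compact_continuous_image) (auto intro: continuous_on_subset simp: assms)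
    then obtain M where "M > 0" "\<And>z. z \<in> closure A \<Longrightarrow> norm (ev R (fst z) (snd z)) \<le> M"
      by (auto simp: bounded_pos)
    then show thesis using that closure_subset by blast
  qed
  have "isCont (poly w) 0" by simp
  then obtain r where r: "r > 0" "\<And>x. \<bar>x\<bar> < r \<Longrightarrow> \<bar>poly w x - poly w 0\<bar> < \<bar>poly w 0\<bar> / 2"
    using w0 unfolding continuous_at_eps_delta dist_real_def
    by (metis diff_zero half_gt_zero zero_less_abs_iff)
  define c where "c = \<bar>poly w 0\<bar> / 2 / M"
  have "y \<ge> c * \<bar>x\<bar> ^ k" if "(x, y) \<in> A" "\<bar>x\<bar> \<le> r / 2" for x y
  proof -
    have y: "y > 0" using assms that by blast
    have "ev P x y = y ^ m * ev Q x y" by (simp add: Q)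
    then have "ev Q x y = 0" using assms(2)[OF that(1)] y by simp
    then have "\<bar>x ^ k * poly w x\<bar> = y * \<bar>ev R x y\<bar>" using y evQ[of x y] by (simp add: abs_mult eq_neg_iff_add_eq_0 flip: abs_minus_cancel[of "x ^ k * poly w x"]) (metis abs_mult abs_of_pos abs_minus_cancel add_eq_0_iff)
    also have "\<dots> \<le> y * M" using M(2)[OF that(1)] y by simp
    finally have "\<bar>x\<bar> ^ k * \<bar>poly w x\<bar> \<le> y * M" by (simp add: abs_mult power_abs)
    moreover have "\<bar>poly w x\<bar> \<ge> \<bar>poly w 0\<bar> / 2" using r(2)[of x] that r(1) by linarith
    then have "\<bar>x\<bar> ^ k * (\<bar>poly w 0\<bar> / 2) \<le> \<bar>x\<bar> ^ k * \<bar>poly w x\<bar>" by (intro mult_left_mono) auto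
    ultimately have "\<bar>x\<bar> ^ k * (\<bar>poly w 0\<bar> / 2) \<le> y * M" by linarith
    then show ?thesis using M(1) by (simp add: c_def field_simps)
  qed
  moreover have "c > 0" using w0 M by (simp add: c_def)
  ultimately show ?thesis using r(1) by (intro exI[of _ c] exI[of _ "r/2"] exI[of _ k]) auto
qed

section \<open>Smooth arcs on convex algebraic graphs\<close>

lemma convex_on_deriv_le:
  fixes g :: "real \<Rightarrow> real"
  assumes "convex_on {a<..<b} g" "x \<in> {a<..<b}" "y \<in> {a<..<b}" "(g has_real_derivative m) (at x)"
  shows "g y \<ge> g x + m * (y - x)"
proof -
  have "g y - g x \<ge> m * (y - x)"
    by (rule convex_on_imp_above_tangent[OF assms(1)])
      (use assms in \<open>auto intro: has_field_derivative_at_within\<close>)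
  then show ?thesis by simp
qed

text \<open>Among the polynomials vanishing along some piece of the graph take one of least degree
  in Y. Its Y-derivative cannot vanish along that whole piece. Near a point where it is nonzero,
  implicit differentiation gives the slope as a quotient of polynomial expressions in
  \<open>x\<close> and \<open>g x\<close>, which can be differentiated once more.\<close>

lemma algebraic_graph_locally_smooth:
  assumes "a < b" and cont: "continuous_on {a<..<b} g" and "P \<noteq> 0"
    and zero: "\<And>x. x \<in> {a<..<b} \<Longrightarrow> ev P x (g x) = 0"
  obtains a' b' G H where "a \<le> a'" "a' < b'" "b' \<le> b"
    "\<And>x. x \<in> {a'<..<b'} \<Longrightarrow> (g has_real_derivative G x) (at x)"
    "\<And>x. x \<in> {a'<..<b'} \<Longrightarrow> (G has_real_derivative H x) (at x)"
    "continuous_on {a'<..<b'} H"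
proof -
  \<comment> \<open>The minimum is taken over all polynomials and all subintervals at once, so that
    passing to a smaller interval cannot lower the degree again.\<close>
  define Z where "Z = (\<lambda>Q c d. Q \<noteq> 0 \<and> a \<le> c \<and> c < d \<and> d \<le> b \<and> (\<forall>x\<in>{c<..<d}. ev Q x (g x) = 0))"
  have "Z P a b" using assms by (auto simp: Z_def)
  then have "\<exists>n Q c d. Z Q c d \<and> degree Q = n" by blast
  then obtain n where n: "\<exists>Q c d. Z Q c d \<and> degree Q = n" "\<And>m. m < n \<Longrightarrow> \<not> (\<exists>Q c d. Z Q c d \<and> degree Q = m)"
    using exists_least_iff[of "\<lambda>n. \<exists>Q c d. Z Q c d \<and> degree Q = n"] by blast
  then obtain Q c d where Q: "Z Q c d" "degree Q = n" by blast
  have min: "\<not> Z R c' d'" if "degree R < degree Q" for R c' d' using n(2) Q(2) that by blast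
  have ne: "Q \<noteq> 0" and cd: "a \<le> c" "c < d" "d \<le> b" and Qz: "\<And>x. x \<in> {c<..<d} \<Longrightarrow> ev Q x (g x) = 0"
    using Q(1) by (auto simp: Z_def)
  have deg: "degree Q > 0"
  proof (rule ccontr)
    assume "\<not> ?thesis"
    then obtain q where q: "Q = [:q:]" using degree_eq_zeroE by blast
    then have "q \<noteq> 0" using ne by auto
    have "{c<..<d} \<subseteq> {x. poly q x = 0}" using Qz q by (auto simp: ev_def)
    then show False using poly_roots_finite[OF \<open>q \<noteq> 0\<close>] infinite_Ioo[OF cd(2)] finite_subset by blast
  qed
  define R where "R = pderiv Q"
  have "R \<noteq> 0" using deg by (simp add: R_def pderiv_eq_0_iff)
  moreover have "degree R < degree Q" using deg by (simp add: R_def degree_pderiv)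
  ultimately have "\<exists>x\<in>{c<..<d}. ev R x (g x) \<noteq> 0" using min cd by (auto simp: Z_def)
  then obtain x0 where x0: "x0 \<in> {c<..<d}" "ev R x0 (g x0) \<noteq> 0" by blast
  have contg: "continuous_on {c<..<d} g" by (rule continuous_on_subset[OF cont]) (use cd in auto)
  have "continuous_on {c<..<d} (\<lambda>x. ev R x (g x))" by (rule ev_continuous[OF contg])
  then have "open {x\<in>{c<..<d}. ev R x (g x) \<noteq> 0}"
  proof -
    assume "continuous_on {c<..<d} (\<lambda>x. ev R x (g x))"
    then have "open ((\<lambda>x. ev R x (g x)) -` (- {0}) \<inter> {c<..<d})"
      by (rule continuous_on_open_vimage[THEN iffD1, rule_format, rotated]) auto
    moreover have "(\<lambda>x. ev R x (g x)) -` (- {0}) \<inter> {c<..<d} = {x\<in>{c<..<d}. ev R x (g x) \<noteq> 0}" by auto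
    ultimately show ?thesis by simp
  qed
  then obtain e where e: "e > 0" "ball x0 e \<subseteq> {x\<in>{c<..<d}. ev R x (g x) \<noteq> 0}"
    using x0 unfolding open_contains_ball by blast
  then have sub: "x \<in> {c<..<d}" "ev R x (g x) \<noteq> 0" if "x \<in> {x0-e<..<x0+e}" for x
    using that by (auto simp: subset_iff dist_real_def ball_def)
  have le: "c \<le> x0 - e"
  proof (rule ccontr)
    assume "\<not> ?thesis"
    then show False using sub(1)[of "(x0-e+c)/2"] e(1) x0 by auto
  qed
  have ge: "x0 + e \<le> d"
  proof (rule ccontr)
    assume "\<not> ?thesis"
    then show False using sub(1)[of "(x0+e+d)/2"] e(1) x0 by auto
  qed
  define G where "G = (\<lambda>x. - ev (pdx Q) x (g x) / ev R x (g x))"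
  have dg: "(g has_real_derivative G x) (at x)" if x: "x \<in> {x0-e<..<x0+e}" for x
    unfolding G_def R_def
  proof (rule implicit_derivative[of "{c<..<d}"])
    show "isCont g x" using contg sub(1)[OF x] by (simp add: continuous_on_eq_continuous_at)
  qed (use sub x Qz R_def in auto)
  define H where "H = (\<lambda>x. - ((ev (pdx (pdx Q)) x (g x) + ev (pderiv (pdx Q)) x (g x) * G x) * ev R x (g x)
        - ev (pdx Q) x (g x) * (ev (pdx R) x (g x) + ev (pderiv R) x (g x) * G x)) / (ev R x (g x) * ev R x (g x)))"
  have dG: "(G has_real_derivative H x) (at x)" if x: "x \<in> {x0-e<..<x0+e}" for x
    using DERIV_minus[OF DERIV_divide[OF ev_has_derivative[OF dg[OF x], of "pdx Q"] ev_has_derivative[OF dg[OF x], of R] sub(2)[OF x]]]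
    unfolding G_def H_def by (simp only: minus_divide_left)
  have cg: "continuous_on {x0-e<..<x0+e} g" by (rule continuous_on_subset[OF contg]) (use le ge in auto)
  have cG: "continuous_on {x0-e<..<x0+e} G"
    using dG by (intro continuous_at_imp_continuous_on) (blast intro: DERIV_isCont)
  have cH: "continuous_on {x0-e<..<x0+e} H"
    unfolding H_def by (intro continuous_intros ev_continuous cg cG) (use sub in auto)
  show thesis
    by (rule that[OF _ _ _ dg dG cH]) (use le ge cd e(1) in auto)
qed

text \<open>The slope \<open>G\<close> increases by convexity, so its derivative \<open>H\<close> is
  nonnegative. If \<open>H\<close> vanished throughout, \<open>g\<close> would be affine, which is
  excluded. Near a point \<open>x0\<close> with \<open>H x0 > 0\<close>, continuity keeps
  \<open>H\<close> between \<open>H x0 / 2\<close> and \<open>2 * H x0\<close>, and the mean value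
  theorem turns these into \<open>l\<close> and \<open>u\<close>.\<close>

lemma algebraic_convex_arc:
  assumes ab: "a < b" and conv: "convex_on {a<..<b} g" and "P \<noteq> 0"
    and zero: "\<forall>x\<in>{a<..<b}. ev P x (g x) = 0"
    and nonaffine: "\<forall>c d m n. a \<le> c \<longrightarrow> c < d \<longrightarrow> d \<le> b \<longrightarrow> \<not> (\<forall>x\<in>{c<..<d}. g x = m * x + n)"
  shows "\<exists>a' b' G l u. a < a' \<and> a' < b' \<and> b' < b \<and> l > 0 \<and> u > 0 \<and>
    (\<forall>x\<in>{a'..b'}. (g has_real_derivative G x) (at x)) \<and>
    (\<forall>x\<in>{a'..b'}. \<forall>y\<in>{a'..b'}. x \<le> y \<longrightarrow> l * (y - x) \<le> G y - G x \<and> G y - G x \<le> u * (y - x))"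
proof -
  have cont: "continuous_on {a<..<b} g" by (rule convex_on_continuous[OF _ conv]) auto
  obtain c d G H where cd: "a \<le> c" "c < d" "d \<le> b"
    and dg: "\<And>x. x \<in> {c<..<d} \<Longrightarrow> (g has_real_derivative G x) (at x)"
    and dG: "\<And>x. x \<in> {c<..<d} \<Longrightarrow> (G has_real_derivative H x) (at x)"
    and cH: "continuous_on {c<..<d} H"
    using algebraic_graph_locally_smooth[OF ab cont \<open>P \<noteq> 0\<close>] zero by blast
  have convcd: "convex_on {c<..<d} g" by (rule convex_on_subset[OF conv]) (use cd in auto)
  have mono: "G x \<le> G y" if "x \<in> {c<..<d}" "y \<in> {c<..<d}" "x \<le> y" for x y
  proof (cases "x = y")
    case False
    then have "x < y" using that by simp
    have "g y \<ge> g x + G x * (y - x)" "g x \<ge> g y + G y * (x - y)"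
      using convex_on_deriv_le[OF convcd] dg that by blast+
    then have "G x * (y - x) \<le> G y * (y - x)" by (simp add: algebra_simps)
    then show ?thesis using \<open>x < y\<close> by simp
  qed simp
  have Hge: "H x \<ge> 0" if x: "x \<in> {c<..<d}" for x
  proof (rule ccontr)
    assume "\<not> ?thesis"
    then obtain e where e: "e > 0" "\<And>h. \<lbrakk>h > 0; h < e\<rbrakk> \<Longrightarrow> G (x + h) < G x"
      using DERIV_neg_dec_right[OF dG[OF x]] by auto
    define h where "h = min (e / 2) ((d - x) / 2)"
    have "h > 0" "h < e" "h < d - x" using e(1) x by (auto simp: h_def min_def)
    then show False using e(2)[of h] mono[of x "x + h"] x by auto
  qed
  have "\<exists>x0\<in>{c<..<d}. H x0 \<noteq> 0"
  proof (rule ccontr)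
    assume "\<not> ?thesis"
    then have H0: "(G has_real_derivative 0) (at x)" if "x \<in> {c<..<d}" for x using dG that by metis
    define z where "z = (c + d) / 2"
    have z: "z \<in> {c<..<d}" using cd by (auto simp: z_def)
    have Gz: "G x = G z" if x: "x \<in> {c<..<d}" for x
    proof -
      have "\<exists>k. \<forall>x\<in>{c<..<d}. G x = k"
        by (rule has_field_derivative_zero_constant) (use H0 in \<open>auto intro: has_field_derivative_at_within\<close>)
      then show ?thesis using x z by metis
    qed
    have "\<exists>k. \<forall>x\<in>{c<..<d}. g x - G z * x = k"
    proof (rule has_field_derivative_zero_constant)
      show "((\<lambda>x. g x - G z * x) has_real_derivative 0) (at x within {c<..<d})" if "x \<in> {c<..<d}" for x
        using Gz[OF that] by (auto intro!: derivative_eq_intros has_field_derivative_at_within[OF dg[OF that]])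
    qed auto
    then obtain k where "\<And>x. x \<in> {c<..<d} \<Longrightarrow> g x = G z * x + k" by (auto simp: algebra_simps)
    then show False using nonaffine cd by blast
  qed
  then obtain x0 where x0: "x0 \<in> {c<..<d}" "H x0 > 0" using Hge by force
  have "isCont H x0" using cH x0(1) by (simp add: continuous_on_eq_continuous_at)
  then obtain e where e: "e > 0" "\<And>x. \<bar>x - x0\<bar> < e \<Longrightarrow> \<bar>H x - H x0\<bar> < H x0 / 2"
    using x0(2) unfolding continuous_at_eps_delta dist_real_def by (metis half_gt_zero)
  define r where "r = min (e / 2) (min ((x0 - c) / 2) ((d - x0) / 2))"
  have r: "r > 0" "r < e" "r < x0 - c" "r < d - x0" using e(1) x0 by (auto simp: r_def min_def)
  have Hb: "H x0 / 2 \<le> H x" "H x \<le> 2 * H x0" if "x \<in> {x0-r..x0+r}" for x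
  proof -
    have "\<bar>x - x0\<bar> < e" using that r by (simp add: abs_less_iff)
    then have "\<bar>H x - H x0\<bar> < H x0 / 2" by (rule e(2))
    then show "H x0 / 2 \<le> H x" "H x \<le> 2 * H x0" using x0(2) by linarith+
  qed
  show ?thesis
  proof (rule exI[of _ "x0 - r"], rule exI[of _ "x0 + r"], rule exI[of _ G], rule exI[of _ "H x0 / 2"],
      rule exI[of _ "2 * H x0"], intro conjI ballI impI)
    show "(g has_real_derivative G x) (at x)" if "x \<in> {x0-r..x0+r}" for x using dg that r by auto
    have both: "H x0 / 2 * (y - x) \<le> G y - G x \<and> G y - G x \<le> 2 * H x0 * (y - x)"
      if xy: "x \<in> {x0-r..x0+r}" "y \<in> {x0-r..x0+r}" "x \<le> y" for x y
    proof (cases "x = y")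
      case False
      then have "x < y" using xy by simp
      then obtain z where z: "z > x" "z < y" "G y - G x = (y - x) * H z"
        using MVT2[of x y G H] dG xy r by (smt (verit) atLeastAtMost_iff greaterThanLessThan_iff)
      have "(y - x) * (H x0 / 2) \<le> (y - x) * H z" "(y - x) * H z \<le> (y - x) * (2 * H x0)"
        using Hb[of z] z xy \<open>x < y\<close> by (auto intro!: mult_left_mono)
      then show ?thesis using z(3) by (simp add: mult.commute)
    qed simp
    show "H x0 / 2 * (y - x) \<le> G y - G x" "G y - G x \<le> 2 * H x0 * (y - x)"
      if "x \<in> {x0-r..x0+r}" "y \<in> {x0-r..x0+r}" "x \<le> y" for x y using both[OF that] by blast+
  qed (use r cd x0 in auto)
qed

section \<open>Perimeter of convex bodies\<close>

text \<open>Ensures that the supremum defining \<open>perimeter\<close> ranges over a nonempty set.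
  Bounded convex sets of equal affine dimension have homeomorphic relative frontiers; the model is
  the unit disc in the complex plane, whose circle is traversed by \<open>exp\<close>.\<close>

lemma frontier_loop_exists:
  assumes "convex_body K"
  obtains g where "simple_path g" "pathfinish g = pathstart g" "path_image g = frontier K"
proof -
  have K: "compact K" "convex K" "interior K \<noteq> {}" using assms by (auto simp: convex_body_def)
  have "rel_frontier (cball (0::complex) 1) homeomorphic rel_frontier K"
  proof (rule homeomorphic_rel_frontiers_convex_bounded_sets)
    have "interior (cball (0::complex) 1) \<noteq> {}" by simp
    then show "aff_dim (cball (0::complex) 1) = aff_dim K"
      using K(3) aff_dim_nonempty_interior[of K] aff_dim_nonempty_interior[of "cball (0::complex) 1"] by simp
  qed (use K compact_imp_bounded in auto)
  moreover have "rel_frontier (cball (0::complex) 1) = sphere 0 1" by simp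
  moreover have "rel_frontier K = frontier K" using K(3) rel_frontier_nonempty_interior by blast
  ultimately obtain h h' where "homeomorphism (sphere (0::complex) 1) (frontier K) h h'"
    unfolding homeomorphic_def by auto
  then have h: "continuous_on (sphere 0 1) h" "h ` sphere 0 1 = frontier K" "inj_on h (sphere 0 1)"
    by (auto simp: homeomorphism_def) (metis inj_on_inverseI mem_sphere_0)
  define e where "e = (\<lambda>t. exp (2 * of_real pi * \<i> * complex_of_real t))"
  have e: "e t = cis (2 * pi * t)" for t by (simp add: e_def cis_conv_exp mult_ac)
  have e_sphere: "e t \<in> sphere 0 1" for t by (simp add: e)
  have e_onto: "e ` {0..1} = sphere 0 1"
  proof
    show "sphere 0 1 \<subseteq> e ` {0..1}"
    proof
      fix z :: complex assume "z \<in> sphere 0 1"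
      then have z: "norm z = 1" by simp
      then have "z \<noteq> 0" by auto
      have "z = exp (\<i> * of_real (Arg2pi z))" using Arg2pi[of z] z unfolding is_Arg_def by (metis mult_1 of_real_1)
      moreover have "0 \<le> Arg2pi z" "Arg2pi z < 2 * pi" using Arg2pi[of z] by auto
      ultimately have "z = e (Arg2pi z / (2 * pi))" "Arg2pi z / (2 * pi) \<in> {0..1}"
        by (auto simp: e cis_conv_exp)
      then show "z \<in> e ` {0..1}" by blast
    qed
  qed (use e_sphere in auto)
  have e_inj: "s = t \<or> s = 0 \<and> t = 1 \<or> s = 1 \<and> t = 0" if st: "s \<in> {0..1}" "t \<in> {0..1}" "e s = e t" for s t
  proof -
    obtain n :: int where "2 * of_real pi * \<i> * complex_of_real s = 2 * of_real pi * \<i> * complex_of_real t + complex_of_real (real_of_int (2 * n) * pi) * \<i>"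
      using st(3) unfolding e_def exp_eq by blast
    then have "2 * of_real pi * \<i> * complex_of_real s = 2 * of_real pi * \<i> * complex_of_real (t + n)"
      by (simp add: algebra_simps)
    then have n: "s = t + n" by (simp only: mult_cancel_left of_real_eq_iff) simp
    then have "n < 2" "n > -2" using st by auto
    then have "n = -1 \<or> n = 0 \<or> n = 1" by linarith
    then show ?thesis using st n by auto
  qed
  have "continuous_on {0..1} e" unfolding e_def by (intro continuous_intros)
  then have "path (h \<circ> e)" unfolding path_def
    by (intro continuous_on_compose) (auto simp: e_onto intro: h)
  moreover have "loop_free (h \<circ> e)"
    unfolding loop_free_def using e_inj h(3) e_sphere by (auto simp: inj_on_def)
  ultimately have "simple_path (h \<circ> e)" by (simp add: simple_path_def)
  moreover have "pathfinish (h \<circ> e) = pathstart (h \<circ> e)"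
    by (simp add: pathfinish_def pathstart_def e)
  moreover have "path_image (h \<circ> e) = frontier K"
    by (simp only: path_image_def image_comp[symmetric] e_onto h(2))
  ultimately show thesis using that by blast
qed

section \<open>Coordinate lines and the boundary of a convex body\<close>

lemma interior_point_on_line:
  fixes K :: "(real^2) set"
  assumes "convex K" "interior K \<noteq> {}" "z \<in> K" "w \<in> K" "z $ i < c" "c < w $ i"
  obtains p where "p \<in> interior K" "p $ i = c"
proof -
  obtain q where q: "q \<in> interior K" using assms by blast
  have seg: "\<exists>p\<in>interior K. p $ i = c" if "v \<in> K" "q $ i < c \<and> c < v $ i \<or> v $ i < c \<and> c < q $ i" for v
  proof -
    define s where "s = (c - q $ i) / (v $ i - q $ i)"
    have s: "0 < s" "s < 1" using that(2) by (auto simp: s_def field_simps)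
    have "v \<noteq> q" using that by auto
    then have "(1 - s) *\<^sub>R q + s *\<^sub>R v \<in> open_segment q v" using s by (auto simp: in_segment)
    then have "(1 - s) *\<^sub>R q + s *\<^sub>R v \<in> interior K"
      using in_interior_closure_convex_segment[OF assms(1) q, of v] that(1) closure_subset by blast
    moreover have "((1 - s) *\<^sub>R q + s *\<^sub>R v) $ i = c"
    proof -
      have "s * (v $ i - q $ i) = c - q $ i" using that(2) by (auto simp: s_def)
      then show ?thesis by (simp add: algebra_simps)
    qed
    ultimately show ?thesis by blast
  qed
  consider "q $ i = c" | "q $ i < c" | "q $ i > c" by linarith
  then show thesis using that q seg[OF assms(3)] seg[OF assms(4)] assms by cases auto
qed

text \<open>An open segment from an interior point to a point of the closure stays in the
  interior.\<close>

lemma frontier_not_between_interior: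
  fixes K :: "(real^2) set"
  assumes "convex K" "p \<in> interior K" "x \<in> frontier K" "y \<in> frontier K"
    and "i \<noteq> j" "x $ i = p $ i" "y $ i = p $ i"
  shows "\<not> (p $ j < x $ j \<and> x $ j < y $ j)" "\<not> (p $ j > x $ j \<and> x $ j > y $ j)"
proof -
  have False if "p $ j < x $ j \<and> x $ j < y $ j \<or> p $ j > x $ j \<and> x $ j > y $ j"
  proof -
    define s where "s = (x $ j - p $ j) / (y $ j - p $ j)"
    have s: "0 < s" "s < 1" using that by (auto simp: s_def field_simps)
    have sj: "s * (y $ j - p $ j) = x $ j - p $ j" using that by (auto simp: s_def)
    have k: "k = i \<or> k = j" for k :: 2 using assms(5) by (metis exhaust_2)
    have "x $ k = ((1 - s) *\<^sub>R p + s *\<^sub>R y) $ k" for k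
      using k[of k] sj assms(6,7) by (auto simp: algebra_simps)
    then have "x = (1 - s) *\<^sub>R p + s *\<^sub>R y" by (intro vec_eq_iff[THEN iffD2] allI)
    moreover have "y \<noteq> p" using that by auto
    ultimately have "x \<in> open_segment p y" using s by (auto simp: in_segment)
    moreover have "y \<in> closure K" using assms(4) by (auto simp: frontier_def)
    ultimately have "x \<in> interior K" using in_interior_closure_convex_segment assms by blast
    then show False using assms(3) by (simp add: frontier_def)
  qed
  then show "\<not> (p $ j < x $ j \<and> x $ j < y $ j)" "\<not> (p $ j > x $ j \<and> x $ j > y $ j)" by blast+
qed

text \<open>The line passes through an interior point \<open>p\<close>. Each of its two rays from
  \<open>p\<close> carries at most one frontier point, and of three points two share a ray.\<close>

lemma frontier_meets_line_at_most_twice: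
  fixes K :: "(real^2) set"
  assumes "convex K" "interior K \<noteq> {}" "z \<in> K" "w \<in> K" "z $ i < c" "c < w $ i"
    and "x \<in> frontier K" "y \<in> frontier K" "v \<in> frontier K" "x $ i = c" "y $ i = c" "v $ i = c"
    and "x \<noteq> y" "y \<noteq> v" "x \<noteq> v"
  shows False
proof -
  obtain p where p: "p \<in> interior K" "p $ i = c" using interior_point_on_line assms(1-6) by metis
  obtain j :: 2 where j: "i \<noteq> j" by (metis exhaust_2 zero_neq_one)
  have k: "k = i \<or> k = j" for k :: 2 using j by (metis exhaust_2)
  have ne: "a $ j \<noteq> b $ j" if "a \<noteq> b" "a $ i = c" "b $ i = c" for a b :: "real^2"
  proof
    assume "a $ j = b $ j"
    then have "a $ l = b $ l" for l using k[of l] that by auto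
    then have "a = b" by (intro vec_eq_iff[THEN iffD2] allI)
    then show False using that by blast
  qed
  have pf: "a \<noteq> p" if "a \<in> frontier K" for a using p that by (auto simp: frontier_def)
  note B = frontier_not_between_interior[OF assms(1) p(1) _ _ j]
  have d: "x $ j \<noteq> y $ j" "y $ j \<noteq> v $ j" "x $ j \<noteq> v $ j" "x $ j \<noteq> p $ j" "y $ j \<noteq> p $ j" "v $ j \<noteq> p $ j"
    using ne[OF assms(13) assms(10,11)] ne[OF assms(14) assms(11,12)] ne[OF assms(15) assms(10,12)]
      ne[OF pf[OF assms(7)] assms(10) p(2)] ne[OF pf[OF assms(8)] assms(11) p(2)]
      ne[OF pf[OF assms(9)] assms(12) p(2)] by blast+
  have e: "x $ i = p $ i" "y $ i = p $ i" "v $ i = p $ i" using assms p by auto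
  note BB = B[OF assms(7) assms(8) e(1) e(2)] B[OF assms(8) assms(7) e(2) e(1)]
    B[OF assms(7) assms(9) e(1) e(3)] B[OF assms(9) assms(7) e(3) e(1)]
    B[OF assms(8) assms(9) e(2) e(3)] B[OF assms(9) assms(8) e(3) e(2)]
  show False using BB d by (smt (verit))
qed

lemma finite_card_le_2:
  assumes "\<And>x y z. \<lbrakk>x \<in> A; y \<in> A; z \<in> A; x \<noteq> y; y \<noteq> z; x \<noteq> z\<rbrakk> \<Longrightarrow> False"
  shows "finite A \<and> card A \<le> 2"
proof (rule ccontr)
  assume "\<not> ?thesis"
  then have "infinite A \<or> 3 \<le> card A" by auto
  then have "\<exists>B\<subseteq>A. card B = 3"
  proof
    assume "infinite A"
    from infinite_arbitrarily_large[OF this, of 3] show ?thesis by auto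
  next
    assume "3 \<le> card A"
    then obtain B where "B \<subseteq> A" "card B = 3" by (rule obtain_subset_with_card_n)
    then show ?thesis by auto
  qed
  then obtain B where B: "B \<subseteq> A" "card B = 3" by blast
  then obtain x y z where "B = {x, y, z}" "x \<noteq> y" "y \<noteq> z" "x \<noteq> z" by (auto simp: card_3_iff)
  then show False using assms[of x y z] B(1) by auto
qed

text \<open>Each level in the range is attained at most twice, so integrating the number of crossings
  over all levels bounds the variation (Banach's indicatrix).\<close>

lemma variation_le_of_two_crossings:
  fixes f :: "real \<Rightarrow> real"
  assumes cont: "continuous_on {0..1} f" and range: "\<And>t. t \<in> {0..1} \<Longrightarrow> m \<le> f t \<and> f t \<le> M"
    and two: "\<And>c. \<lbrakk>m < c; c < M\<rbrakk> \<Longrightarrow> finite {t\<in>{0<..<1}. f t = c} \<and> card {t\<in>{0<..<1}. f t = c} \<le> 2"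
    and t: "\<And>i. i \<le> k \<Longrightarrow> t i \<in> {0..1}" "\<And>i. i < k \<Longrightarrow> t i \<le> t (Suc i)"
  shows "(\<Sum>i<k. \<bar>f (t i) - f (t (Suc i))\<bar>) \<le> 2 * (M - m)"
proof -
  \<comment> \<open>The intervals are open: a level in \<open>J i\<close> is not taken at
    \<open>t i\<close> or \<open>t (Suc i)\<close>, so it is taken strictly in between, and
    different \<open>i\<close> yield different parameters.\<close>
  define J where "J i = {min (f (t i)) (f (t (Suc i)))<..<max (f (t i)) (f (t (Suc i)))}" for i
  have mono: "t i \<le> t j" if "i \<le> j" "j \<le> k" for i j
    using that
  proof (induction j)
    case (Suc j)
    show ?case
    proof (cases "i = Suc j")
      case False
      then have "i \<le> j" "j < k" using Suc.prems by auto
      then show ?thesis using Suc.IH t(2)[of j] by force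
    qed simp
  qed simp
  have mM: "m \<le> M" using range[of 0] by auto
  have J: "J i \<subseteq> {m<..<M}" if "i < k" for i
    using range[OF t(1)[of i]] range[OF t(1)[of "Suc i"]] that by (auto simp: J_def)
  have count: "card {i\<in>{..<k}. c \<in> J i} \<le> 2" if c: "m < c" "c < M" for c
  proof -
    let ?A = "{i\<in>{..<k}. c \<in> J i}"
    have "\<exists>s. t i < s \<and> s < t (Suc i) \<and> f s = c" if "i \<in> ?A" for i
    proof -
      have i: "i < k" "c \<in> J i" using that by auto
      have le: "t i \<le> t (Suc i)" using t i by blast
      have sub: "{t i..t (Suc i)} \<subseteq> {0..1}" using t(1)[of i] t(1)[of "Suc i"] i by auto
      have c': "continuous_on {t i..t (Suc i)} f" by (rule continuous_on_subset[OF cont sub])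
      have "\<exists>s\<ge>t i. s \<le> t (Suc i) \<and> f s = c"
      proof (cases "f (t i) \<le> f (t (Suc i))")
        case True
        then show ?thesis using IVT'[of f "t i" c "t (Suc i)"] i(2) le c' by (auto simp: J_def)
      next
        case False
        then show ?thesis using IVT2'[of f "t (Suc i)" c "t i"] i(2) le c' by (auto simp: J_def)
      qed
      then obtain s where s: "s \<ge> t i" "s \<le> t (Suc i)" "f s = c" by blast
      have "f (t i) \<noteq> c" "f (t (Suc i)) \<noteq> c" using i(2) by (auto simp: J_def)
      then have "s \<noteq> t i" "s \<noteq> t (Suc i)" using s by auto
      then show ?thesis using s by (intro exI[of _ s]) auto
    qed
    then obtain \<tau> where \<tau>: "\<And>i. i \<in> ?A \<Longrightarrow> t i < \<tau> i \<and> \<tau> i < t (Suc i) \<and> f (\<tau> i) = c" by metis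
    have "inj_on \<tau> ?A"
    proof (rule linorder_inj_onI')
      fix i j assume ij: "i \<in> ?A" "j \<in> ?A" "i < j"
      then have "t (Suc i) \<le> t j" using mono[of "Suc i" j] by auto
      then show "\<tau> i \<noteq> \<tau> j" using \<tau>[OF ij(1)] \<tau>[OF ij(2)] by linarith
    qed
    moreover have "\<tau> ` ?A \<subseteq> {s\<in>{0<..<1}. f s = c}"
    proof
      fix s assume "s \<in> \<tau> ` ?A"
      then obtain i where i: "i \<in> ?A" "s = \<tau> i" by blast
      then show "s \<in> {s\<in>{0<..<1}. f s = c}" using \<tau>[OF i(1)] t(1)[of i] t(1)[of "Suc i"] by auto
    qed
    ultimately show ?thesis using two[OF c] card_mono card_image by (metis (no_types, lifting) le_trans)
  qed
  have "(\<Sum>i<k. \<bar>f (t i) - f (t (Suc i))\<bar>) = (\<Sum>i<k. measure lborel (J i))"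
    by (intro sum.cong) (auto simp: J_def min_def max_def)
  also have "\<dots> = (\<Sum>i<k. integral\<^sup>L lborel (indicat_real (J i)))"
    by (simp add: J_def)
  also have "\<dots> = integral\<^sup>L lborel (\<lambda>c. \<Sum>i<k. indicat_real (J i) c)"
    by (rule Bochner_Integration.integral_sum[symmetric]) (auto simp: J_def)
  also have "\<dots> \<le> integral\<^sup>L lborel (\<lambda>c. 2 * indicat_real {m<..<M} c)"
  proof (rule integral_mono)
    show "(\<Sum>i<k. indicat_real (J i) c) \<le> 2 * indicat_real {m<..<M} c" for c
    proof (cases "c \<in> {m<..<M}")
      case True
      have "(\<Sum>i<k. indicat_real (J i) c) = real (card {i\<in>{..<k}. c \<in> J i})"
        by (simp add: indicator_def sum.If_cases Int_def)
      then show ?thesis using count[of c] True by simp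
    next
      case False
      then have "indicat_real (J i) c = 0" if "i < k" for i using J[OF that] by (auto simp: indicator_def)
      then show ?thesis using False by simp
    qed
  qed (auto simp: J_def mM intro!: integrable_mult_right integrable_real_indicator Bochner_Integration.integrable_sum)
  also have "\<dots> = 2 * (M - m)" using mM by simp
  finally show ?thesis .
qed

section \<open>Bounds for the lengths of inscribed chains\<close>

definition chain_lengths :: "(real \<Rightarrow> real^2) \<Rightarrow> real set" where
  "chain_lengths g = {(\<Sum>i<k. dist (g (t i)) (g (t (Suc i)))) | k t.
            (\<forall>i\<le>k. t i \<in> {0..1}) \<and> (\<forall>i<k. t i \<le> t (Suc i))}"

lemma path_length_chain_lengths: "path_length g = Sup (chain_lengths g)"
  by (simp add: path_length_def chain_lengths_def)

text \<open>Each coordinate along the loop takes every level strictly inside its range at most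
  twice, so its variation is at most twice the width of \<open>K\<close> and thus at most
  \<open>2 * \<delta>\<close>. The length is bounded by the variations of the two coordinates, hence
  the factor 4.\<close>

lemma chain_length_le:
  assumes K: "convex_body K" and diam: "\<And>x y. \<lbrakk>x \<in> K; y \<in> K\<rbrakk> \<Longrightarrow> dist x y \<le> \<delta>"
    and g: "simple_path g" "path_image g = frontier K" and l: "l \<in> chain_lengths g"
  shows "l \<le> 4 * \<delta>"
proof -
  have cK: "compact K" "convex K" "interior K \<noteq> {}" using K by (auto simp: convex_body_def)
  have sub: "frontier K \<subseteq> K" using cK(1) compact_imp_closed frontier_subset_closed by blast
  obtain k t where l: "l = (\<Sum>i<k. dist (g (t i)) (g (t (Suc i))))"
    and t: "\<And>i. i \<le> k \<Longrightarrow> t i \<in> {0..1}" "\<And>i. i < k \<Longrightarrow> t i \<le> t (Suc i)"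
    using l by (auto simp: chain_lengths_def)
  have gf: "g s \<in> frontier K" if "s \<in> {0..1}" for s using g(2) that by (auto simp: path_image_def)
  have var: "(\<Sum>i<k. \<bar>g (t i) $ r - g (t (Suc i)) $ r\<bar>) \<le> 2 * \<delta>" for r
  proof -
    have ne: "K \<noteq> {}" using cK(3) interior_subset by auto
    have co: "continuous_on K (\<lambda>z. z $ r)" by (intro continuous_intros)
    obtain z where z: "z \<in> K" "\<And>y. y \<in> K \<Longrightarrow> z $ r \<le> y $ r"
      using continuous_attains_inf[OF cK(1) ne co] by blast
    obtain w where w: "w \<in> K" "\<And>y. y \<in> K \<Longrightarrow> y $ r \<le> w $ r"
      using continuous_attains_sup[OF cK(1) ne co] by blast
    have "(\<Sum>i<k. \<bar>g (t i) $ r - g (t (Suc i)) $ r\<bar>) \<le> 2 * (w $ r - z $ r)"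
    proof (rule variation_le_of_two_crossings[of "\<lambda>s. g s $ r"])
      show "continuous_on {0..1} (\<lambda>s. g s $ r)"
        using g(1) by (auto simp: simple_path_def path_def intro!: continuous_intros)
      show "z $ r \<le> g s $ r \<and> g s $ r \<le> w $ r" if "s \<in> {0..1}" for s
        using gf[OF that] sub z w by blast
      fix c assume c: "z $ r < c" "c < w $ r"
      \<comment> \<open>The open parameter interval is used because a loop takes its base point at
        both ends.\<close>
      have inj: "g x \<noteq> g y" if "x \<noteq> y" "x \<in> {0<..<1}" "y \<in> {0<..<1}" for x y
      proof -
        have "x \<in> {0..1}" "y \<in> {0..1}" using that by auto
        then show ?thesis using g(1) that unfolding simple_path_def loop_free_def by fastforce
      qed
      show "finite {s \<in> {0<..<1}. g s $ r = c} \<and> card {s \<in> {0<..<1}. g s $ r = c} \<le> 2"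
      proof (rule finite_card_le_2)
        fix a b d assume "a \<in> {s \<in> {0<..<1}. g s $ r = c}" "b \<in> {s \<in> {0<..<1}. g s $ r = c}"
          "d \<in> {s \<in> {0<..<1}. g s $ r = c}" "a \<noteq> b" "b \<noteq> d" "a \<noteq> d"
        then show False
          using frontier_meets_line_at_most_twice[OF cK(2,3) z(1) w(1) c, of "g a" "g b" "g d"] inj gf by auto
      qed
    qed (use t in auto)
    also have "w $ r - z $ r \<le> norm (w - z)" using component_le_norm_cart[of "w - z" r] by simp
    then have "2 * (w $ r - z $ r) \<le> 2 * \<delta>" using diam[OF w(1) z(1)] by (simp add: dist_norm)
    finally show ?thesis .
  qed
  have "l \<le> (\<Sum>i<k. \<bar>g (t i) $ 1 - g (t (Suc i)) $ 1\<bar> + \<bar>g (t i) $ 2 - g (t (Suc i)) $ 2\<bar>)"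
    unfolding l
  proof (rule sum_mono)
    show "dist (g (t i)) (g (t (Suc i))) \<le> \<bar>g (t i) $ 1 - g (t (Suc i)) $ 1\<bar> + \<bar>g (t i) $ 2 - g (t (Suc i)) $ 2\<bar>" for i
      using norm_le_l1_cart[of "g (t i) - g (t (Suc i))"] by (simp add: dist_norm sum_2)
  qed
  also have "\<dots> \<le> 4 * \<delta>" using var[of 1] var[of 2] by (simp add: sum.distrib)
  finally show ?thesis .
qed

lemma chain_lengths_nonempty: "chain_lengths g \<noteq> {}"
proof -
  have "(\<Sum>i<0. dist (g ((\<lambda>_. 0) i)) (g ((\<lambda>_. 0) (Suc i)))) \<in> chain_lengths g"
    unfolding chain_lengths_def by (rule CollectI, rule exI[of _ 0], rule exI[of _ "\<lambda>_. 0"]) simp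
  then show ?thesis by blast
qed

lemma perimeter_le:
  assumes K: "convex_body K" and diam: "\<And>x y. \<lbrakk>x \<in> K; y \<in> K\<rbrakk> \<Longrightarrow> dist x y \<le> \<delta>"
  shows "perimeter K \<le> 4 * \<delta>"
  unfolding perimeter_def
proof (rule cSup_least)
  show "{path_length g | g. simple_path g \<and> pathfinish g = pathstart g \<and> path_image g = frontier K} \<noteq> {}"
  proof -
    obtain g where "simple_path g" "pathfinish g = pathstart g" "path_image g = frontier K"
      by (rule frontier_loop_exists[OF K])
    then show ?thesis by blast
  qed
next
  fix x assume "x \<in> {path_length g | g. simple_path g \<and> pathfinish g = pathstart g \<and> path_image g = frontier K}"
  then obtain g where g: "x = path_length g" "simple_path g" "path_image g = frontier K" by blast
  show "x \<le> 4 * \<delta>" unfolding g(1) path_length_chain_lengths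
    by (rule cSup_least[OF chain_lengths_nonempty]) (rule chain_length_le[OF K diam g(2,3)])
qed

text \<open>A chain with a single edge has this length. The uniform bound on chain lengths
  guarantees that both suprema are finite and so dominate their elements.\<close>

lemma dist_le_perimeter:
  assumes K: "convex_body K" and ab: "a \<in> frontier K" "b \<in> frontier K"
  shows "dist a b \<le> perimeter K"
proof -
  have "bounded K" using K by (simp add: convex_body_def compact_imp_bounded)
  then have diam: "\<And>x y. \<lbrakk>x \<in> K; y \<in> K\<rbrakk> \<Longrightarrow> dist x y \<le> diameter K" by (rule diameter_bounded_bound)
  obtain g where g: "simple_path g" "pathfinish g = pathstart g" "path_image g = frontier K"
    by (rule frontier_loop_exists[OF K])
  have bdd: "bdd_above (chain_lengths h)" if "simple_path h" "path_image h = frontier K" for h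
    using chain_length_le[OF K diam that] by (intro bdd_aboveI)
  have le: "dist (g r) (g s) \<in> chain_lengths g" if "r \<in> {0..1}" "s \<in> {0..1}" "r \<le> s" for r s
  proof -
    have "(\<Sum>i<1. dist (g ((\<lambda>i. if i = 0 then r else s) i)) (g ((\<lambda>i. if i = 0 then r else s) (Suc i)))) \<in> chain_lengths g"
      unfolding chain_lengths_def
      by (rule CollectI, rule exI[of _ 1], rule exI[of _ "\<lambda>i. if i = 0 then r else s"]) (use that in auto)
    then show ?thesis by simp
  qed
  obtain r s where rs: "r \<in> {0..1}" "s \<in> {0..1}" "a = g r" "b = g s"
    using ab g(3) by (metis imageE path_image_def)
  have "dist a b \<in> chain_lengths g"
    using le[of r s] le[of s r] rs by (cases "r \<le> s") (auto simp: dist_commute)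
  then have "dist a b \<le> path_length g"
    unfolding path_length_chain_lengths by (rule cSup_upper) (rule bdd[OF g(1,3)])
  also have "\<dots> \<le> perimeter K" unfolding perimeter_def
  proof (rule cSup_upper)
    show "bdd_above {path_length g | g. simple_path g \<and> pathfinish g = pathstart g \<and> path_image g = frontier K}"
    proof (rule bdd_aboveI)
      fix x assume "x \<in> {path_length g | g. simple_path g \<and> pathfinish g = pathstart g \<and> path_image g = frontier K}"
      then obtain g where g: "x = path_length g" "simple_path g" "path_image g = frontier K" by blast
      show "x \<le> 4 * diameter K" unfolding g(1) path_length_chain_lengths
        by (rule cSup_least[OF chain_lengths_nonempty]) (rule chain_length_le[OF K diam g(2,3)])
    qed
  qed (use g in blast)
  finally show ?thesis .
qed

section \<open>The upper bound\<close>

lemma measure_interior_convex: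
  fixes K :: "(real^2) set"
  assumes "convex K" "bounded K"
  shows "measure lebesgue (interior K) = measure lebesgue K"
  using measure_interior[OF assms(2) negligible_convex_frontier[OF assms(1)]] .

lemma convex_body_measure_pos:
  assumes "convex_body K"
  shows "measure lebesgue K > 0"
proof -
  have K: "convex K" "bounded K" "interior K \<noteq> {}" using assms by (auto simp: convex_body_def compact_imp_bounded)
  have "\<not> negligible (interior K)" using K(3) open_not_negligible by blast
  then have "measure lebesgue (interior K) \<noteq> 0"
    using negligible_iff_measure0[of "interior K"] lmeasurable_interior[OF K(2)] by auto
  then show ?thesis using measure_interior_convex[OF K(1,2)] measure_nonneg[of lebesgue K] by linarith
qed

text \<open>Shrinking \<open>D\<close> towards an interior point \<open>z\<close> moves it away from its boundary.\<close>

lemma frontier_neighbourhood_measure: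
  assumes D: "convex_body D"
  shows "\<exists>c. \<forall>r>0. \<exists>N\<in>lmeasurable. measure lebesgue N \<le> c * r \<and>
           (\<forall>x\<in>D. \<forall>q\<in>frontier D. dist x q < r \<longrightarrow> x \<in> N)"
proof -
  have cD: "compact D" "convex D" "interior D \<noteq> {}" using D by (auto simp: convex_body_def)
  obtain z \<epsilon> where z: "\<epsilon> > 0" "ball z \<epsilon> \<subseteq> D" using cD(3) by (auto simp: interior_def open_contains_ball) blast
  have mD: "D \<in> lmeasurable" using cD(1) by (rule lmeasurable_compact)
  have zD: "z \<in> D" using z by (auto simp: subset_iff)
  have "\<exists>N\<in>lmeasurable. measure lebesgue N \<le> (2 * measure lebesgue D / \<epsilon>) * r \<and>
           (\<forall>x\<in>D. \<forall>q\<in>frontier D. dist x q < r \<longrightarrow> x \<in> N)" if r: "r > 0" for r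
  proof (cases "r < \<epsilon>")
    case False
    have "measure lebesgue D * \<epsilon> \<le> measure lebesgue D * (2 * r)" using False r by (intro mult_left_mono) auto
    then have "measure lebesgue D \<le> (2 * measure lebesgue D / \<epsilon>) * r"
      using z(1) by (simp add: field_simps)
    then show ?thesis using mD by blast
  next
    case True
    \<comment> \<open>Chosen so that \<open>(1 - s) * \<epsilon> = r\<close>: since \<open>D\<close>
      contains the ball of radius \<open>\<epsilon>\<close> about \<open>z\<close>, every point of
      the shrunken body \<open>E\<close> is the centre of a ball of radius \<open>r\<close> inside
      \<open>D\<close>. Hence \<open>D - E\<close> serves as \<open>N\<close>, and its area is of
      order \<open>1 - s\<close>.\<close>
    define s where "s = 1 - r / \<epsilon>"
    have s: "0 < s" "s < 1" using True r z(1) by (auto simp: s_def)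
    define E where "E = (\<lambda>x. s *\<^sub>R x + (1 - s) *\<^sub>R z) ` D"
    have mE: "E \<in> lmeasurable" unfolding E_def
      by (intro lmeasurable_compact compact_continuous_image continuous_intros cD)
    have ED: "E \<subseteq> D" unfolding E_def
      using s zD by (auto intro!: convexD[OF cD(2)])
    have "measure lebesgue E = s^2 * measure lebesgue D"
      unfolding E_def using measure_lebesgue_affine[of s "(1 - s) *\<^sub>R z" D] s by simp
    then have "measure lebesgue (D - E) = (1 - s^2) * measure lebesgue D"
      using measurable_measure_Diff[OF mD fmeasurableD[OF mE] ED] by (simp only: left_diff_distrib mult_1)
    also have "\<dots> \<le> (2 * (1 - s)) * measure lebesgue D"
    proof (rule mult_right_mono)
      have "0 \<le> (1 - s)^2" by simp
      then show "1 - s^2 \<le> 2 * (1 - s)" by (simp add: power2_eq_square algebra_simps)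
    qed simp
    also have "\<dots> = (2 * measure lebesgue D / \<epsilon>) * r" by (simp add: s_def)
    finally have m: "measure lebesgue (D - E) \<le> (2 * measure lebesgue D / \<epsilon>) * r" .
    have "x \<notin> E" if x: "x \<in> D" "q \<in> frontier D" "dist x q < r" for x q
    proof
      assume "x \<in> E"
      then obtain y where y: "y \<in> D" "x = s *\<^sub>R y + (1 - s) *\<^sub>R z" by (auto simp: E_def)
      have "ball x r \<subseteq> D"
      proof
        fix w assume "w \<in> ball x r"
        then have w: "norm (w - x) < r" by (simp add: dist_norm norm_minus_commute)
        \<comment> \<open>The solution of \<open>w = s *\<^sub>R y + (1 - s) *\<^sub>R v\<close>; it
          lies within \<open>\<epsilon>\<close> of \<open>z\<close>, so \<open>w\<close> is a convex
          combination of two points of \<open>D\<close>.\<close>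
        define v where "v = z + (1 / (1 - s)) *\<^sub>R (w - x)"
        have "norm ((1 / (1 - s)) *\<^sub>R (w - x)) < \<epsilon>"
        proof -
          have "1 / (1 - s) = \<epsilon> / r" by (simp add: s_def)
          moreover have "\<epsilon> / r * norm (w - x) < \<epsilon>" using w r z(1) by (simp add: field_simps)
          ultimately show ?thesis using r z(1) by (simp only: norm_scaleR) simp
        qed
        then have "v \<in> D" using z(2) by (auto simp: v_def subset_iff dist_norm)
        moreover have "w = s *\<^sub>R y + (1 - s) *\<^sub>R v"
          using s by (simp add: v_def y(2) scaleR_add_right)
        ultimately show "w \<in> D" using convexD[OF cD(2) y(1), of v s "1 - s"] s by auto
      qed
      then have "q \<in> interior D" using x(3) by (meson centre_in_ball interior_maximal open_ball mem_ball subsetD)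
      then show False using x(2) by (simp add: frontier_def)
    qed
    then show ?thesis using m mD mE by (intro bexI[of _ "D - E"]) auto
  qed
  then show ?thesis by blast
qed

definition homothety :: "real \<Rightarrow> real^2 \<Rightarrow> real^2 \<Rightarrow> real^2" where
  "homothety \<mu> v x = \<mu> *\<^sub>R x + v"

definition homothet_family :: "(real^2) set \<Rightarrow> (real^2) set \<Rightarrow> (real^2) set set \<Rightarrow> ((real^2) set \<Rightarrow> real) \<Rightarrow> bool" where
  "homothet_family C D S \<mu> \<longleftrightarrow> packing_in D S \<and>
     (\<forall>K\<in>S. \<mu> K > 0 \<and> (\<exists>v. homothety (\<mu> K) v ` C = K) \<and> touches_boundary D K)"

lemma large_homothets_count:
  assumes C: "convex_body C" and D: "convex_body D"
  shows "\<exists>c\<ge>0. \<forall>S \<mu> r. homothet_family C D S \<mu> \<longrightarrow> r > 0 \<longrightarrow> r * real (card {K\<in>S. r \<le> \<mu> K}) \<le> c"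
proof -
  have cC: "compact C" "convex C" "interior C \<noteq> {}" using C by (auto simp: convex_body_def)
  \<comment> \<open>The summand 1 makes \<open>\<delta>\<close> positive and the distances within
    \<open>C\<close> strictly smaller than \<open>\<delta>\<close>, as the open neighbourhood of the
    frontier requires.\<close>
  define \<delta> where "\<delta> = diameter C + 1"
  have \<delta>: "\<delta> > 0" using diameter_ge_0[OF compact_imp_bounded[OF cC(1)]] by (simp add: \<delta>_def)
  have diam: "dist x y < \<delta>" if "x \<in> C" "y \<in> C" for x y
    using diameter_bounded_bound[OF compact_imp_bounded[OF cC(1)] that] by (simp add: \<delta>_def)
  define m where "m = measure lebesgue C"
  have m: "m > 0" unfolding m_def by (rule convex_body_measure_pos[OF C])
  obtain c where c: "\<And>r. r > 0 \<Longrightarrow> \<exists>N\<in>lmeasurable. measure lebesgue N \<le> c * r \<and>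
           (\<forall>x\<in>D. \<forall>q\<in>frontier D. dist x q < r \<longrightarrow> x \<in> N)"
    using frontier_neighbourhood_measure[OF D] by blast
  have bound: "r * real (card {K\<in>S. r \<le> \<mu> K}) \<le> c * \<delta> / m"
    if fam: "homothet_family C D S \<mu>" and r: "r > 0" for S \<mu> r
  proof -
    have S: "packing_in D S" and \<mu>: "\<And>K. K \<in> S \<Longrightarrow> \<mu> K > 0 \<and> (\<exists>v. homothety (\<mu> K) v ` C = K) \<and> touches_boundary D K"
      using fam by (auto simp: homothet_family_def)
    let ?T = "{K\<in>S. r \<le> \<mu> K}"
    have fin: "finite ?T" using S by (auto simp: packing_in_def)
    obtain N where N: "N \<in> lmeasurable" "measure lebesgue N \<le> c * (r * \<delta>)"
      "\<And>x q. \<lbrakk>x \<in> D; q \<in> frontier D; dist x q < r * \<delta>\<rbrakk> \<Longrightarrow> x \<in> N"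
      using c[of "r * \<delta>"] r \<delta> by auto
    \<comment> \<open>\<open>U\<close> will be the interior of the copy shrunk to ratio
      \<open>r\<close>. The area is the same for all members, and interiors are used because only
      the interiors of the bodies are disjoint.\<close>
    define Q where "Q = (\<lambda>K U. open U \<and> U \<subseteq> interior K \<and> U \<subseteq> N \<and> U \<in> lmeasurable \<and> measure lebesgue U = r^2 * m)"
    have "\<exists>U. Q K U" if K: "K \<in> ?T" for K
    proof -
      have cK: "convex K" "compact K" and KD: "K \<subseteq> D" using K S by (auto simp: packing_in_def convex_body_def)
      obtain v where v: "homothety (\<mu> K) v ` C = K" using \<mu> K by blast
      obtain q where q: "q \<in> K" "q \<in> frontier D" using \<mu> K by (auto simp: touches_boundary_def)
      have \<mu>K: "\<mu> K > 0" "r \<le> \<mu> K" using \<mu> K by auto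
      define s where "s = r / \<mu> K"
      have s: "0 < s" "s \<le> 1" using r \<mu>K by (auto simp: s_def)
      define L where "L = (\<lambda>x. s *\<^sub>R x + (1 - s) *\<^sub>R q) ` K"
      have LK: "L \<subseteq> K" unfolding L_def using s q by (auto intro!: convexD[OF cK(1)])
      have cL: "compact L" unfolding L_def by (intro compact_continuous_image continuous_intros cK)
      have convL: "convex L"
        unfolding L_def using convex_affinity[OF cK(1), of "(1 - s) *\<^sub>R q" s] by (simp add: add.commute)
      have LN: "L \<subseteq> N"
      proof
        fix w assume "w \<in> L"
        then obtain x where x: "x \<in> K" "w = s *\<^sub>R x + (1 - s) *\<^sub>R q" by (auto simp: L_def)
        obtain a b where ab: "a \<in> C" "b \<in> C" "x = homothety (\<mu> K) v a" "q = homothety (\<mu> K) v b"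
          using x(1) q(1) v by (metis imageE)
        have "w - q = s *\<^sub>R (x - q)" by (simp add: x(2) algebra_simps)
        moreover have "x - q = \<mu> K *\<^sub>R (a - b)" by (simp add: ab homothety_def algebra_simps)
        ultimately have "w - q = r *\<^sub>R (a - b)" using \<mu>K by (simp add: s_def)
        then have "dist w q = r * dist a b" using r by (simp add: dist_norm)
        also have "\<dots> < r * \<delta>" using diam[OF ab(1,2)] r by simp
        finally show "w \<in> N" using N(3)[of w q] \<open>w \<in> L\<close> LK KD q by blast
      qed
      have "measure lebesgue L = s^2 * measure lebesgue K"
        unfolding L_def using measure_lebesgue_affine[of s "(1 - s) *\<^sub>R q" K] s by simp
      moreover have "measure lebesgue (homothety (\<mu> K) v ` C) = (\<mu> K)^2 * m"
        unfolding homothety_def m_def using measure_lebesgue_affine[of "\<mu> K" v C] \<mu>K by simp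
      then have "measure lebesgue K = (\<mu> K)^2 * m" using v by simp
      ultimately have "measure lebesgue L = r^2 * m" using \<mu>K by (simp add: s_def power_divide)
      then have "measure lebesgue (interior L) = r^2 * m"
        using measure_interior_convex[OF convL] compact_imp_bounded[OF cL] by simp
      then show ?thesis
        using LK LN interior_subset[of L] lmeasurable_interior[OF compact_imp_bounded[OF cL]]
        unfolding Q_def by (intro exI[of _ "interior L"]) (auto dest: interior_mono)
    qed
    then obtain U where "\<forall>K\<in>?T. Q K (U K)" using bchoice[of ?T Q] by blast
    then have U: "\<And>K. K \<in> ?T \<Longrightarrow> open (U K) \<and> U K \<subseteq> interior K \<and> U K \<subseteq> N \<and> U K \<in> lmeasurable \<and> measure lebesgue (U K) = r^2 * m"
      unfolding Q_def by blast
    have "measure lebesgue (\<Union>K\<in>?T. U K) = (\<Sum>K\<in>?T. measure lebesgue (U K))"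
    proof (rule measure_UNION'[OF fin])
      show "pairwise (\<lambda>K L. disjnt (U K) (U L)) ?T"
        unfolding pairwise_def
      proof (intro ballI impI)
        fix K L assume KL: "K \<in> ?T" "L \<in> ?T" "K \<noteq> L"
        then have "interior K \<inter> interior L = {}" using S by (auto simp: packing_in_def)
        then show "disjnt (U K) (U L)" using U[OF KL(1)] U[OF KL(2)] unfolding disjnt_def by blast
      qed
    qed (use U in auto)
    also have "\<dots> = (\<Sum>K\<in>?T. r^2 * m)" by (rule sum.cong[OF refl]) (use U in blast)
    also have "\<dots> = real (card ?T) * (r^2 * m)" by (simp only: sum_constant)
    finally have "real (card ?T) * (r^2 * m) = measure lebesgue (\<Union>K\<in>?T. U K)" by simp
    also have "\<dots> \<le> measure lebesgue N"
      by (rule measure_mono_fmeasurable) (use U N(1) in blast, use U fin in \<open>intro fmeasurableD fmeasurable.finite_UN; blast\<close>, rule N(1))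
    also have "\<dots> \<le> c * (r * \<delta>)" by (rule N)
    finally have "(r * real (card ?T) * m) * r \<le> (c * \<delta>) * r" by (simp add: power2_eq_square mult_ac)
    then have "r * real (card ?T) * m \<le> c * \<delta>" using r by (rule mult_right_le_imp_le)
    then show ?thesis using m by (simp add: field_simps)
  qed
  have "r * real (card {K\<in>S. r \<le> \<mu> K}) \<le> \<bar>c * \<delta> / m\<bar>"
    if "homothet_family C D S \<mu>" "r > 0" for S \<mu> r
    using bound[OF that] by linarith
  then show ?thesis by (intro exI[of _ "\<bar>c * \<delta> / m\<bar>"]) auto
qed

text \<open>Induction by removing the smallest value: the hypothesis with \<open>r\<close> equal to
  this value shows that it is at most \<open>c / card S\<close>. The harmonic sum is absorbed step
  by step through \<open>1 / (n + 1) \<le> ln (n + 1) - ln n\<close>.\<close>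

lemma sum_le_of_weak_bound:
  fixes \<mu> :: "'a \<Rightarrow> real"
  assumes "finite S" "S \<noteq> {}" "c \<ge> 0"
    and "\<And>K. K \<in> S \<Longrightarrow> \<mu> K > 0" "\<And>r. r > 0 \<Longrightarrow> r * real (card {K\<in>S. r \<le> \<mu> K}) \<le> c"
  shows "sum \<mu> S \<le> c * (1 + ln (real (card S)))"
  using assms
proof (induction "card S" arbitrary: S)
  case 0
  then show ?case by simp
next
  case (Suc n)
  obtain K where K: "K \<in> S" "\<And>L. L \<in> S \<Longrightarrow> \<mu> K \<le> \<mu> L"
    using Suc.prems(1,2) by (metis arg_min_if_finite(1) arg_min_least)
  have "{L\<in>S. \<mu> K \<le> \<mu> L} = S" using K by auto
  then have bK: "\<mu> K * real (card S) \<le> c" using Suc.prems(5)[of "\<mu> K"] Suc.prems(4)[OF K(1)] by simp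
  have n: "card (S - {K}) = n" using Suc K by simp
  show ?case
  proof (cases "n = 0")
    case True
    then have "S - {K} = {}" using n Suc.prems(1) by (metis card_0_eq finite_Diff)
    then have "S = {K}" using K(1) by blast
    then show ?thesis using bK by simp
  next
    case False
    have "sum \<mu> (S - {K}) \<le> c * (1 + ln (real (card (S - {K}))))"
    proof (rule Suc.hyps(1))
      show "S - {K} \<noteq> {}" using n False by (metis card.empty)
      show "r * real (card {L \<in> S - {K}. r \<le> \<mu> L}) \<le> c" if "r > 0" for r
      proof -
        have "card {L \<in> S - {K}. r \<le> \<mu> L} \<le> card {L \<in> S. r \<le> \<mu> L}"
          using Suc.prems(1) by (intro card_mono) auto
        then have "r * real (card {L \<in> S - {K}. r \<le> \<mu> L}) \<le> r * real (card {L \<in> S. r \<le> \<mu> L})"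
          using that by simp
        then show ?thesis using Suc.prems(5)[OF that] by linarith
      qed
    qed (use n Suc.prems in auto)
    then have "sum \<mu> S \<le> \<mu> K + c * (1 + ln (real n))"
      using sum.remove[OF Suc.prems(1) K(1), of \<mu>] n by simp
    moreover have "\<mu> K \<le> c * (1 / real (Suc n))" using bK Suc.hyps(2) by (simp add: field_simps)
    moreover have "1 / real (Suc n) \<le> ln (real (Suc n)) - ln (real n)"
    proof -
      have "ln (real n / real (Suc n)) \<le> real n / real (Suc n) - 1"
        by (rule ln_le_minus_one) (use False in auto)
      also have "\<dots> = - (1 / real (Suc n))" by (simp add: field_simps)
      finally show ?thesis using False by (simp add: ln_div)
    qed
    then have "c * (1 / real (Suc n)) \<le> c * (ln (real (Suc n)) - ln (real n))"
      using \<open>c \<ge> 0\<close> by (rule mult_left_mono)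
    ultimately show ?thesis unfolding Suc.hyps(2)[symmetric] by (simp add: algebra_simps)
  qed
qed

lemma perimeter_homothet_le:
  assumes C: "convex_body C" and K: "convex_body K" "homothety \<mu> v ` C = K" "\<mu> > 0"
  shows "perimeter K \<le> 4 * diameter C * \<mu>"
proof -
  have "perimeter K \<le> 4 * (\<mu> * diameter C)"
  proof (rule perimeter_le[OF K(1)])
    fix x y assume "x \<in> K" "y \<in> K"
    then obtain a b where ab: "a \<in> C" "b \<in> C" "x = homothety \<mu> v a" "y = homothety \<mu> v b" using K(2) by blast
    have "x - y = \<mu> *\<^sub>R (a - b)" by (simp add: ab homothety_def algebra_simps)
    then have "dist x y = \<mu> * dist a b" using K(3) by (simp add: dist_norm)
    also have "dist a b \<le> diameter C"
      using ab C by (intro diameter_bounded_bound) (auto simp: convex_body_def compact_imp_bounded)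
    finally show "dist x y \<le> \<mu> * diameter C" using K(3) by simp
  qed
  then show ?thesis by (simp add: mult_ac)
qed

lemma total_perimeter_upper_bound:
  assumes C: "convex_body C" and D: "convex_body D"
  shows "\<exists>\<rho>::real. \<forall>n::nat. n \<ge> 2 \<longrightarrow>
            (\<forall>S. boundary_homothet_packing C D n S \<longrightarrow> total_perimeter S \<le> \<rho> * log 2 (real n))"
proof -
  obtain c where c: "c \<ge> 0"
    "\<And>S \<mu> r. homothet_family C D S \<mu> \<Longrightarrow> r > 0 \<Longrightarrow> r * real (card {K\<in>S. r \<le> \<mu> K}) \<le> c"
    using large_homothets_count[OF C D] by blast
  have d: "diameter C \<ge> 0" using C by (simp add: convex_body_def compact_imp_bounded diameter_ge_0)
  \<comment> \<open>The 8 consists of the 4 of the perimeter bound and a 2 from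
    \<open>1 + ln n \<le> 2 * log 2 n\<close>, which holds because \<open>n \<ge> 2\<close>.\<close>
  have "total_perimeter S \<le> (8 * diameter C * c) * log 2 (real n)"
    if n: "n \<ge> 2" and S: "boundary_homothet_packing C D n S" for n S
  proof -
    have pS: "packing_in D S" "card S = n" "\<And>K. K \<in> S \<Longrightarrow> positive_homothet C K \<and> touches_boundary D K"
      using S by (auto simp: boundary_homothet_packing_def)
    have "\<forall>K\<in>S. \<exists>\<mu>. \<mu> > 0 \<and> (\<exists>v. homothety \<mu> v ` C = K)"
      using pS(3) unfolding positive_homothet_def homothety_def by metis
    then obtain \<mu> where \<mu>: "\<And>K. K \<in> S \<Longrightarrow> \<mu> K > 0 \<and> (\<exists>v. homothety (\<mu> K) v ` C = K)" by metis
    have fam: "homothet_family C D S \<mu>" using \<mu> pS by (auto simp: homothet_family_def)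
    have fin: "finite S" "S \<noteq> {}" using pS n by (auto simp: packing_in_def)
    have "total_perimeter S \<le> (\<Sum>K\<in>S. 4 * diameter C * \<mu> K)"
      unfolding total_perimeter_def
    proof (rule sum_mono)
      fix K assume "K \<in> S"
      then show "perimeter K \<le> 4 * diameter C * \<mu> K"
        using perimeter_homothet_le[OF C] \<mu> pS(1) unfolding packing_in_def by metis
    qed
    also have "\<dots> = 4 * diameter C * sum \<mu> S" by (simp add: sum_distrib_left)
    also have "\<dots> \<le> 4 * diameter C * (c * (1 + ln (real n)))"
    proof (rule mult_left_mono)
      have "sum \<mu> S \<le> c * (1 + ln (real (card S)))"
        by (rule sum_le_of_weak_bound[OF fin c(1)]) (use \<mu> c(2)[OF fam] in blast)+
      then show "sum \<mu> S \<le> c * (1 + ln (real n))" using pS(2) by simp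
    qed (use d in simp)
    also have "\<dots> \<le> 4 * diameter C * (c * (2 * log 2 (real n)))"
    proof (intro mult_left_mono)
      have "1 \<le> log 2 (real n)" using n by simp
      moreover have "ln (real n) = ln 2 * log 2 (real n)" by (simp add: log_def)
      moreover have "ln 2 * log 2 (real n) \<le> 1 * log 2 (real n)"
        by (rule mult_right_mono) (use \<open>1 \<le> log 2 (real n)\<close> ln_2_less_1 in auto)
      ultimately show "1 + ln (real n) \<le> 2 * log 2 (real n)" by linarith
    qed (use d c in auto)
    finally show ?thesis by (simp add: mult_ac)
  qed
  then show ?thesis by blast
qed

section \<open>Packings on logarithmically many scales\<close>

text \<open>Level \<open>j\<close> has \<open>q\<^sup>j\<close> candidate positions on a grid, where \<open>q = 13 X\<close>. A candidate is kept if it is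
  at grid distance at least \<open>X\<^sup>d\<close> from all candidates that are \<open>d\<close> levels coarser.\<close>

definition kept :: "nat \<Rightarrow> nat \<Rightarrow> nat \<Rightarrow> nat set" where
  "kept X q j = {i. i < q ^ j \<and> (\<forall>j'<j. \<forall>i'<q ^ j'. \<bar>int i - int i' * int q ^ (j - j')\<bar> \<ge> int X ^ (j - j'))}"

lemma kept_subset: "kept X q j \<subseteq> {..<q ^ j}"
  by (auto simp: kept_def)

lemma finite_kept [simp]: "finite (kept X q j)"
  by (rule finite_subset[OF kept_subset]) simp

text \<open>For positive \<open>X\<close>, division by \<open>q ^ j\<close> turns the summands into
  \<open>1 / 13 ^ (j - j')\<close>, whose sum stays below 1/12.\<close>

lemma blocked_sum_le:
  assumes "q = 13 * (X::nat)"
  shows "12 * (\<Sum>j'<j. q ^ j' * X ^ (j - j')) \<le> q ^ j"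
proof (induction j)
  case (Suc j)
  have "(\<Sum>j'<Suc j. q ^ j' * X ^ (Suc j - j')) = X * (\<Sum>j'<j. q ^ j' * X ^ (j - j')) + q ^ j * X"
    by (simp add: sum_distrib_left Suc_diff_le mult_ac)
  then have "12 * (\<Sum>j'<Suc j. q ^ j' * X ^ (Suc j - j')) = X * (12 * (\<Sum>j'<j. q ^ j' * X ^ (j - j'))) + 12 * (q ^ j * X)"
    by (simp add: algebra_simps)
  also have "\<dots> \<le> X * q ^ j + 12 * (q ^ j * X)"
    using mult_left_mono[OF Suc.IH, of X] by simp
  also have "\<dots> = q ^ Suc j" by (simp add: assms mult_ac)
  finally show ?case .
qed simp

text \<open>A candidate \<open>d\<close> levels coarser blocks at most \<open>2 * X ^ d\<close>
  positions. By \<open>blocked_sum_le\<close> at most a sixth of the level is blocked, so 5/6 of it,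
  and in particular 3/4, survives.\<close>

lemma card_kept:
  assumes q: "q = 13 * X"
  shows "3 * q ^ j \<le> 4 * card (kept X q j)"
proof -
  define B where "B j' i' = {i. \<bar>int i - int i' * int q ^ (j - j')\<bar> < int X ^ (j - j')}" for j' i'
  have B: "finite (B j' i') \<and> card (B j' i') \<le> 2 * X ^ (j - j')" for j' i'
  proof -
    let ?c = "i' * q ^ (j - j')" and ?r = "X ^ (j - j')"
    have sub: "B j' i' \<subseteq> {?c - ?r..<?c + ?r}"
      unfolding B_def by (auto simp flip: of_nat_power of_nat_mult)
    have "card {?c - ?r..<?c + ?r} \<le> 2 * ?r" by simp
    then show ?thesis using sub finite_subset card_mono by (metis finite_atLeastLessThan le_trans)
  qed
  have "{..<q ^ j} \<subseteq> kept X q j \<union> (\<Union>j'<j. \<Union>i'<q ^ j'. B j' i')"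
  proof
    fix i assume "i \<in> {..<q ^ j}"
    then show "i \<in> kept X q j \<union> (\<Union>j'<j. \<Union>i'<q ^ j'. B j' i')"
      by (cases "i \<in> kept X q j") (auto simp: kept_def B_def not_le)
  qed
  then have "card {..<q ^ j} \<le> card (kept X q j \<union> (\<Union>j'<j. \<Union>i'<q ^ j'. B j' i'))"
    by (intro card_mono) (use B in auto)
  also have "\<dots> \<le> card (kept X q j) + card (\<Union>j'<j. \<Union>i'<q ^ j'. B j' i')" by (rule card_Un_le)
  also have "card (\<Union>j'<j. \<Union>i'<q ^ j'. B j' i') \<le> (\<Sum>j'<j. card (\<Union>i'<q ^ j'. B j' i'))"
    by (rule card_UN_le) simp
  also have "\<dots> \<le> (\<Sum>j'<j. q ^ j' * (2 * X ^ (j - j')))"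
  proof (rule sum_mono)
    fix j' assume "j' \<in> {..<j}"
    have "card (\<Union>i'<q ^ j'. B j' i') \<le> (\<Sum>i'<q ^ j'. card (B j' i'))" by (rule card_UN_le) simp
    also have "\<dots> \<le> (\<Sum>i'<q ^ j'. 2 * X ^ (j - j'))" by (rule sum_mono) (use B in blast)
    finally show "card (\<Union>i'<q ^ j'. B j' i') \<le> q ^ j' * (2 * X ^ (j - j'))" by simp
  qed
  also have "\<dots> = 2 * (\<Sum>j'<j. q ^ j' * X ^ (j - j'))" by (simp add: sum_distrib_left mult_ac)
  finally have "q ^ j \<le> card (kept X q j) + 2 * (\<Sum>j'<j. q ^ j' * X ^ (j - j'))" by simp
  then show ?thesis using blocked_sum_le[OF q, of j] by linarith
qed

lemma geometric_sum_le:
  assumes "2 \<le> (q::nat)"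
  shows "(\<Sum>j<m. q ^ j) \<le> q ^ m"
proof (induction m)
  case (Suc m)
  have "(\<Sum>j<Suc m. q ^ j) \<le> 2 * q ^ m" using Suc.IH by simp
  also have "\<dots> \<le> q ^ Suc m" unfolding power_Suc by (rule mult_right_mono[OF assms]) simp
  finally show ?case .
qed simp

text \<open>Separates the counting from the geometry: required separations are measured in steps
  \<open>(b - a) / q ^ j\<close> of the finer grid. Complete coarse levels supply the perimeter, and
  one very fine level supplies the missing members, since the packing must have exactly
  \<open>n\<close> of them.\<close>

lemma multiscale_packing:
  fixes F :: "nat \<Rightarrow> real \<Rightarrow> (real^2) set"
  assumes X: "X \<ge> 1" and q: "q = 13 * X" and ab: "a < b" and \<delta>: "\<delta> > 0"
    and body: "\<And>j t. t \<in> {a..b} \<Longrightarrow> convex_body (F j t) \<and> F j t \<subseteq> D \<and> positive_homothet C (F j t) \<and>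
        touches_boundary D (F j t) \<and> \<delta> / real q ^ j \<le> perimeter (F j t)"
    and disj: "\<And>j j' t t'. \<lbrakk>t \<in> {a..b}; t' \<in> {a..b}; j' \<le> j;
        \<bar>t - t'\<bar> \<ge> (b - a) * real X ^ (j - j') / real q ^ j\<rbrakk> \<Longrightarrow> F j' t' \<inter> F j t = {}"
  shows "\<exists>\<sigma>::real. \<sigma> > 0 \<and> (\<forall>n::nat. n \<ge> 1 \<longrightarrow>
               (\<exists>S. boundary_homothet_packing C D n S \<and> total_perimeter S \<ge> \<sigma> * log 2 (real n)))"
proof -
  have q0: "q \<ge> 13" using X q by simp
  define pos where "pos j i = a + real i * (b - a) / real q ^ j" for j i
  have pos_in: "pos j i \<in> {a..b}" if "i < q ^ j" for j i
  proof -
    have "real i \<le> real q ^ j" using that by (simp flip: of_nat_power)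
    then have "real i * (b - a) \<le> real q ^ j * (b - a)" using ab by simp
    then have "real i * (b - a) / real q ^ j \<le> b - a" using q0 by (simp add: field_simps)
    moreover have "0 \<le> real i * (b - a) / real q ^ j" using ab by simp
    ultimately show ?thesis by (auto simp: pos_def)
  qed
  define I where "I = {(j, i). i \<in> kept X q j}"
  define G where "G = (\<lambda>(j, i). F j (pos j i))"
  have posdiff: "\<bar>pos j i - pos j' i'\<bar> = \<bar>real_of_int (int i - int i' * int q ^ (j - j'))\<bar> * (b - a) / real q ^ j"
    if "j' \<le> j" for i i' j j'
  proof -
    have "real q ^ j = real q ^ j' * real q ^ (j - j')" using that by (simp flip: power_add)
    then have "pos j i - pos j' i' = (real i - real i' * real q ^ (j - j')) * (b - a) / real q ^ j"
      using q0 by (simp add: pos_def field_simps)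
    then show ?thesis using ab q0 by (simp add: abs_mult)
  qed
  have disjG: "F j' (pos j' i') \<inter> F j (pos j i) = {}"
    if ij: "i \<in> kept X q j" "i' \<in> kept X q j'" "j' \<le> j" "(j, i) \<noteq> (j', i')" for i i' j j'
  proof (rule disj)
    show "pos j i \<in> {a..b}" "pos j' i' \<in> {a..b}" using ij pos_in kept_subset by blast+
    \<comment> \<open>On one level the bound is \<open>X ^ 0 = 1\<close>, the distance of distinct
      grid positions; across levels it is the condition in \<open>kept\<close>.\<close>
    have "int X ^ (j - j') \<le> \<bar>int i - int i' * int q ^ (j - j')\<bar>"
    proof (cases "j' = j")
      case True
      then show ?thesis using ij(4) by simp
    next
      case False
      then show ?thesis using ij(1-3) by (auto simp: kept_def)
    qed
    then have "real_of_int (int X ^ (j - j')) \<le> \<bar>real_of_int (int i - int i' * int q ^ (j - j'))\<bar>"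
      by (simp only: of_int_abs[symmetric] of_int_le_iff)
    then have "real X ^ (j - j') * (b - a) / real q ^ j \<le> \<bar>real_of_int (int i - int i' * int q ^ (j - j'))\<bar> * (b - a) / real q ^ j"
      using ab by (intro divide_right_mono mult_right_mono) auto
    then show "(b - a) * real X ^ (j - j') / real q ^ j \<le> \<bar>pos j i - pos j' i'\<bar>"
      using posdiff[OF ij(3), of i i'] by (simp add: mult.commute)
  qed (use ij in simp)
  have GI: "convex_body (G p) \<and> G p \<subseteq> D \<and> positive_homothet C (G p) \<and> touches_boundary D (G p) \<and>
      \<delta> / real q ^ fst p \<le> perimeter (G p)" if "p \<in> I" for p
  proof -
    obtain j i where "p = (j, i)" "i \<in> kept X q j" using \<open>p \<in> I\<close> by (auto simp: I_def)
    then show ?thesis using body[OF pos_in[of i j], of j] kept_subset[of X q j] by (auto simp: G_def)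
  qed
  have Gdisj: "G p \<inter> G p' = {}" if p: "p \<in> I" "p' \<in> I" "p \<noteq> p'" for p p'
  proof -
    obtain j i j' i' where e: "p = (j, i)" "p' = (j', i')" by (cases p; cases p')
    then show ?thesis
      using disjG[of i j i' j'] disjG[of i' j' i j] p by (cases "j' \<le> j") (auto simp: I_def G_def)
  qed
  have Gne: "G p \<noteq> {}" if "p \<in> I" for p
    using GI[OF that] by (auto simp: convex_body_def)
  \<comment> \<open>Disjoint nonempty bodies are different, so counting positions counts
    bodies.\<close>
  have injG: "inj_on G I" using Gdisj Gne unfolding inj_on_def by (metis Int_absorb)
  define L where "L j = Pair j ` kept X q j" for j
  have L: "finite (L j)" "L j \<subseteq> I" "card (L j) = card (kept X q j)" for j
    by (auto simp: L_def I_def card_image inj_on_def)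
  have cardL: "card (L j) \<le> q ^ j" "3 * q ^ j \<le> 4 * card (L j)" for j
    using card_mono[OF _ kept_subset, of q j X] card_kept[OF q, of j] L by auto
  \<comment> \<open>Each level contributes at least \<open>3 / 4 * \<delta>\<close>. The remaining
    factor 1/2 pays for \<open>m + 1 \<le> 2 * m'\<close>, and \<open>log 2 q\<close> converts
    levels into \<open>log 2 n\<close>.\<close>
  define \<sigma> where "\<sigma> = 3 / 8 * \<delta> / log 2 (real q)"
  have lq: "log 2 (real q) > 0" using q0 by simp
  have "\<exists>S. boundary_homothet_packing C D n S \<and> total_perimeter S \<ge> \<sigma> * log 2 (real n)" if n: "n \<ge> 1" for n
  proof -
    obtain m where m: "q ^ m \<le> n" "n < q ^ (m + 1)" using ex_power_ivl1[of q n] n q0 by auto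
    \<comment> \<open>For \<open>n < q\<close> one has \<open>m = 0\<close> and no level would be
      used; the maximum then keeps level 0, which consists of one body.\<close>
    define m' where "m' = max m 1"
    define A where "A = (\<Union>j<m'. L j)"
    have finA: "finite A" and AI: "A \<subseteq> I" using L by (auto simp: A_def)
    have cA: "card A \<le> n"
    proof -
      have "card A \<le> (\<Sum>j<m'. card (L j))" unfolding A_def by (rule card_UN_le) simp
      also have "\<dots> \<le> (\<Sum>j<m'. q ^ j)" by (rule sum_mono) (use cardL in blast)
      also have "\<dots> \<le> n"
      proof (cases "m = 0")
        case True
        then show ?thesis using n by (simp add: m'_def)
      next
        case False
        then have "m' = m" by (simp add: m'_def)
        then show ?thesis using geometric_sum_le[of q m] m(1) q0 by simp
      qed
      finally show ?thesis .
    qed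
    \<comment> \<open>Level \<open>n\<close> alone has at least \<open>n\<close> members, so
      \<open>A\<close> can be completed to exactly \<open>n\<close> positions. The additions do not
      decrease the perimeter.\<close>
    have "n \<le> card (A \<union> L n)"
    proof -
      have "4 * n + 1 \<le> 3 * 13 ^ n" by (induction n) auto
      then have "4 * n \<le> 3 * 13 ^ n" by simp
      also have "(13::nat) ^ n \<le> q ^ n" by (rule power_mono) (use q0 in auto)
      finally have "4 * n \<le> 3 * q ^ n" by simp
      then have "n \<le> card (L n)" using cardL(2)[of n] by linarith
      also have "\<dots> \<le> card (A \<union> L n)" by (rule card_mono) (use finA L in auto)
      finally show ?thesis .
    qed
    then obtain A' where A': "A \<subseteq> A'" "A' \<subseteq> A \<union> L n" "card A' = n"
      using exists_subset_between[of A n "A \<union> L n"] cA finA L by auto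
    have A'I: "A' \<subseteq> I" using A' AI L(2) by blast
    have finA': "finite A'" by (rule finite_subset[OF A'(2)]) (use finA L in simp)
    have injA': "inj_on G A'" using injG A'I inj_on_subset by blast
    define S where "S = G ` A'"
    have "boundary_homothet_packing C D n S"
      unfolding boundary_homothet_packing_def packing_in_def
    proof (intro conjI ballI impI)
      show "finite S" "card S = n" using finA' injA' A' by (auto simp: S_def card_image)
      fix K assume "K \<in> S"
      then obtain p where p: "p \<in> I" "K = G p" using A'I by (auto simp: S_def)
      then show "convex_body K" "K \<subseteq> D" "positive_homothet C K" "touches_boundary D K" using GI by blast+
      fix K' assume "K' \<in> S" "K \<noteq> K'"
      then obtain p' where p': "p' \<in> I" "K' = G p'" "p \<noteq> p'" using A'I p by (auto simp: S_def)
      then have "K \<inter> K' = {}" using Gdisj p by blast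
      then show "interior K \<inter> interior K' = {}" using interior_subset by blast
    qed
    moreover have "total_perimeter S \<ge> \<sigma> * log 2 (real n)"
    proof -
      have nn: "perimeter (G p) \<ge> 0" if "p \<in> I" for p
      proof -
        have "0 \<le> \<delta> / real q ^ fst p" using \<delta> by simp
        then show ?thesis using GI[OF that] by linarith
      qed
      have "log 2 (real n) \<le> log 2 (real (q ^ (m + 1)))"
      proof (rule log_mono)
        show "real n \<le> real (q ^ (m + 1))" using m(2) by (simp only: of_nat_le_iff)
      qed (use n in auto)
      also have "\<dots> = real (m + 1) * log 2 (real q)" unfolding of_nat_power by (rule log_nat_power) (use q0 in simp)
      also have "\<dots> \<le> real (2 * m') * log 2 (real q)"
        by (rule mult_right_mono) (use lq m'_def in auto)
      finally have "\<sigma> * log 2 (real n) \<le> \<sigma> * (real (2 * m') * log 2 (real q))"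
        using \<delta> lq by (intro mult_left_mono) (auto simp: \<sigma>_def)
      also have "\<dots> = real m' * (3 / 4 * \<delta>)" using lq by (simp add: \<sigma>_def)
      also have "\<dots> = (\<Sum>j<m'. 3 / 4 * \<delta>)" by simp
      also have "\<dots> \<le> (\<Sum>j<m'. \<Sum>p\<in>L j. perimeter (G p))"
      proof (rule sum_mono)
        fix j
        have "3 * real q ^ j \<le> 4 * real (card (L j))"
        proof -
          have "real (3 * q ^ j) \<le> real (4 * card (L j))" using cardL(2)[of j] by (simp only: of_nat_le_iff)
          then show ?thesis by simp
        qed
        then have "3 / 4 * \<delta> \<le> real (card (L j)) * (\<delta> / real q ^ j)"
          using \<delta> q0 mult_right_mono[of "3 * real q ^ j" "4 * real (card (L j))" \<delta>] by (simp add: field_simps)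
        also have "\<dots> = (\<Sum>p\<in>L j. \<delta> / real q ^ fst p)" by (simp add: L_def sum.reindex inj_on_def card_image)
        also have "\<dots> \<le> (\<Sum>p\<in>L j. perimeter (G p))" by (rule sum_mono) (use GI L(2) in blast)
        finally show "3 / 4 * \<delta> \<le> (\<Sum>p\<in>L j. perimeter (G p))" .
      qed
      also have "\<dots> = (\<Sum>p\<in>A. perimeter (G p))" unfolding A_def
        by (rule sum.UNION_disjoint[symmetric]) (use L in \<open>auto simp: L_def\<close>)
      also have "\<dots> \<le> (\<Sum>p\<in>A'. perimeter (G p))"
        by (rule sum_mono2[OF finA' A'(1)]) (use nn A'I in blast)
      also have "\<dots> = total_perimeter S" by (simp add: total_perimeter_def S_def sum.reindex[OF injA'])
      finally show ?thesis .
    qed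
    ultimately show ?thesis by blast
  qed
  moreover have "\<sigma> > 0" using \<delta> lq by (simp add: \<sigma>_def)
  ultimately show ?thesis by blast
qed

section \<open>Homothetic copies of a convex body\<close>

lemma interior_homothety:
  assumes "\<mu> > 0"
  shows "interior (homothety \<mu> v ` C) = homothety \<mu> v ` interior C"
proof -
  have eq: "homothety \<mu> v ` A = (+) v ` ((*\<^sub>R) \<mu> ` A)" for A
    by (simp add: image_image homothety_def add.commute cong: image_cong_simp)
  have "linear ((*\<^sub>R) \<mu> :: real^2 \<Rightarrow> real^2)" by (simp add: linear_scaleR)
  moreover have "inj ((*\<^sub>R) \<mu> :: real^2 \<Rightarrow> real^2)" using assms by (auto simp: inj_def)
  ultimately show ?thesis
    unfolding eq interior_translation by (simp add: interior_injective_linear_image)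
qed

lemma convex_body_homothety:
  assumes "convex_body C" "\<mu> > 0"
  shows "convex_body (homothety \<mu> v ` C)"
proof -
  have C: "compact C" "convex C" "interior C \<noteq> {}" using assms by (auto simp: convex_body_def)
  have "compact (homothety \<mu> v ` C)"
    unfolding homothety_def by (intro compact_continuous_image continuous_intros C)
  moreover have "convex (homothety \<mu> v ` C)"
    unfolding homothety_def using convex_affinity[OF C(2), of v \<mu>] by (simp add: add.commute)
  moreover have "interior (homothety \<mu> v ` C) \<noteq> {}" using interior_homothety[OF assms(2)] C(3) by simp
  ultimately show ?thesis by (simp add: convex_body_def)
qed

text \<open>Two fixed distinct frontier points of \<open>C\<close> are carried to frontier points of
  the copy, at a distance proportional to \<open>\<mu>\<close>.\<close>

lemma perimeter_homothety_ge:
  assumes "convex_body C"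
  shows "\<exists>\<delta>>0. \<forall>\<mu> v. \<mu> > 0 \<longrightarrow> \<delta> * \<mu> \<le> perimeter (homothety \<mu> v ` C)"
proof -
  have C: "compact C" "convex C" "interior C \<noteq> {}" using assms by (auto simp: convex_body_def)
  obtain g where g: "simple_path g" "path_image g = frontier C" using frontier_loop_exists[OF assms] by metis
  then have "g 0 \<noteq> g (1/2)" unfolding simple_path_def loop_free_def by force
  moreover have g01: "g 0 \<in> frontier C" "g (1/2) \<in> frontier C" using g(2) by (auto simp: path_image_def)
  ultimately have "dist (g 0) (g (1/2)) > 0" by simp
  moreover have "dist (g 0) (g (1/2)) * \<mu> \<le> perimeter (homothety \<mu> v ` C)" if \<mu>: "\<mu> > 0" for \<mu> v
  proof -
    have K: "convex_body (homothety \<mu> v ` C)" by (rule convex_body_homothety[OF assms \<mu>])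
    have inj: "inj (homothety \<mu> v)" using \<mu> by (auto simp: inj_def homothety_def)
    have "homothety \<mu> v x \<in> frontier (homothety \<mu> v ` C)" if "x \<in> frontier C" for x
    proof -
      have "x \<in> C" "x \<notin> interior C" using that C(1) by (auto simp: frontier_def compact_imp_closed)
      then show ?thesis
        using interior_homothety[OF \<mu>, of v C] inj closure_subset[of "homothety \<mu> v ` C"]
        by (auto simp: frontier_def inj_image_mem_iff)
    qed
    then have "dist (homothety \<mu> v (g 0)) (homothety \<mu> v (g (1/2))) \<le> perimeter (homothety \<mu> v ` C)"
      using dist_le_perimeter[OF K] g01 by blast
    moreover have "dist (homothety \<mu> v (g 0)) (homothety \<mu> v (g (1/2))) = \<mu> * dist (g 0) (g (1/2))"
      using \<mu> by (simp add: homothety_def dist_norm flip: scaleR_diff_right)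
    ultimately show ?thesis by (simp add: mult.commute)
  qed
  ultimately show ?thesis by blast
qed

section \<open>Coordinates in the orthonormal frame of a direction\<close>

definition rot :: "real^2 \<Rightarrow> real^2" where "rot d = vector [- d $ 2, d $ 1]"
text \<open>Since \<open>rot d\<close> points to the left of \<open>d\<close>, a body lies above its
  supporting line of direction \<open>d\<close> in these coordinates; supporting lines belong to the
  lower boundary.\<close>

definition pt :: "real^2 \<Rightarrow> real \<Rightarrow> real \<Rightarrow> real^2" where "pt d u v = u *\<^sub>R d + v *\<^sub>R rot d"

lemma rot_component [simp]: "rot d $ 1 = - d $ 2" "rot d $ 2 = d $ 1"
  by (simp_all add: rot_def)

lemma pt_component [simp]: "pt d u v $ 1 = u * d $ 1 - v * d $ 2" "pt d u v $ 2 = u * d $ 2 + v * d $ 1"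
  by (simp_all add: pt_def)

lemma norm_eq_1_components:
  fixes d :: "real^2"
  assumes "norm d = 1"
  shows "d $ 1 * d $ 1 + d $ 2 * d $ 2 = 1"
  using assms by (simp add: norm_eq_1 inner_vec_def sum_2)

lemma norm_rot: "norm (rot d) = norm d"
  by (simp add: norm_eq_sqrt_inner inner_vec_def sum_2 add.commute)

lemma inner_pt [simp]:
  assumes "norm d = 1"
  shows "d \<bullet> pt d u v = u" "rot d \<bullet> pt d u v = v"
proof -
  have "d \<bullet> pt d u v = u * (d $ 1 * d $ 1 + d $ 2 * d $ 2)" by (simp add: inner_vec_def sum_2 algebra_simps)
  then show "d \<bullet> pt d u v = u" using norm_eq_1_components[OF assms] by simp
  have "rot d \<bullet> pt d u v = v * (d $ 1 * d $ 1 + d $ 2 * d $ 2)" by (simp add: inner_vec_def sum_2 algebra_simps)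
  then show "rot d \<bullet> pt d u v = v" using norm_eq_1_components[OF assms] by simp
qed

lemma pt_inner [simp]:
  assumes "norm d = 1"
  shows "pt d (d \<bullet> z) (rot d \<bullet> z) = z"
proof -
  note n = norm_eq_1_components[OF assms]
  have "pt d (d \<bullet> z) (rot d \<bullet> z) $ 1 = (d $ 1 * d $ 1 + d $ 2 * d $ 2) * z $ 1"
    by (simp add: inner_vec_def sum_2 algebra_simps)
  moreover have "pt d (d \<bullet> z) (rot d \<bullet> z) $ 2 = (d $ 1 * d $ 1 + d $ 2 * d $ 2) * z $ 2"
    by (simp add: inner_vec_def sum_2 algebra_simps)
  ultimately show ?thesis using n by (simp add: vec_eq_iff forall_2)
qed

lemma abs_inner_le:
  assumes "norm d = 1"
  shows "\<bar>d \<bullet> z\<bar> \<le> norm z" "\<bar>rot d \<bullet> z\<bar> \<le> norm z"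
  using Cauchy_Schwarz_ineq2[of d z] Cauchy_Schwarz_ineq2[of "rot d" z] assms by (auto simp: norm_rot)

text \<open>A copy \<open>\<mu> (C - z) + p\<close> lies above the tangent of \<open>D\<close> at \<open>p\<close>, at height at least
  \<open>c \<mu> \<bar>(u - t) / \<mu>\<bar>\<^sup>k\<close>; a copy that is smaller by the factor \<open>x\<^sup>k\<close> fits below it at horizontal distance
  of order \<open>\<mu> x\<close>.\<close>

lemma touching_copies_packing:
  fixes C D :: "(real^2) set" and d :: "real^2" and g s :: "real \<Rightarrow> real" and z :: "real \<Rightarrow> real^2"
  assumes C: "convex_body C" and d: "norm d = 1"
    and ab: "\<alpha>' < \<alpha>" "\<alpha> < \<beta>" "\<beta> < \<beta>'" and k: "k \<ge> 2" and c: "c > 0" and b: "b \<ge> 0" and h: "h > 0"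
    and above: "\<And>u v. \<lbrakk>u \<in> {\<alpha>'..\<beta>'}; g u \<le> v; v \<le> g u + h\<rbrakk> \<Longrightarrow> pt d u v \<in> D"
    and front: "\<And>t. t \<in> {\<alpha>..\<beta>} \<Longrightarrow> pt d t (g t) \<in> frontier D"
    and tangent: "\<And>t u. \<lbrakk>t \<in> {\<alpha>..\<beta>}; u \<in> {\<alpha>'..\<beta>'}\<rbrakk> \<Longrightarrow>
        g t + s t * (u - t) \<le> g u \<and> g u \<le> g t + s t * (u - t) + b * \<bar>u - t\<bar> ^ k"
    and z: "\<And>t. t \<in> {\<alpha>..\<beta>} \<Longrightarrow> z t \<in> C"
    and curved: "\<And>t w. \<lbrakk>t \<in> {\<alpha>..\<beta>}; w \<in> C\<rbrakk> \<Longrightarrow>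
        rot d \<bullet> (w - z t) \<ge> s t * (d \<bullet> (w - z t)) + c * \<bar>d \<bullet> (w - z t)\<bar> ^ k"
    and S: "\<And>t. t \<in> {\<alpha>..\<beta>} \<Longrightarrow> \<bar>s t\<bar> \<le> S"
  shows "\<exists>\<sigma>::real. \<sigma> > 0 \<and> (\<forall>n::nat. n \<ge> 1 \<longrightarrow>
               (\<exists>P. boundary_homothet_packing C D n P \<and> total_perimeter P \<ge> \<sigma> * log 2 (real n)))"
proof -
  define W where "W = diameter C + 1"
  have bC: "bounded C" using C by (simp add: convex_body_def compact_imp_bounded)
  have W: "W > 0" using diameter_ge_0[OF bC] by (simp add: W_def)
  have dW: "norm (w - w') \<le> W" if "w \<in> C" "w' \<in> C" for w w'
    using diameter_bounded_bound[OF bC that] by (simp add: W_def dist_norm)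
  have S0: "S \<ge> 0" using S[of \<alpha>] ab by auto
  \<comment> \<open>The copy of ratio \<open>\<mu>\<close>, translated so that the support point
    \<open>z t\<close> lands on the boundary point of \<open>D\<close> over
    \<open>t\<close>.\<close>
  define F where "F t \<mu> = homothety \<mu> (pt d t (g t) - \<mu> *\<^sub>R z t) ` C" for t \<mu>
  have F_pt: "pt d t (g t) \<in> F t \<mu>" if "t \<in> {\<alpha>..\<beta>}" for t \<mu>
  proof -
    have "homothety \<mu> (pt d t (g t) - \<mu> *\<^sub>R z t) (z t) = pt d t (g t)" by (simp add: homothety_def)
    then show ?thesis unfolding F_def using z[OF that] by (metis imageI)
  qed
  have F: "\<bar>d \<bullet> p - t\<bar> \<le> W * \<mu>" "rot d \<bullet> p \<le> g t + W * \<mu>"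
      "rot d \<bullet> p \<ge> g t + s t * (d \<bullet> p - t) + c * \<mu> * (\<bar>d \<bullet> p - t\<bar> / \<mu>) ^ k"
    if t: "t \<in> {\<alpha>..\<beta>}" and \<mu>: "\<mu> > 0" and p: "p \<in> F t \<mu>" for t \<mu> p
  proof -
    obtain w where w: "w \<in> C" "p = pt d t (g t) + \<mu> *\<^sub>R (w - z t)"
      using p by (auto simp: F_def homothety_def algebra_simps)
    define e f where "e = d \<bullet> (w - z t)" and "f = rot d \<bullet> (w - z t)"
    have u: "d \<bullet> p = t + \<mu> * e" and v: "rot d \<bullet> p = g t + \<mu> * f"
      using d by (simp_all add: w(2) inner_add_right e_def f_def)
    have "\<bar>e\<bar> \<le> W" "\<bar>f\<bar> \<le> W"
      using abs_inner_le[OF d, of "w - z t"] dW[OF w(1) z[OF t]] unfolding e_def f_def by linarith+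
    then show "\<bar>d \<bullet> p - t\<bar> \<le> W * \<mu>" "rot d \<bullet> p \<le> g t + W * \<mu>"
      using \<mu> by (simp_all add: u v abs_mult mult.commute)
    have "\<mu> * (s t * e + c * \<bar>e\<bar> ^ k) \<le> \<mu> * f"
      using curved[OF t w(1)] \<mu> unfolding e_def f_def by simp
    then show "rot d \<bullet> p \<ge> g t + s t * (d \<bullet> p - t) + c * \<mu> * (\<bar>d \<bullet> p - t\<bar> / \<mu>) ^ k"
      using \<mu> by (simp add: u v abs_mult algebra_simps)
  qed
  \<comment> \<open>The second entry keeps the bending of \<open>D\<close> below half of the gap;
    \<open>2 ^ k\<close> allows for distances doubled in the disjointness argument, and
    \<open>b + 1\<close> avoids division by zero. The entry with \<open>h\<close> keeps copies
    within the room above the arc, the last two keep them over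
    \<open>{\<alpha>'..\<beta>'}\<close>.\<close>
  define \<mu>1 where "\<mu>1 = min (min 1 (c / (2 * 2 ^ k * (b + 1)))) (min (h / (W + S * W)) (min ((\<alpha> - \<alpha>') / W) ((\<beta>' - \<beta>) / W)))"
  have WS: "W + S * W > 0" using W S0 by (simp add: add_pos_nonneg)
  have \<mu>1: "\<mu>1 > 0" "\<mu>1 \<le> 1" using c b h ab W WS by (auto simp: \<mu>1_def)
  have \<mu>1b: "\<mu> * (2 * 2 ^ k * b) \<le> c" "\<mu> * (W + S * W) \<le> h" "\<mu> * W \<le> \<alpha> - \<alpha>'" "\<mu> * W \<le> \<beta>' - \<beta>"
    if "\<mu> > 0" "\<mu> \<le> \<mu>1" for \<mu>
  proof -
    have m: "\<mu> \<le> c / (2 * 2 ^ k * (b + 1))" "\<mu> \<le> h / (W + S * W)" "\<mu> \<le> (\<alpha> - \<alpha>') / W" "\<mu> \<le> (\<beta>' - \<beta>) / W"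
      using that by (auto simp: \<mu>1_def)
    have "\<mu> * (2 * 2 ^ k * (b + 1)) \<le> c" using m(1) b by (subst (asm) pos_le_divide_eq) auto
    moreover have "\<mu> * (2 * 2 ^ k * b) \<le> \<mu> * (2 * 2 ^ k * (b + 1))" using that b by (intro mult_left_mono) auto
    ultimately show "\<mu> * (2 * 2 ^ k * b) \<le> c" by linarith
    show "\<mu> * (W + S * W) \<le> h" using m(2) WS by (subst (asm) pos_le_divide_eq) auto
    show "\<mu> * W \<le> \<alpha> - \<alpha>'" "\<mu> * W \<le> \<beta>' - \<beta>" using m(3,4) W by (simp_all add: pos_le_divide_eq)
  qed
  have pow: "\<mu> ^ k \<le> \<mu> * \<mu>" if "\<mu> > 0" "\<mu> \<le> 1" for \<mu> :: real
    using power_decreasing[OF k, of \<mu>] that by (simp add: power2_eq_square)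
  have sub: "F t \<mu> \<subseteq> D" if t: "t \<in> {\<alpha>..\<beta>}" and \<mu>: "\<mu> > 0" "\<mu> \<le> \<mu>1" for t \<mu>
  proof
    fix p assume p: "p \<in> F t \<mu>"
    let ?u = "d \<bullet> p" and ?v = "rot d \<bullet> p"
    note Fp = F[OF t \<mu>(1) p]
    have u: "?u \<in> {\<alpha>'..\<beta>'}" using Fp(1) \<mu>1b(3,4)[OF \<mu>] t by (auto simp: mult.commute abs_le_iff)
    have "b * \<mu> ^ k \<le> c * \<mu>"
    proof -
      have "b * \<mu> ^ k \<le> b * (\<mu> * \<mu>)" using pow[of \<mu>] \<mu> \<mu>1(2) b by (intro mult_left_mono) auto
      also have "\<dots> \<le> \<mu> * (\<mu> * (2 * 2 ^ k * b))"
      proof -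
        have "b * 1 \<le> b * (2 * 2 ^ k)" using b by (intro mult_left_mono) (auto intro: order_trans[of 1 2])
        then show ?thesis using \<mu> by (simp add: mult_ac)
      qed
      also have "\<dots> \<le> \<mu> * c" using \<mu>1b(1)[OF \<mu>] \<mu>(1) by (intro mult_left_mono) auto
      finally show ?thesis by (simp add: mult.commute)
    qed
    then have "b * \<mu> ^ k * (\<bar>?u - t\<bar> / \<mu>) ^ k \<le> c * \<mu> * (\<bar>?u - t\<bar> / \<mu>) ^ k"
      by (intro mult_right_mono) (use \<mu> in auto)
    moreover have "b * \<mu> ^ k * (\<bar>?u - t\<bar> / \<mu>) ^ k = b * \<bar>?u - t\<bar> ^ k" using \<mu> by (simp add: power_divide)
    ultimately have "g ?u \<le> ?v" using Fp(3) tangent[OF t u] by linarith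
    moreover have "?v \<le> g ?u + h"
    proof -
      have "\<bar>s t * (?u - t)\<bar> \<le> S * (W * \<mu>)"
        unfolding abs_mult using S[OF t] Fp(1) by (intro mult_mono) (use S0 in auto)
      then have "?v \<le> g ?u + (W * \<mu> + S * (W * \<mu>))" using Fp(2) tangent[OF t u] by linarith
      then show ?thesis using \<mu>1b(2)[OF \<mu>] by (simp add: algebra_simps)
    qed
    ultimately have "pt d ?u ?v \<in> D" using above u by blast
    then show "p \<in> D" using d by simp
  qed
  \<comment> \<open>Contacts \<open>B * \<mu> * x\<close> apart leave a common point at distance at
    least \<open>(B - W) * \<mu> * x\<close> from the larger contact. The last summand makes half of
    the gap there exceed the height \<open>(W + S * W) * \<mu> * x ^ k\<close> that the smaller copy
    can reach.\<close>
  define B where "B = 2 * W + 1 + 2 * (W + S * W) / c"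
  have B: "B > 0" "B - W \<ge> 1" "B - W \<ge> W" "c / 2 * (B - W) > W + S * W"
  proof -
    have 0: "2 * (W + S * W) / c > 0" using WS c by simp
    show "B > 0" "B - W \<ge> 1" "B - W \<ge> W" using W 0 by (auto simp: B_def)
    have "c / 2 * (B - W) = c / 2 * (W + 1) + (W + S * W)" using c by (simp add: B_def field_simps)
    then show "c / 2 * (B - W) > W + S * W" using c W by (simp add: add_pos_pos)
  qed
  \<comment> \<open>A common point would lie at least the gap above the tangent at \<open>t\<close>.
    But the smaller copy starts on the graph over \<open>t'\<close>, which is at most half the gap
    above that tangent, and climbs relative to the tangent by at most
    \<open>(W + S * W) * \<nu>\<close>.\<close>
  have disj: "F t \<mu> \<inter> F t' \<nu> = {}"
    if t: "t \<in> {\<alpha>..\<beta>}" "t' \<in> {\<alpha>..\<beta>}" and \<mu>: "\<mu> > 0" "\<mu> \<le> \<mu>1" and x: "0 < x" "x \<le> 1"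
      and \<nu>: "0 < \<nu>" "\<nu> \<le> \<mu> * x ^ k" and far: "\<bar>t - t'\<bar> \<ge> B * \<mu> * x" for t t' \<mu> \<nu> x
  proof (rule ccontr)
    assume "\<not> ?thesis"
    then obtain p where p: "p \<in> F t \<mu>" "p \<in> F t' \<nu>" by blast
    let ?u = "d \<bullet> p" and ?v = "rot d \<bullet> p"
    note A = F[OF t(1) \<mu>(1) p(1)] and A' = F[OF t(2) \<nu>(1) p(2)]
    define y where "y = \<bar>?u - t\<bar> / \<mu>"
    have "x ^ k \<le> x" using power_decreasing[of 1 k x] k x by simp
    then have "\<mu> * x ^ k \<le> \<mu> * x" using \<mu> by simp
    then have \<nu>x: "W * \<nu> \<le> W * \<mu> * x" using \<nu>(2) W by (simp add: mult.assoc)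
    have ut: "\<bar>?u - t\<bar> \<ge> (B - W) * (\<mu> * x)" using A'(1) \<nu>x far by (simp add: algebra_simps abs_le_iff) linarith
    then have y: "y \<ge> (B - W) * x" using \<mu>(1) by (simp add: y_def field_simps)
    have y0: "y \<ge> 0" using \<mu> by (simp add: y_def)
    have "\<bar>t' - t\<bar> \<le> 2 * \<bar>?u - t\<bar>"
    proof -
      have "W * (\<mu> * x) \<le> (B - W) * (\<mu> * x)" using B(3) \<mu> x by (intro mult_right_mono) auto
      then have "W * \<mu> * x \<le> \<bar>?u - t\<bar>" using ut by (simp add: mult.assoc)
      then have le: "\<bar>?u - t'\<bar> \<le> \<bar>?u - t\<bar>" using A'(1) \<nu>x by (meson order_trans)
      have "\<bar>t' - t\<bar> \<le> \<bar>?u - t\<bar> + \<bar>?u - t'\<bar>" by linarith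
      also have "\<dots> \<le> \<bar>?u - t\<bar> + \<bar>?u - t\<bar>" by (rule add_left_mono[OF le])
      finally show ?thesis by simp
    qed
    then have "b * \<bar>t' - t\<bar> ^ k \<le> b * (2 * \<bar>?u - t\<bar>) ^ k" using b by (intro mult_left_mono power_mono) auto
    also have "\<dots> = b * 2 ^ k * \<mu> ^ k * y ^ k" using \<mu> by (simp add: y_def power_mult_distrib power_divide)
    also have "\<dots> \<le> b * 2 ^ k * (\<mu> * \<mu>) * y ^ k"
      using pow[of \<mu>] \<mu> \<mu>1(2) b y0 by (intro mult_left_mono mult_right_mono) auto
    also have "\<dots> = (\<mu> * (2 * 2 ^ k * b)) * (\<mu> * y ^ k / 2)" by (simp add: mult_ac)
    also have "\<dots> \<le> c * (\<mu> * y ^ k / 2)"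
      using \<mu>1b(1)[OF \<mu>] \<mu>(1) y0 by (intro mult_right_mono) auto
    finally have bt: "b * \<bar>t' - t\<bar> ^ k \<le> c * (\<mu> * y ^ k / 2)" .
    have t'in: "t' \<in> {\<alpha>'..\<beta>'}" using t ab by auto
    have "\<bar>s t * (t' - ?u)\<bar> \<le> S * (W * \<nu>)"
      unfolding abs_mult using S[OF t(1)] A'(1) by (intro mult_mono) (use S0 in auto)
    then have "s t * (t' - t) \<le> s t * (?u - t) + S * (W * \<nu>)" by (simp add: algebra_simps)
    then have "?v \<le> g t + s t * (?u - t) + S * (W * \<nu>) + c * (\<mu> * y ^ k / 2) + W * \<nu>"
      using A'(2) tangent[OF t(1) t'in] bt by linarith
    then have "c * \<mu> * y ^ k \<le> c * (\<mu> * y ^ k / 2) + (W + S * W) * \<nu>"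
      using A(3) by (simp add: y_def algebra_simps)
    also have "(W + S * W) * \<nu> \<le> (W + S * W) * (\<mu> * x ^ k)" using \<nu>(2) WS by (intro mult_left_mono) auto
    finally have "\<mu> * (c / 2 * y ^ k) \<le> \<mu> * ((W + S * W) * x ^ k)" by (simp add: algebra_simps)
    then have "c / 2 * y ^ k \<le> (W + S * W) * x ^ k" using \<mu>(1) by simp
    moreover have "(B - W) * x ^ k \<le> y ^ k"
    proof -
      have "(B - W) ^ 1 \<le> (B - W) ^ k" using B(2) k by (intro power_increasing) auto
      then have "(B - W) * x ^ k \<le> (B - W) ^ k * x ^ k" using x by (intro mult_right_mono) auto
      also have "\<dots> = ((B - W) * x) ^ k" by (simp add: power_mult_distrib)
      also have "\<dots> \<le> y ^ k" using y B(2) x by (intro power_mono) auto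
      finally show ?thesis .
    qed
    then have "c / 2 * ((B - W) * x ^ k) \<le> c / 2 * y ^ k" using c by (intro mult_left_mono) auto
    ultimately have "(c / 2 * (B - W)) * x ^ k \<le> (W + S * W) * x ^ k" by (simp add: mult.assoc)
    then show False using B(4) x by simp
  qed
  obtain \<delta> where \<delta>: "\<delta> > 0" "\<And>\<mu> v. \<mu> > 0 \<Longrightarrow> \<delta> * \<mu> \<le> perimeter (homothety \<mu> v ` C)"
    using perimeter_homothety_ge[OF C] by blast
  \<comment> \<open>The second entry turns \<open>B * \<mu>0\<close> into at most the length
    \<open>\<beta> - \<alpha>\<close> of the grid.\<close>
  define \<mu>0 where "\<mu>0 = min \<mu>1 ((\<beta> - \<alpha>) / B)"
  have \<mu>0: "\<mu>0 > 0" "\<mu>0 \<le> \<mu>1" "B * \<mu>0 \<le> \<beta> - \<alpha>"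
  proof -
    show "\<mu>0 > 0" "\<mu>0 \<le> \<mu>1" using \<mu>1 ab B by (auto simp: \<mu>0_def)
    have "\<mu>0 \<le> (\<beta> - \<alpha>) / B" by (simp add: \<mu>0_def)
    then show "B * \<mu>0 \<le> \<beta> - \<alpha>" using B(1) by (simp add: pos_le_divide_eq mult.commute)
  qed
  define X :: nat where "X = 13 ^ (k - 1)"
  define q :: nat where "q = 13 * X"
  have qk: "q = 13 ^ k" using k by (cases k) (auto simp: q_def X_def)
  have q1: "real q ^ j \<ge> 1" for j by (simp add: qk)
  have qp: "real q > 0" by (simp add: qk)
  define G where "G j t = F t (\<mu>0 / real q ^ j)" for j t
  have scale: "\<mu>0 / real q ^ j > 0" "\<mu>0 / real q ^ j \<le> \<mu>1" for j
  proof -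
    show "\<mu>0 / real q ^ j > 0" using \<mu>0(1) less_le_trans[OF zero_less_one q1[of j]] by (rule divide_pos_pos)
    have "\<mu>0 / real q ^ j \<le> \<mu>0 / 1" using \<mu>0 q1[of j] qp by (intro divide_left_mono) auto
    then show "\<mu>0 / real q ^ j \<le> \<mu>1" using \<mu>0 by simp
  qed
  show ?thesis
  proof (rule multiscale_packing[where F = G and a = \<alpha> and b = \<beta> and X = X and q = q and \<delta> = "\<delta> * \<mu>0"])
    show "X \<ge> 1" by (simp add: X_def)
    show "\<delta> * \<mu>0 > 0" using \<delta> \<mu>0 by simp
    show "convex_body (G j t) \<and> G j t \<subseteq> D \<and> positive_homothet C (G j t) \<and>
        touches_boundary D (G j t) \<and> \<delta> * \<mu>0 / real q ^ j \<le> perimeter (G j t)" if t: "t \<in> {\<alpha>..\<beta>}" for j t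
    proof (intro conjI)
      show "convex_body (G j t)" unfolding G_def F_def by (rule convex_body_homothety[OF C scale(1)])
      show "G j t \<subseteq> D" unfolding G_def by (rule sub[OF t scale])
      show "positive_homothet C (G j t)"
        unfolding positive_homothet_def G_def F_def homothety_def[abs_def] using scale(1)[of j] by blast
      show "touches_boundary D (G j t)"
        unfolding touches_boundary_def G_def using F_pt[OF t] front[OF t] by blast
      show "\<delta> * \<mu>0 / real q ^ j \<le> perimeter (G j t)"
        unfolding G_def F_def using \<delta>(2)[OF scale(1)[of j]] by simp
    qed
    show "G j' t' \<inter> G j t = {}"
      if t: "t \<in> {\<alpha>..\<beta>}" "t' \<in> {\<alpha>..\<beta>}" and j: "j' \<le> j"
        and far: "\<bar>t - t'\<bar> \<ge> (\<beta> - \<alpha>) * real X ^ (j - j') / real q ^ j" for j j' t t'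
      unfolding G_def
    \<comment> \<open>Here \<open>x ^ k\<close> is the ratio of the two sizes, because
      \<open>q = 13 ^ k\<close>, and \<open>\<mu> * x\<close> becomes \<open>X ^ (j - j')\<close>
      steps of the grid of level \<open>j\<close>.\<close>
    proof (rule disj[where x = "1 / 13 ^ (j - j')"])
      have qj: "real q ^ j = real q ^ j' * (13 ^ (j - j') * real X ^ (j - j'))"
      proof -
        have "real q ^ j = real q ^ j' * real q ^ (j - j')" using j by (simp flip: power_add)
        moreover have "real q ^ (j - j') = 13 ^ (j - j') * real X ^ (j - j')"
          unfolding power_mult_distrib[symmetric] by (simp add: q_def)
        ultimately show ?thesis by simp
      qed
      show "\<mu>0 / real q ^ j \<le> \<mu>0 / real q ^ j' * (1 / 13 ^ (j - j')) ^ k"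
      proof -
        have "(13 ^ (j - j')) ^ k = real q ^ (j - j')" by (simp add: qk mult.commute flip: power_mult)
        then have "real q ^ j' * (13 ^ (j - j')) ^ k = real q ^ j" using j by (simp flip: power_add)
        then show ?thesis by (simp add: power_divide)
      qed
      have "B * (\<mu>0 / real q ^ j') * (1 / 13 ^ (j - j')) = B * \<mu>0 * real X ^ (j - j') / real q ^ j"
        unfolding qj by (simp add: X_def)
      also have "\<dots> \<le> (\<beta> - \<alpha>) * real X ^ (j - j') / real q ^ j"
        using \<mu>0 by (intro divide_right_mono mult_right_mono) auto
      finally show "B * (\<mu>0 / real q ^ j') * (1 / 13 ^ (j - j')) \<le> \<bar>t' - t\<bar>" using far by linarith
    qed (rule t scale | simp)+
  qed (use ab q_def in auto)
qed

section \<open>The lower boundary of a convex body\<close>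

lemma pt_affine: "pt d ((1 - s) * u1 + s * u2) ((1 - s) * v1 + s * v2) = (1 - s) *\<^sub>R pt d u1 v1 + s *\<^sub>R pt d u2 v2"
  by (simp add: pt_def algebra_simps)

text \<open>The lower boundary as a function; the upper boundary is obtained from
  \<open>low (- d) K\<close>. Outside the projection of \<open>K\<close> the infimum is over the
  empty set, so the lemmas below ask for a point of \<open>K\<close> over \<open>u\<close> or for
  points on both sides.\<close>

definition low :: "real^2 \<Rightarrow> (real^2) set \<Rightarrow> real \<Rightarrow> real" where
  "low d K u = Inf {v. pt d u v \<in> K}"

lemma low_attained:
  assumes K: "convex_body K" and d: "norm d = 1" and v: "pt d u v \<in> K"
  shows "pt d u (low d K u) \<in> K" "low d K u \<le> v"
proof -
  let ?A = "{v. pt d u v \<in> K}"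
  have cK: "compact K" using K by (simp add: convex_body_def)
  have "continuous_on UNIV (\<lambda>v. pt d u v)" unfolding pt_def by (intro continuous_intros)
  then have "closed ((\<lambda>v. pt d u v) -` K)"
    using compact_imp_closed[OF cK] by (simp add: continuous_on_closed_vimage)
  then have cl: "closed ?A" by (simp add: vimage_def)
  obtain M where M: "\<And>x. x \<in> K \<Longrightarrow> norm x \<le> M" using compact_imp_bounded[OF cK] by (auto simp: bounded_iff)
  have bdd: "bdd_below ?A"
  proof (rule bdd_belowI)
    fix v assume "v \<in> ?A"
    then have "\<bar>rot d \<bullet> pt d u v\<bar> \<le> M" using abs_inner_le(2)[OF d, of "pt d u v"] M[of "pt d u v"] by simp
    then show "- M \<le> v" using d by simp
  qed
  have "Inf ?A \<in> ?A" by (rule closed_contains_Inf[OF _ bdd cl]) (use v in auto)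
  then show "pt d u (low d K u) \<in> K" by (simp add: low_def)
  show "low d K u \<le> v" unfolding low_def by (rule cInf_lower[OF _ bdd]) (use v in simp)
qed

lemma low_point:
  assumes K: "convex_body K" and d: "norm d = 1" and w: "w \<in> K"
  shows "pt d (d \<bullet> w) (low d K (d \<bullet> w)) \<in> K" "low d K (d \<bullet> w) \<le> rot d \<bullet> w"
  using low_attained[OF K d, of "d \<bullet> w" "rot d \<bullet> w"] w d by auto

lemma low_frontier:
  assumes K: "convex_body K" and d: "norm d = 1" and v: "pt d u v \<in> K"
  shows "pt d u (low d K u) \<in> frontier K"
proof -
  have "pt d u (low d K u) \<notin> interior K"
  proof
    assume "pt d u (low d K u) \<in> interior K"
    then obtain e where e: "e > 0" "ball (pt d u (low d K u)) e \<subseteq> K"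
      by (auto simp: mem_interior)
    have "pt d u (low d K u) - pt d u (low d K u - e / 2) = (e / 2) *\<^sub>R rot d" by (simp add: pt_def algebra_simps)
    then have "dist (pt d u (low d K u)) (pt d u (low d K u - e / 2)) = e / 2"
      using e(1) d by (simp only: dist_norm) (simp add: norm_rot)
    then have "pt d u (low d K u - e / 2) \<in> K" using e by (auto simp: subset_iff)
    then show False using low_attained(2)[OF K d] e(1) by fastforce
  qed
  then show ?thesis using low_attained(1)[OF K d v] closure_subset by (auto simp: frontier_def)
qed

lemma low_convex_combination:
  assumes K: "convex_body K" and d: "norm d = 1" and s: "0 \<le> s" "s \<le> 1"
    and "pt d u1 v1 \<in> K" "pt d u2 v2 \<in> K"
  shows "pt d ((1 - s) * u1 + s * u2) ((1 - s) * v1 + s * v2) \<in> K"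
    "low d K ((1 - s) * u1 + s * u2) \<le> (1 - s) * v1 + s * v2"
proof -
  have "convex K" using K by (simp add: convex_body_def)
  then show *: "pt d ((1 - s) * u1 + s * u2) ((1 - s) * v1 + s * v2) \<in> K"
    unfolding pt_affine by (rule convexD) (use assms in auto)
  show "low d K ((1 - s) * u1 + s * u2) \<le> (1 - s) * v1 + s * v2"
    by (rule low_attained(2)[OF K d *])
qed

lemma low_defined_between:
  assumes K: "convex_body K" and d: "norm d = 1" and w: "w1 \<in> K" "w2 \<in> K" and u: "d \<bullet> w1 \<le> u" "u \<le> d \<bullet> w2"
  shows "pt d u (low d K u) \<in> K"
proof (cases "d \<bullet> w1 = d \<bullet> w2")
  case True
  then have "u = d \<bullet> w1" using u by simp
  then show ?thesis using low_point(1)[OF K d w(1)] by simp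
next
  case False
  define s where "s = (u - d \<bullet> w1) / (d \<bullet> w2 - d \<bullet> w1)"
  have s: "0 \<le> s" "s \<le> 1" using u False by (auto simp: s_def field_simps)
  have "s * (d \<bullet> w2 - d \<bullet> w1) = u - d \<bullet> w1" using False by (simp add: s_def)
  then have e: "(1 - s) * (d \<bullet> w1) + s * (d \<bullet> w2) = u" by (simp add: algebra_simps)
  have "pt d u ((1 - s) * (rot d \<bullet> w1) + s * (rot d \<bullet> w2)) \<in> K"
    using low_convex_combination(1)[OF K d s, of "d \<bullet> w1" "rot d \<bullet> w1" "d \<bullet> w2" "rot d \<bullet> w2"] d w e by simp
  then show ?thesis using low_attained(1)[OF K d] by blast
qed

lemma low_convex_on:
  assumes K: "convex_body K" and d: "norm d = 1" and w: "w1 \<in> K" "w2 \<in> K"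
  shows "convex_on {d \<bullet> w1..d \<bullet> w2} (low d K)"
proof (rule convex_onI)
  fix t x y :: real
  assume t: "0 < t" "t < 1" and xy: "x \<in> {d \<bullet> w1..d \<bullet> w2}" "y \<in> {d \<bullet> w1..d \<bullet> w2}"
  then show "low d K ((1 - t) *\<^sub>R x + t *\<^sub>R y) \<le> (1 - t) * low d K x + t * low d K y"
    using low_convex_combination(2)[OF K d, of t x "low d K x" y "low d K y"] low_defined_between[OF K d w] by simp
qed simp

text \<open>The product of the polynomials of the finitely many arcs vanishes on the whole frontier.
  Rewriting it in the frame of \<open>d\<close> with origin \<open>p\<close> is a substitution of
  determinant 1, so it stays nonzero.\<close>

lemma frontier_polynomial:
  assumes "bounded_description_complexity K" and d: "norm d = 1"
  shows "\<exists>Q. Q \<noteq> 0 \<and> (\<forall>u v. pt d u v + p \<in> frontier K \<longrightarrow> ev Q u v = 0)"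
proof -
  obtain \<A> where A: "finite \<A>" "\<forall>A\<in>\<A>. algebraic_arc A" "frontier K = \<Union>\<A>"
    using assms(1) by (auto simp: bounded_description_complexity_def)
  then have "\<forall>A\<in>\<A>. \<exists>P. P \<noteq> 0 \<and> A \<subseteq> poly_zero_set P" by (simp add: algebraic_arc_def)
  then obtain f where f: "\<forall>A\<in>\<A>. f A \<noteq> 0 \<and> A \<subseteq> poly_zero_set (f A)" by metis
  define P where "P = prod f \<A>"
  have P: "P \<noteq> 0" using f A(1) by (simp add: P_def)
  have PZ: "ev P (z $ 1) (z $ 2) = 0" if zK: "z \<in> frontier K" for z
  proof -
    obtain B where B: "B \<in> \<A>" "z \<in> B" using zK unfolding A(3) by blast
    then have "ev (f B) (z $ 1) (z $ 2) = 0" using f poly_zero_set_iff by blast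
    then show ?thesis using B(1) A(1) by (auto simp: P_def)
  qed
  have "d $ 1 * d $ 1 - (- d $ 2) * d $ 2 \<noteq> 0" using norm_eq_1_components[OF d] by simp
  then obtain Q where Q: "Q \<noteq> 0"
    "\<And>x y. ev Q x y = ev P (d $ 1 * x + (- d $ 2) * y + p $ 1) (d $ 2 * x + d $ 1 * y + p $ 2)"
    using ev_affine_substitution_nonzero[OF P] by blast
  have "ev Q u v = 0" if "pt d u v + p \<in> frontier K" for u v
    using PZ[OF that] by (simp add: Q(2) mult.commute)
  then show ?thesis using Q(1) by blast
qed

text \<open>A vertical segment through an interior point \<open>q\<close> is contracted towards
  \<open>w1\<close> or \<open>w2\<close> until it stands over \<open>u\<close>. As \<open>u\<close>
  is strictly inside the projection, the contraction factor \<open>1 - s\<close> is positive and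
  some height remains.\<close>

lemma low_vertical_room:
  assumes K: "convex_body K" and d: "norm d = 1" and w: "w1 \<in> K" "w2 \<in> K" and u: "d \<bullet> w1 < u" "u < d \<bullet> w2"
  shows "\<exists>h>0. pt d u (low d K u + h) \<in> K"
proof -
  have cK: "convex K" "interior K \<noteq> {}" using K by (auto simp: convex_body_def)
  then obtain q e where q: "e > 0" "ball q e \<subseteq> K" by (auto simp: mem_interior ex_in_conv[symmetric])
  define qu qv where "qu = d \<bullet> q" and "qv = rot d \<bullet> q"
  have q_pt: "q = pt d qu qv" using d by (simp add: qu_def qv_def)
  have up: "pt d qu (qv + e / 2) \<in> K" and mid: "pt d qu qv \<in> K"
  proof -
    have "pt d qu (qv + e / 2) - q = (e / 2) *\<^sub>R rot d" unfolding q_pt by (simp add: pt_def algebra_simps)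
    then have "dist q (pt d qu (qv + e / 2)) = e / 2"
      using q(1) d by (simp only: dist_norm norm_minus_commute[of q]) (simp add: norm_rot)
    then show "pt d qu (qv + e / 2) \<in> K" using q by (auto simp: subset_iff)
    show "pt d qu qv \<in> K" using q q_pt by (auto simp: subset_iff)
  qed
  have "\<exists>w s. w \<in> K \<and> 0 \<le> s \<and> s < 1 \<and> (1 - s) * qu + s * (d \<bullet> w) = u"
  proof -
    consider "qu = u" | "qu < u" | "qu > u" by linarith
    then show ?thesis
    proof cases
      case 1
      then show ?thesis using w(1) by (intro exI[of _ w1] exI[of _ 0]) simp
    next
      case 2
      define s where "s = (u - qu) / (d \<bullet> w2 - qu)"
      have "s * (d \<bullet> w2 - qu) = u - qu" using 2 u by (simp add: s_def)
      then have "(1 - s) * qu + s * (d \<bullet> w2) = u" by (simp add: algebra_simps)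
      moreover have "0 \<le> s" "s < 1" using 2 u by (auto simp: s_def field_simps)
      ultimately show ?thesis using w(2) by blast
    next
      case 3
      define s where "s = (qu - u) / (qu - d \<bullet> w1)"
      have "s * (qu - d \<bullet> w1) = qu - u" using 3 u by (simp add: s_def)
      then have "(1 - s) * qu + s * (d \<bullet> w1) = u" by (simp add: algebra_simps)
      moreover have "0 \<le> s" "s < 1" using 3 u by (auto simp: s_def field_simps)
      ultimately show ?thesis using w(1) by blast
    qed
  qed
  then obtain w s where ws: "w \<in> K" "0 \<le> s" "s < 1" "(1 - s) * qu + s * (d \<bullet> w) = u" by blast
  have wpt: "pt d (d \<bullet> w) (rot d \<bullet> w) \<in> K" using ws(1) d by simp
  have 1: "low d K u \<le> (1 - s) * qv + s * (rot d \<bullet> w)"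
    using low_convex_combination(2)[OF K d ws(2) _ mid wpt] ws by simp
  define v where "v = (1 - s) * (qv + e / 2) + s * (rot d \<bullet> w)"
  have "pt d u v \<in> K"
    using low_convex_combination(1)[OF K d ws(2) _ up wpt] ws by (simp add: v_def)
  moreover have "(1 - s) * e > 0" using ws(3) q(1) by simp
  then have "v - low d K u > 0" using 1 by (simp add: v_def field_simps)
  ultimately show ?thesis by (intro exI[of _ "v - low d K u"]) simp
qed

text \<open>Height \<open>h\<close> available over both ends is available over the whole chord
  between them by convexity, and the graph of \<open>low d K\<close> lies below this chord.\<close>

lemma low_uniform_room:
  assumes K: "convex_body K" and d: "norm d = 1" and w: "w1 \<in> K" "w2 \<in> K"
    and ab: "d \<bullet> w1 < a" "a < b" "b < d \<bullet> w2"
  shows "\<exists>h>0. \<forall>u v. u \<in> {a..b} \<longrightarrow> low d K u \<le> v \<longrightarrow> v \<le> low d K u + h \<longrightarrow> pt d u v \<in> K"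
proof -
  obtain h1 where h1: "h1 > 0" "pt d a (low d K a + h1) \<in> K" using low_vertical_room[OF K d w, of a] ab by auto
  obtain h2 where h2: "h2 > 0" "pt d b (low d K b + h2) \<in> K" using low_vertical_room[OF K d w, of b] ab by auto
  have vert: "pt d u v \<in> K" if "pt d u v1 \<in> K" "pt d u v2 \<in> K" "v1 \<le> v" "v \<le> v2" for u v v1 v2
  proof (cases "v1 = v2")
    case False
    define s where "s = (v - v1) / (v2 - v1)"
    have s: "0 \<le> s" "s \<le> 1" using that False by (auto simp: s_def field_simps)
    have "s * (v2 - v1) = v - v1" using False by (simp add: s_def)
    then have "(1 - s) * v1 + s * v2 = v" by (simp add: algebra_simps)
    moreover have "(1 - s) * u + s * u = u" by (simp add: algebra_simps)
    ultimately show ?thesis using low_convex_combination(1)[OF K d s that(1,2)] by simp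
  qed (use that in auto)
  have la: "pt d a (low d K a) \<in> K" and lb: "pt d b (low d K b) \<in> K"
    using low_defined_between[OF K d w] ab by auto
  define h where "h = min h1 h2"
  have h: "h > 0" using h1 h2 by (simp add: h_def)
  have ha: "pt d a (low d K a + h) \<in> K" by (rule vert[OF la h1(2)]) (use h1 h2 in \<open>auto simp: h_def\<close>)
  have hb: "pt d b (low d K b + h) \<in> K" by (rule vert[OF lb h2(2)]) (use h1 h2 in \<open>auto simp: h_def\<close>)
  have "pt d u v \<in> K" if u: "u \<in> {a..b}" and v: "low d K u \<le> v" "v \<le> low d K u + h" for u v
  proof -
    define s where "s = (u - a) / (b - a)"
    have s: "0 \<le> s" "s \<le> 1" using u ab by (auto simp: s_def field_simps)
    have "s * (b - a) = u - a" using ab by (simp add: s_def)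
    then have us: "(1 - s) * a + s * b = u" by (simp add: algebra_simps)
    have 1: "low d K u \<le> (1 - s) * low d K a + s * low d K b"
      using low_convex_combination(2)[OF K d s la lb] us by simp
    have "(1 - s) * (low d K a + h) + s * (low d K b + h) = (1 - s) * low d K a + s * low d K b + h"
      by (simp add: algebra_simps)
    then have 2: "pt d u ((1 - s) * low d K a + s * low d K b + h) \<in> K"
      using low_convex_combination(1)[OF K d s ha hb] us by simp
    have "pt d u (low d K u) \<in> K" using low_defined_between[OF K d w] u ab by auto
    then show ?thesis using vert[OF _ 2] v 1 by simp
  qed
  then show ?thesis using h by blast
qed

text \<open>Applies \<open>touching_copies_packing\<close> to the lower boundary of
  \<open>D\<close>, where convexity provides the room above the arc and the frontier points.\<close>

lemma low_tangent_packing: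
  fixes C D :: "(real^2) set" and d :: "real^2" and s :: "real \<Rightarrow> real" and z :: "real \<Rightarrow> real^2"
  assumes C: "convex_body C" and D: "convex_body D" and d: "norm d = 1" and w: "w1 \<in> D" "w2 \<in> D"
    and ab: "d \<bullet> w1 < \<alpha>'" "\<alpha>' < \<alpha>" "\<alpha> < \<beta>" "\<beta> < \<beta>'" "\<beta>' < d \<bullet> w2"
    and k: "k \<ge> 2" and c: "c > 0" and b: "b \<ge> 0"
    and tangent: "\<And>t u. \<lbrakk>t \<in> {\<alpha>..\<beta>}; u \<in> {\<alpha>'..\<beta>'}\<rbrakk> \<Longrightarrow>
        low d D t + s t * (u - t) \<le> low d D u \<and> low d D u \<le> low d D t + s t * (u - t) + b * \<bar>u - t\<bar> ^ k"
    and z: "\<And>t. t \<in> {\<alpha>..\<beta>} \<Longrightarrow> z t \<in> C"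
    and curved: "\<And>t w. \<lbrakk>t \<in> {\<alpha>..\<beta>}; w \<in> C\<rbrakk> \<Longrightarrow>
        rot d \<bullet> (w - z t) \<ge> s t * (d \<bullet> (w - z t)) + c * \<bar>d \<bullet> (w - z t)\<bar> ^ k"
    and S: "\<And>t. t \<in> {\<alpha>..\<beta>} \<Longrightarrow> \<bar>s t\<bar> \<le> S"
  shows "\<exists>\<sigma>::real. \<sigma> > 0 \<and> (\<forall>n::nat. n \<ge> 1 \<longrightarrow>
               (\<exists>P. boundary_homothet_packing C D n P \<and> total_perimeter P \<ge> \<sigma> * log 2 (real n)))"
proof -
  have ab': "\<alpha>' < \<beta>'" using ab by linarith
  obtain h where h: "h > 0" "\<And>u v. \<lbrakk>u \<in> {\<alpha>'..\<beta>'}; low d D u \<le> v; v \<le> low d D u + h\<rbrakk> \<Longrightarrow> pt d u v \<in> D"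
    using low_uniform_room[OF D d w ab(1) ab' ab(5)] by blast
  have front: "pt d t (low d D t) \<in> frontier D" if "t \<in> {\<alpha>..\<beta>}" for t
    by (rule low_frontier[OF D d low_defined_between[OF D d w]]) (use that ab in auto)
  show ?thesis
    by (rule touching_copies_packing[OF C d ab(2-4) k c b h(1) h(2) front tangent z curved S])
qed

section \<open>Curved boundary arcs\<close>

lemma low_convex_on_open:
  assumes K: "convex_body K" and d: "norm d = 1" and w: "w1 \<in> K" "w2 \<in> K" and ab: "d \<bullet> w1 \<le> a" "b \<le> d \<bullet> w2"
  shows "convex_on {a<..<b} (low d K)"
  by (rule convex_on_subset[OF low_convex_on[OF K d w]]) (use ab in auto)

lemma finite_avoid_interval:
  fixes F :: "real set"
  assumes "finite F" "a < b"
  obtains c e where "a < c" "c < e" "e < b" "{c..e} \<inter> F = {}"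
proof -
  have "infinite ({a<..<b} - F)" using assms infinite_Ioo by (simp add: Diff_infinite_finite)
  then obtain x where x: "x \<in> {a<..<b} - F" by (metis all_not_in_conv finite.emptyI)
  have "open ({a<..<b} - F)" using assms(1) by (intro open_Diff finite_imp_closed) auto
  then obtain r where r: "r > 0" "ball x r \<subseteq> {a<..<b} - F" using x open_contains_ball by blast
  have "y \<in> {a<..<b} - F" if "\<bar>y - x\<bar> < r" for y using r(2) that by (auto simp: subset_iff dist_real_def)
  then have y: "y \<in> {a<..<b} - F" if "y \<in> {x - r / 2..x + r / 2}" for y
  proof -
    have "\<bar>y - x\<bar> < r" using \<open>y \<in> {x - r / 2..x + r / 2}\<close> r(1) by (simp add: abs_less_iff field_simps)
    then show ?thesis using \<open>\<And>y. \<bar>y - x\<bar> < r \<Longrightarrow> y \<in> {a<..<b} - F\<close> by blast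
  qed
  show thesis
  proof (rule that[of "x - r / 2" "x + r / 2"])
    show "a < x - r / 2" "x + r / 2 < b" using y[of "x - r / 2"] y[of "x + r / 2"] r(1) by auto
    show "{x - r / 2..x + r / 2} \<inter> F = {}" using y by blast
  qed (use r in auto)
qed

text \<open>The second-order lower bound holds on the arc by the growth of the derivative, and spreads to the whole
  body by convexity.\<close>

lemma low_quadratic_growth:
  assumes K: "convex_body K" and d: "norm d = 1" and w: "w1 \<in> K" "w2 \<in> K"
    and ab: "d \<bullet> w1 \<le> a" "b \<le> d \<bullet> w2" and x: "a \<le> x - \<eta>" "x + \<eta> \<le> b" and \<eta>: "\<eta> > 0" "\<eta> \<le> W"
    and W: "\<And>u v. \<lbrakk>u \<in> K; v \<in> K\<rbrakk> \<Longrightarrow> norm (u - v) \<le> W"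
    and dF: "\<And>y. y \<in> {a..b} \<Longrightarrow> (low d K has_real_derivative F y) (at y)"
    and l: "l > 0" "\<And>y z. \<lbrakk>y \<in> {a..b}; z \<in> {a..b}; y \<le> z\<rbrakk> \<Longrightarrow> l * (z - y) \<le> F z - F y"
    and v: "v \<in> K"
  shows "rot d \<bullet> (v - pt d x (low d K x)) \<ge> F x * (d \<bullet> (v - pt d x (low d K x)))
      + l / 4 * (\<eta> / W) * \<bar>d \<bullet> (v - pt d x (low d K x))\<bar> ^ 2"
proof -
  let ?f = "low d K"
  have xab: "x \<in> {a..b}" using x \<eta> by auto
  have ab': "a < b" using x \<eta> by linarith
  have conv: "convex_on {d \<bullet> w1..d \<bullet> w2} ?f" by (rule low_convex_on[OF K d w])
  have tan: "?f y \<ge> ?f x + F x * (y - x)" if "y \<in> {a..b}" for y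
  proof -
    have "?f y - ?f x \<ge> F x * (y - x)"
    proof (rule convex_on_imp_above_tangent[OF conv])
      show "x \<in> interior {d \<bullet> w1..d \<bullet> w2}" using x \<eta> ab by (simp add: interior_atLeastAtMost_real)
      show "(?f has_real_derivative F x) (at x within {d \<bullet> w1..d \<bullet> w2})"
        by (rule has_field_derivative_at_within[OF dF[OF xab]])
    qed (use that ab in auto)
    then show ?thesis by simp
  qed
  have near: "?f y \<ge> ?f x + F x * (y - x) + l / 4 * (y - x)^2" if y: "y \<in> {a..b}" for y
  proof -
    \<comment> \<open>On the half from \<open>x\<close> to \<open>m\<close> the tangent suffices. On
      the other half the slope differs from \<open>F x\<close> by at least
      \<open>l * \<bar>y - x\<bar> / 2\<close>, which over the length
      \<open>\<bar>y - x\<bar> / 2\<close> gains \<open>l / 4 * (y - x)^2\<close>.\<close>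
    define m where "m = (x + y) / 2"
    have m: "m \<in> {a..b}" using y xab by (auto simp: m_def)
    have fm: "?f m \<ge> ?f x + F x * ((y - x) / 2)" using tan[OF m] by (simp add: m_def field_simps)
    consider "y = x" | "y > x" | "y < x" by linarith
    then show ?thesis
    proof cases
      case 2
      then have "m < y" "x < m" by (auto simp: m_def)
      have "\<exists>z>m. z < y \<and> ?f y - ?f m = (y - m) * F z"
        by (rule MVT2[OF \<open>m < y\<close>]) (use dF m y in auto)
      then obtain z where z: "m < z" "z < y" "?f y - ?f m = (y - m) * F z" by blast
      have "l * (z - x) \<le> F z - F x" using l(2)[of x z] xab z \<open>x < m\<close> y by auto
      moreover have "l * ((y - x) / 2) \<le> l * (z - x)" using z l(1) by (intro mult_left_mono) (auto simp: m_def field_simps)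
      ultimately have "F x + l * ((y - x) / 2) \<le> F z" by linarith
      then have "(y - m) * (F x + l * ((y - x) / 2)) \<le> ?f y - ?f m" unfolding z(3) using \<open>m < y\<close> by (intro mult_left_mono) auto
      moreover have "(y - m) * (F x + l * ((y - x) / 2)) = F x * ((y - x) / 2) + l / 4 * (y - x)^2"
        by (simp add: m_def field_simps power2_eq_square)
      ultimately show ?thesis using fm by (simp add: field_simps)
    next
      case 3
      then have "y < m" "m < x" by (auto simp: m_def)
      have "\<exists>z>y. z < m \<and> ?f m - ?f y = (m - y) * F z"
        by (rule MVT2[OF \<open>y < m\<close>]) (use dF m y in auto)
      then obtain z where z: "y < z" "z < m" "?f m - ?f y = (m - y) * F z" by blast
      have "l * (x - z) \<le> F x - F z" using l(2)[of z x] xab z \<open>m < x\<close> y by auto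
      moreover have "l * ((x - y) / 2) \<le> l * (x - z)" using z l(1) by (intro mult_left_mono) (auto simp: m_def field_simps)
      ultimately have "F z \<le> F x - l * ((x - y) / 2)" by linarith
      then have "?f m - ?f y \<le> (m - y) * (F x - l * ((x - y) / 2))" unfolding z(3) using \<open>y < m\<close> by (intro mult_left_mono) auto
      moreover have "(m - y) * (F x - l * ((x - y) / 2)) = F x * ((x - y) / 2) - l / 4 * (y - x)^2"
        by (simp add: m_def field_simps power2_eq_square)
      ultimately show ?thesis using fm by (simp add: field_simps)
    qed simp
  qed
  define u where "u = d \<bullet> v"
  define h where "h = rot d \<bullet> v - ?f x - F x * (u - x)"
  have wx: "pt d x (?f x) \<in> K" using low_defined_between[OF K d w] xab ab by auto
  have wv: "pt d u (rot d \<bullet> v) \<in> K" using v d by (simp add: u_def)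
  have uW: "\<bar>u - x\<bar> \<le> W"
    using abs_inner_le(1)[OF d, of "v - pt d x (?f x)"] W[OF v wx] d by (simp add: u_def inner_diff_right)
  have "h \<ge> l / 4 * (\<eta> / W) * (u - x)^2"
  proof (cases "\<bar>u - x\<bar> \<le> \<eta>")
    case True
    then have "u \<in> {a..b}" using x by (auto simp: abs_le_iff)
    then have "h \<ge> l / 4 * (u - x)^2" using near[of u] low_point(2)[OF K d v] by (simp add: h_def u_def)
    moreover have "l / 4 * (\<eta> / W) \<le> l / 4"
      using mult_left_mono[of "\<eta> / W" 1 "l / 4"] \<eta> l by simp
    then have "l / 4 * (\<eta> / W) * (u - x)^2 \<le> l / 4 * (u - x)^2" by (rule mult_right_mono) simp
    ultimately show ?thesis by linarith
  next
    case False
    \<comment> \<open>Beyond distance \<open>\<eta>\<close> the point is pulled towards the contact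
      until its distance is \<open>\<eta>\<close>, where \<open>near\<close> applies. The height
      over the tangent scales by \<open>\<kappa>\<close>, so it grows at least linearly, and
      \<open>\<bar>u - x\<bar> \<le> W\<close> turns this into a quadratic bound at the cost of the
      factor \<open>\<eta> / W\<close>.\<close>
    define \<kappa> where "\<kappa> = \<eta> / \<bar>u - x\<bar>"
    have \<kappa>: "0 < \<kappa>" "\<kappa> \<le> 1" using False \<eta> by (auto simp: \<kappa>_def)
    define y where "y = (1 - \<kappa>) * x + \<kappa> * u"
    have yx: "y - x = \<kappa> * (u - x)" by (simp add: y_def algebra_simps)
    have "\<bar>y - x\<bar> = \<eta>" unfolding yx using False \<eta> by (simp add: \<kappa>_def abs_mult)
    then have yab: "y \<in> {a..b}" and y2: "(y - x)^2 = \<eta>^2" using x by (auto simp: abs_le_iff power2_eq_iff abs_if split: if_splits)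
    have "?f y \<le> (1 - \<kappa>) * ?f x + \<kappa> * (rot d \<bullet> v)"
      unfolding y_def by (rule low_convex_combination(2)[OF K d _ \<kappa>(2) wx wv]) (use \<kappa> in simp)
    moreover have "?f y \<ge> ?f x + F x * (y - x) + l / 4 * \<eta>^2" using near[OF yab] unfolding y2 .
    then have "?f y \<ge> ?f x + F x * (\<kappa> * (u - x)) + l / 4 * \<eta>^2" unfolding yx .
    ultimately have "l / 4 * \<eta>^2 \<le> \<kappa> * h" by (simp add: h_def algebra_simps)
    then have "l / 4 * \<eta>^2 * \<bar>u - x\<bar> \<le> \<eta> * h" using False \<eta> by (simp add: \<kappa>_def field_simps)
    then have "\<eta> * (l / 4 * \<eta> * \<bar>u - x\<bar>) \<le> \<eta> * h" by (simp add: power2_eq_square mult_ac)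
    then have h: "l / 4 * \<eta> * \<bar>u - x\<bar> \<le> h" using \<eta>(1) by simp
    have W0: "W > 0" using \<eta> by linarith
    have "(u - x)^2 = \<bar>u - x\<bar> * \<bar>u - x\<bar>" by (simp add: power2_eq_square)
    also have "\<dots> \<le> W * \<bar>u - x\<bar>" by (rule mult_right_mono[OF uW]) simp
    finally have "(u - x)^2 \<le> W * \<bar>u - x\<bar>" .
    then have "l / 4 * (\<eta> / W) * (u - x)^2 \<le> l / 4 * (\<eta> / W) * (W * \<bar>u - x\<bar>)"
      using l \<eta> W0 by (intro mult_left_mono) auto
    also have "\<dots> = l / 4 * \<eta> * \<bar>u - x\<bar>" using W0 by simp
    finally show ?thesis using h by linarith
  qed
  moreover have "d \<bullet> (v - pt d x (?f x)) = u - x" "rot d \<bullet> (v - pt d x (?f x)) = rot d \<bullet> v - ?f x"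
    using d by (simp_all add: inner_diff_right u_def)
  ultimately show ?thesis by (simp add: h_def)
qed

text \<open>Slopes of lines contained in the zero set are avoided; then the support point is a vertex for an interval of
  slopes, or lies on an arc of positive curvature.\<close>

lemma curved_support_points:
  assumes C: "convex_body C" and bdc: "bounded_description_complexity C" and d: "norm d = 1" and s12: "s1 < s2"
  shows "\<exists>\<sigma>1 \<sigma>2 c. s1 \<le> \<sigma>1 \<and> \<sigma>1 < \<sigma>2 \<and> \<sigma>2 \<le> s2 \<and> c > 0 \<and> (\<forall>s\<in>{\<sigma>1..\<sigma>2}. \<exists>z\<in>C. \<forall>w\<in>C.
      rot d \<bullet> (w - z) \<ge> s * (d \<bullet> (w - z)) + c * \<bar>d \<bullet> (w - z)\<bar> ^ 2)"
proof -
  have cC: "compact C" "bounded C" "C \<noteq> {}"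
    using C interior_subset by (auto simp: convex_body_def compact_imp_bounded)
  define W where "W = diameter C + 1"
  have W: "W \<ge> 1" using diameter_ge_0[OF cC(2)] by (simp add: W_def)
  have dW: "norm (u - v) \<le> W" if "u \<in> C" "v \<in> C" for u v
    using diameter_bounded_bound[OF cC(2) that] by (simp add: W_def dist_norm)
  obtain Q where Q: "Q \<noteq> 0" "\<And>u v. pt d u v + 0 \<in> frontier C \<Longrightarrow> ev Q u v = 0"
    using frontier_polynomial[OF bdc d, of 0] by blast
  have finR: "finite (fst ` affine_roots Q)" using finite_affine_roots[OF Q(1)] by simp
  obtain r1 r2 where r: "s1 < r1" "r1 < r2" "r2 < s2" "{r1..r2} \<inter> fst ` affine_roots Q = {}"
    using finite_avoid_interval[OF finR s12] by blast
  have minimizer: "\<exists>z\<in>C. \<forall>w\<in>C. rot d \<bullet> (w - z) \<ge> s * (d \<bullet> (w - z))" for s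
  proof -
    have "continuous_on C (\<lambda>w. rot d \<bullet> w - s * (d \<bullet> w))" by (intro continuous_intros)
    then obtain z where z: "z \<in> C" "\<And>w. w \<in> C \<Longrightarrow> rot d \<bullet> z - s * (d \<bullet> z) \<le> rot d \<bullet> w - s * (d \<bullet> w)"
      using continuous_attains_inf[OF cC(1,3)] by blast
    have "rot d \<bullet> (w - z) \<ge> s * (d \<bullet> (w - z))" if "w \<in> C" for w
      using z(2)[OF that] by (simp add: inner_diff_right algebra_simps)
    then show ?thesis using z(1) by blast
  qed
  obtain z1 where z1: "z1 \<in> C" "\<And>w. w \<in> C \<Longrightarrow> rot d \<bullet> (w - z1) \<ge> r1 * (d \<bullet> (w - z1))" using minimizer by blast
  obtain z2 where z2: "z2 \<in> C" "\<And>w. w \<in> C \<Longrightarrow> rot d \<bullet> (w - z2) \<ge> r2 * (d \<bullet> (w - z2))" using minimizer by blast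
  show ?thesis
  proof (cases "z1 = z2")
    case True
    \<comment> \<open>The vertex has support lines of both slopes \<open>r1\<close> and
      \<open>r2\<close>. A slope at distance at least \<open>\<epsilon>\<close> from both leaves a
      linear gap \<open>\<epsilon> * \<bar>e\<bar>\<close>, and this exceeds the quadratic one
      because \<open>\<bar>e\<bar> \<le> W\<close>.\<close>
    define \<epsilon> where "\<epsilon> = (r2 - r1) / 3"
    have \<epsilon>: "\<epsilon> > 0" using r by (simp add: \<epsilon>_def)
    have "rot d \<bullet> (w - z1) \<ge> s * (d \<bullet> (w - z1)) + \<epsilon> / W * \<bar>d \<bullet> (w - z1)\<bar> ^ 2"
      if s: "s \<in> {r1 + \<epsilon>..r2 - \<epsilon>}" and w: "w \<in> C" for s w
    proof -
      define e where "e = d \<bullet> (w - z1)"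
      have eW: "\<bar>e\<bar> \<le> W" unfolding e_def using abs_inner_le(1)[OF d, of "w - z1"] dW[OF w z1(1)] by linarith
      have "\<bar>e\<bar>^2 \<le> W * \<bar>e\<bar>" using eW by (simp only: power2_eq_square) (rule mult_right_mono, auto)
      then have "\<epsilon> / W * \<bar>e\<bar> ^ 2 \<le> \<epsilon> / W * (W * \<bar>e\<bar>)" using \<epsilon> W by (intro mult_left_mono) auto
      also have "\<dots> = \<epsilon> * \<bar>e\<bar>" using W by simp
      finally have q: "\<epsilon> / W * \<bar>e\<bar> ^ 2 \<le> \<epsilon> * \<bar>e\<bar>" .
      have "s * e + \<epsilon> * \<bar>e\<bar> \<le> rot d \<bullet> (w - z1)"
      proof (cases "e \<ge> 0")
        case True
        have "(s + \<epsilon>) * e \<le> r2 * e" using s True by (intro mult_right_mono) auto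
        then show ?thesis using z2(2)[OF w] True \<open>z1 = z2\<close> by (simp add: e_def algebra_simps)
      next
        case False
        have "(s - \<epsilon>) * e \<le> r1 * e" using s False by (intro mult_right_mono_neg) auto
        then show ?thesis using z1(2)[OF w] False by (simp add: e_def algebra_simps)
      qed
      then show ?thesis using q by (simp add: e_def)
    qed
    then have "\<forall>s\<in>{r1 + \<epsilon>..r2 - \<epsilon>}. \<exists>z\<in>C. \<forall>w\<in>C.
      rot d \<bullet> (w - z) \<ge> s * (d \<bullet> (w - z)) + \<epsilon> / W * \<bar>d \<bullet> (w - z)\<bar> ^ 2" using z1(1) by blast
    moreover have "s1 \<le> r1 + \<epsilon>" "r1 + \<epsilon> < r2 - \<epsilon>" "r2 - \<epsilon> \<le> s2" "\<epsilon> / W > 0"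
    proof -
      have "3 * \<epsilon> = r2 - r1" by (simp add: \<epsilon>_def)
      then show "s1 \<le> r1 + \<epsilon>" "r1 + \<epsilon> < r2 - \<epsilon>" "r2 - \<epsilon> \<le> s2" using r \<epsilon> by linarith+
      show "\<epsilon> / W > 0" using \<epsilon> W by simp
    qed
    ultimately show ?thesis by blast
  next
    case False
    let ?f = "low d C"
    define u1 u2 where "u1 = d \<bullet> z1" and "u2 = d \<bullet> z2"
    have low_ge: "?f u \<ge> rot d \<bullet> z + s * (u - d \<bullet> z)"
      if z: "\<And>w. w \<in> C \<Longrightarrow> rot d \<bullet> (w - z) \<ge> s * (d \<bullet> (w - z))" and u: "pt d u (?f u) \<in> C" for s z u
      using z[OF u] d by (simp add: inner_diff_right algebra_simps)
    have v1: "rot d \<bullet> z1 = ?f u1"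
      using low_ge[OF z1(2), of u1] low_point[OF C d z1(1)] by (simp add: u1_def)
    have v2: "rot d \<bullet> z2 = ?f u2"
      using low_ge[OF z2(2), of u2] low_point[OF C d z2(1)] by (simp add: u2_def)
    have "u1 < u2"
    proof -
      have "rot d \<bullet> (z2 - z1) \<ge> r1 * (u2 - u1)" "rot d \<bullet> (z1 - z2) \<ge> r2 * (u1 - u2)"
        using z1(2)[OF z2(1)] z2(2)[OF z1(1)] by (simp_all add: u1_def u2_def inner_diff_right)
      then have "(r2 - r1) * (u2 - u1) \<ge> 0" by (simp add: inner_diff_right algebra_simps)
      then have "u1 \<le> u2" using r(2) by (simp add: zero_le_mult_iff)
      moreover have "u1 \<noteq> u2"
      proof
        assume "u1 = u2"
        then have "pt d (d \<bullet> z1) (rot d \<bullet> z1) = pt d (d \<bullet> z2) (rot d \<bullet> z2)" using v1 v2 by (simp add: u1_def u2_def)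
        then show False using False d by simp
      qed
      ultimately show ?thesis by simp
    qed
    have inC: "pt d u (?f u) \<in> C" if "u1 \<le> u" "u \<le> u2" for u
      using low_defined_between[OF C d z1(1) z2(1)] that by (simp add: u1_def u2_def)
    \<comment> \<open>The graph stays above the support line of slope \<open>r1\<close> through its
      left end and above that of slope \<open>r2\<close> through its right end, so a tangent in
      between must have an intermediate slope.\<close>
    have slope: "r1 \<le> m \<and> m \<le> r2" if x: "u1 < x" "x < u2" and m: "(?f has_real_derivative m) (at x)" for x m
    proof -
      have tan: "?f y - ?f x \<ge> m * (y - x)" if "y \<in> {u1..u2}" for y
      proof (rule convex_on_imp_above_tangent[of "{u1..u2}"])
        show "convex_on {u1..u2} ?f" using low_convex_on[OF C d z1(1) z2(1)] by (simp add: u1_def u2_def)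
        show "x \<in> interior {u1..u2}" using x by (simp add: interior_atLeastAtMost_real)
        show "(?f has_real_derivative m) (at x within {u1..u2})" by (rule has_field_derivative_at_within[OF m])
      qed (use that in auto)
      have "?f x \<ge> ?f u1 + r1 * (x - u1)" using low_ge[OF z1(2) inC[of x]] x v1 by (simp add: u1_def)
      moreover have "?f u1 - ?f x \<ge> m * (u1 - x)" by (rule tan) (use \<open>u1 < u2\<close> in auto)
      ultimately have "r1 * (x - u1) \<le> m * (x - u1)" by (simp add: algebra_simps)
      moreover have "?f x \<ge> ?f u2 + r2 * (x - u2)" using low_ge[OF z2(2) inC[of x]] x v2 by (simp add: u2_def)
      moreover have "?f u2 - ?f x \<ge> m * (u2 - x)" by (rule tan) (use \<open>u1 < u2\<close> in auto)
      ultimately have "m * (u2 - x) \<le> r2 * (u2 - x)" "r1 * (x - u1) \<le> m * (x - u1)" by (simp_all add: algebra_simps)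
      then show ?thesis using x by simp
    qed
    have conv: "convex_on {u1<..<u2} ?f"
      by (rule low_convex_on_open[OF C d z1(1) z2(1)]) (simp_all add: u1_def u2_def)
    have zero: "ev Q x (?f x) = 0" if "x \<in> {u1<..<u2}" for x
      using Q(2)[of x "?f x"] low_frontier[OF C d inC[of x]] that by simp
    \<comment> \<open>A straight piece would span a line in the zero set, and its slope would lie in
      the interval that avoids these slopes.\<close>
    have nonaffine: False if cd: "u1 \<le> c" "c < e" "e \<le> u2" and aff: "\<And>x. x \<in> {c<..<e} \<Longrightarrow> ?f x = m * x + n" for c e m n
    proof -
      have "{c<..<e} \<subseteq> {x. ev Q x (m * x + n) = 0}"
      proof
        fix x assume x: "x \<in> {c<..<e}"
        then have "ev Q x (?f x) = 0" using cd by (intro zero) auto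
        then show "x \<in> {x. ev Q x (m * x + n) = 0}" using aff[OF x] by simp
      qed
      then have "infinite {x. ev Q x (m * x + n) = 0}" using infinite_Ioo[OF cd(2)] finite_subset by blast
      then have "m \<in> fst ` affine_roots Q" using affine_rootI[of Q m n] by force
      moreover have "r1 \<le> m \<and> m \<le> r2"
      proof (rule slope)
        show "u1 < (c + e) / 2" "(c + e) / 2 < u2" using cd by auto
        have "((\<lambda>x. m * x + n) has_real_derivative m) (at ((c + e) / 2))" by (auto intro!: derivative_eq_intros)
        then show "(?f has_real_derivative m) (at ((c + e) / 2))"
          by (rule has_field_derivative_transform_within_open[where S = "{c<..<e}"]) (use aff cd in auto)
      qed
      ultimately have "m \<in> {r1..r2} \<inter> fst ` affine_roots Q" by simp
      then show False using r(4) by simp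
    qed
    have zero': "\<forall>x\<in>{u1<..<u2}. ev Q x (?f x) = 0" using zero by blast
    have nonaffine': "\<forall>c e m n. u1 \<le> c \<longrightarrow> c < e \<longrightarrow> e \<le> u2 \<longrightarrow> \<not> (\<forall>x\<in>{c<..<e}. ?f x = m * x + n)"
      using nonaffine by blast
    obtain a b F l U where ab: "u1 < a" "a < b" "b < u2"
      and dF: "\<And>x. x \<in> {a..b} \<Longrightarrow> (?f has_real_derivative F x) (at x)" and l: "l > 0" and U: "U > 0"
      and lF: "\<And>x y. \<lbrakk>x \<in> {a..b}; y \<in> {a..b}; x \<le> y\<rbrakk> \<Longrightarrow> l * (y - x) \<le> F y - F x \<and> F y - F x \<le> U * (y - x)"
      using algebraic_convex_arc[OF \<open>u1 < u2\<close> conv Q(1) zero' nonaffine'] by blast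
    \<comment> \<open>The margin at both ends of the arc gives \<open>low_quadratic_growth\<close>
      room on either side of the contact. The slopes over the remaining middle part are the interval
      that is returned.\<close>
    define \<eta> where "\<eta> = min W ((b - a) / 3)"
    have \<eta>: "\<eta> > 0" "\<eta> \<le> W" "3 * \<eta> \<le> b - a"
    proof -
      have "\<eta> \<le> (b - a) / 3" unfolding \<eta>_def by (rule min.cobounded2)
      then show "3 * \<eta> \<le> b - a" by simp
    qed (use ab W in \<open>auto simp: \<eta>_def\<close>)
    have contF: "continuous_on {a..b} F"
    proof -
      have "U \<ge> 0" using U by simp
      have "U-lipschitz_on {a..b} F"
      proof (rule lipschitz_onI[OF _ \<open>U \<ge> 0\<close>])
        fix x y assume xy: "x \<in> {a..b}" "y \<in> {a..b}"
        have le: "\<bar>F y - F x\<bar> \<le> U * (y - x)" if "x \<in> {a..b}" "y \<in> {a..b}" "x \<le> y" for x y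
        proof -
          have "0 \<le> l * (y - x)" using l that by simp
          then show ?thesis using lF[OF that] by linarith
        qed
        show "dist (F x) (F y) \<le> U * dist x y"
          using le[of x y] le[of y x] xy by (cases "x \<le> y") (auto simp: dist_real_def abs_minus_commute)
      qed
      then show ?thesis by (rule lipschitz_on_continuous_on)
    qed
    have "F (a + \<eta>) < F (b - \<eta>)"
    proof -
      have "0 < l * (b - \<eta> - (a + \<eta>))" using l \<eta> by (intro mult_pos_pos) auto
      also have "\<dots> \<le> F (b - \<eta>) - F (a + \<eta>)" using lF[of "a + \<eta>" "b - \<eta>"] \<eta> by auto
      finally show ?thesis by simp
    qed
    moreover have "s1 \<le> F (a + \<eta>)" "F (b - \<eta>) \<le> s2"
      using slope[of "a + \<eta>" "F (a + \<eta>)"] slope[of "b - \<eta>" "F (b - \<eta>)"] dF[of "a + \<eta>"] dF[of "b - \<eta>"] r ab \<eta> by auto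
    moreover have "l / 4 * (\<eta> / W) > 0" using l \<eta> W by simp
    moreover have "\<forall>s\<in>{F (a + \<eta>)..F (b - \<eta>)}. \<exists>z\<in>C. \<forall>w\<in>C.
      rot d \<bullet> (w - z) \<ge> s * (d \<bullet> (w - z)) + l / 4 * (\<eta> / W) * \<bar>d \<bullet> (w - z)\<bar> ^ 2"
    proof
      fix s assume s: "s \<in> {F (a + \<eta>)..F (b - \<eta>)}"
      have "\<exists>x\<ge>a + \<eta>. x \<le> b - \<eta> \<and> F x = s"
        by (rule IVT') (use s \<eta> contF in \<open>auto intro: continuous_on_subset\<close>)
      then obtain x where x: "a + \<eta> \<le> x" "x \<le> b - \<eta>" "F x = s" by blast
      have zC: "pt d x (?f x) \<in> C" by (rule inC) (use x ab \<eta> in auto)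
      have "rot d \<bullet> (w - pt d x (?f x)) \<ge> F x * (d \<bullet> (w - pt d x (?f x)))
          + l / 4 * (\<eta> / W) * \<bar>d \<bullet> (w - pt d x (?f x))\<bar> ^ 2" if w: "w \<in> C" for w
      proof (rule low_quadratic_growth[OF C d z1(1) z2(1), of a b])
        show "d \<bullet> z1 \<le> a" "b \<le> d \<bullet> z2" using ab by (simp_all add: u1_def u2_def)
        show "l * (z - y) \<le> F z - F y" if "y \<in> {a..b}" "z \<in> {a..b}" "y \<le> z" for y z using lF[OF that] by simp
      qed (use x \<eta> dW dF l w in auto)
      then show "\<exists>z\<in>C. \<forall>w\<in>C. rot d \<bullet> (w - z) \<ge> s * (d \<bullet> (w - z)) + l / 4 * (\<eta> / W) * \<bar>d \<bullet> (w - z)\<bar> ^ 2"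
        using zC x(3) by blast
    qed
    ultimately show ?thesis by blast
  qed
qed

section \<open>Sides without a parallel counterpart\<close>

lemma supporting_line_section:
  assumes d: "norm d = 1" and p: "p \<in> K" and x: "x \<in> K"
  shows "x \<in> directed_line p d \<longleftrightarrow> rot d \<bullet> x = rot d \<bullet> p"
proof
  assume "x \<in> directed_line p d"
  then obtain t where "x = p + t *\<^sub>R d" by (auto simp: directed_line_def)
  moreover have "rot d \<bullet> d = 0" by (simp add: inner_vec_def sum_2)
  ultimately show "rot d \<bullet> x = rot d \<bullet> p" by (simp add: inner_add_right)
next
  assume eq: "rot d \<bullet> x = rot d \<bullet> p"
  have "x = pt d (d \<bullet> x) (rot d \<bullet> x)" "p = pt d (d \<bullet> p) (rot d \<bullet> p)" using d by simp_all
  then have "x - p = pt d (d \<bullet> x) (rot d \<bullet> x) - pt d (d \<bullet> p) (rot d \<bullet> p)" by simp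
  also have "\<dots> = (d \<bullet> x - d \<bullet> p) *\<^sub>R d" by (simp add: pt_def eq algebra_simps)
  finally have "x = p + (d \<bullet> x - d \<bullet> p) *\<^sub>R d" by (simp add: algebra_simps)
  then show "x \<in> directed_line p d" unfolding directed_line_def by blast
qed

lemma left_halfplane_iff: "x \<in> left_halfplane p d \<longleftrightarrow> rot d \<bullet> x \<ge> rot d \<bullet> p"
  by (simp add: left_halfplane_def inner_vec_def sum_2 algebra_simps)

text \<open>The supporting line meets the body in a compact convex set, hence in a possibly
  degenerate segment; were it nondegenerate, it would be a side.\<close>

lemma no_side_imp_unique_support:
  assumes K: "convex_body K" and d: "norm d = 1" and ns: "\<not> has_side d K"
  obtains p where "p \<in> K" "\<And>x. x \<in> K \<Longrightarrow> rot d \<bullet> x \<ge> rot d \<bullet> p" "\<And>x. \<lbrakk>x \<in> K; rot d \<bullet> x = rot d \<bullet> p\<rbrakk> \<Longrightarrow> x = p"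
proof -
  have cK: "compact K" "convex K" "K \<noteq> {}" using K interior_subset by (auto simp: convex_body_def)
  have "continuous_on K (\<lambda>x. rot d \<bullet> x)" by (intro continuous_intros)
  then obtain p where p: "p \<in> K" "\<And>x. x \<in> K \<Longrightarrow> rot d \<bullet> p \<le> rot d \<bullet> x"
    using continuous_attains_inf[OF cK(1,3)] by blast
  have sl: "supporting_line d K (directed_line p d)"
    unfolding supporting_line_def using p left_halfplane_iff by blast
  define T where "T = {t. p + t *\<^sub>R d \<in> K}"
  have T_eq: "T = (\<lambda>t. p + t *\<^sub>R d) -` K" by (auto simp: T_def)
  have "closed T" unfolding T_eq
    by (intro closed_vimage compact_imp_closed cK continuous_intros)
  moreover have "bounded T"
  proof -
    obtain M where M: "\<And>x. x \<in> K \<Longrightarrow> norm x \<le> M" using compact_imp_bounded[OF cK(1)] by (auto simp: bounded_iff)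
    have "norm t \<le> 2 * M" if t: "t \<in> T" for t
    proof -
      have "norm t = norm ((p + t *\<^sub>R d) - p)" using d by simp
      also have "\<dots> \<le> norm (p + t *\<^sub>R d) + norm p" by (rule norm_triangle_ineq4)
      also have "\<dots> \<le> M + M" using M[of "p + t *\<^sub>R d"] M[OF p(1)] t by (simp add: T_def)
      finally show ?thesis by simp
    qed
    then show ?thesis by (auto simp: bounded_iff)
  qed
  ultimately have "compact T" by (simp add: compact_eq_bounded_closed)
  moreover have "connected T"
  proof (rule convex_connected)
    show "convex T"
    proof (rule convexI)
      fix x y u v :: real
      assume xy: "x \<in> T" "y \<in> T" and uv: "0 \<le> u" "0 \<le> v" "u + v = 1"
      have "u *\<^sub>R (p + x *\<^sub>R d) + v *\<^sub>R (p + y *\<^sub>R d) \<in> K"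
        by (rule convexD[OF cK(2)]) (use xy uv in \<open>auto simp: T_def\<close>)
      moreover have "u *\<^sub>R (p + x *\<^sub>R d) + v *\<^sub>R (p + y *\<^sub>R d) = (u + v) *\<^sub>R p + (u * x + v * y) *\<^sub>R d"
        by (simp add: algebra_simps)
      ultimately show "u *\<^sub>R x + v *\<^sub>R y \<in> T" using uv by (simp add: T_def)
    qed
  qed
  ultimately obtain t1 t2 where T: "T = {t1..t2}" using connected_compact_interval_1 by blast
  have line: "directed_line p d \<inter> K = (\<lambda>t. p + t *\<^sub>R d) ` {t1..t2}"
    unfolding T[symmetric] T_def directed_line_def by auto
  have "0 \<in> T" using p by (simp add: T_def)
  then have t12: "t1 \<le> t2" using T by auto
  have seg: "directed_line p d \<inter> K = closed_segment (p + t1 *\<^sub>R d) (p + t2 *\<^sub>R d)"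
  proof -
    have "closed_segment (p + t1 *\<^sub>R d) (p + t2 *\<^sub>R d) = (\<lambda>t. p + t *\<^sub>R d) ` closed_segment t1 t2"
    proof -
      have "(1 - u) *\<^sub>R (p + t1 *\<^sub>R d) + u *\<^sub>R (p + t2 *\<^sub>R d) = p + ((1 - u) *\<^sub>R t1 + u *\<^sub>R t2) *\<^sub>R d" for u
        by (simp add: algebra_simps)
      then show ?thesis by (auto simp: closed_segment_def)
    qed
    then show ?thesis using line t12 by (simp add: closed_segment_eq_real_ivl)
  qed
  have "t1 = t2"
  proof (rule ccontr)
    assume "t1 \<noteq> t2"
    moreover have "d \<noteq> 0" using d by auto
    ultimately have "p + t1 *\<^sub>R d \<noteq> p + t2 *\<^sub>R d" by simp
    then show False using ns sl seg unfolding has_side_def by blast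
  qed
  then have "directed_line p d \<inter> K = {p + t1 *\<^sub>R d}" using seg by simp
  moreover have "p \<in> directed_line p d \<inter> K" using p supporting_line_section[OF d p(1) p(1)] by simp
  ultimately have single: "directed_line p d \<inter> K = {p}" by auto
  show thesis
  proof (rule that[OF p])
    fix x assume "x \<in> K" "rot d \<bullet> x = rot d \<bullet> p"
    then have "x \<in> directed_line p d \<inter> K" using supporting_line_section[OF d p(1)] by blast
    then show "x = p" using single by blast
  qed
qed

text \<open>Near \<open>p\<close> the bound is \<open>lojasiewicz_near_zero\<close> for the
  frontier, with \<open>p\<close> as origin. Away from \<open>p\<close> the height over the
  supporting line has a positive minimum by compactness and uniqueness of \<open>p\<close>, while
  the horizontal distance is bounded.\<close>

lemma unique_support_power_bound:
  assumes C: "convex_body C" and bdc: "bounded_description_complexity C" and d: "norm d = 1" and p: "p \<in> C"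
    and min: "\<And>x. x \<in> C \<Longrightarrow> rot d \<bullet> x \<ge> rot d \<bullet> p"
    and uniq: "\<And>x. \<lbrakk>x \<in> C; rot d \<bullet> x = rot d \<bullet> p\<rbrakk> \<Longrightarrow> x = p"
  shows "\<exists>c>0. \<exists>k\<ge>2. \<forall>w\<in>C. rot d \<bullet> (w - p) \<ge> c * \<bar>d \<bullet> (w - p)\<bar> ^ k"
proof -
  have cC: "compact C" "bounded C" using C by (auto simp: convex_body_def compact_imp_bounded)
  obtain Q where Q: "Q \<noteq> 0" "\<And>u v. pt d u v + p \<in> frontier C \<Longrightarrow> ev Q u v = 0"
    using frontier_polynomial[OF bdc d] by blast
  define A where "A = {(u, v). pt d u v + p \<in> frontier C \<and> v > 0}"
  have fC: "frontier C \<subseteq> C" using cC(1) compact_imp_closed frontier_subset_closed by blast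
  define W where "W = diameter C + 1"
  have W: "W \<ge> 1" using diameter_ge_0[OF cC(2)] by (simp add: W_def)
  have dW: "\<bar>d \<bullet> (w - p)\<bar> \<le> W" "\<bar>rot d \<bullet> (w - p)\<bar> \<le> W" if "w \<in> C" for w
    using abs_inner_le[OF d, of "w - p"] diameter_bounded_bound[OF cC(2) that p] by (auto simp: W_def dist_norm)
  have bA: "bounded A"
  proof -
    have "A \<subseteq> cbox (-W, -W) (W, W)"
    proof
      fix a assume "a \<in> A"
      then obtain u v where a: "a = (u, v)" "pt d u v + p \<in> C" using fC by (auto simp: A_def)
      have "\<bar>u\<bar> \<le> W" "\<bar>v\<bar> \<le> W" using dW[OF a(2)] d by simp_all
      then show "a \<in> cbox (-W, -W) (W, W)" using a(1) by (auto simp: cbox_Pair_eq abs_le_iff)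
    qed
    then show ?thesis using bounded_cbox bounded_subset by blast
  qed
  have zA: "ev Q x y = 0" if "(x, y) \<in> A" for x y using that Q(2) by (auto simp: A_def)
  have pA: "y > 0" if "(x, y) \<in> A" for x y using that by (auto simp: A_def)
  obtain c r k where c: "c > 0" and r: "r > 0" and ck: "\<forall>(x, y)\<in>A. \<bar>x\<bar> \<le> r \<longrightarrow> y \<ge> c * \<bar>x\<bar> ^ k"
    using lojasiewicz_near_zero[of Q A] Q(1) zA pA bA by blast
  \<comment> \<open>The packing argument asks for an exponent of at least 2. Raising it weakens the
    bound only for distances up to 1, hence the cap in \<open>r'\<close>.\<close>
  define K where "K = max k 2"
  define r' where "r' = min r 1"
  have r': "r' > 0" "r' \<le> r" "r' \<le> 1" using r by (auto simp: r'_def)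
  have near: "rot d \<bullet> (w - p) \<ge> c * \<bar>d \<bullet> (w - p)\<bar> ^ K" if w: "w \<in> C" and u: "\<bar>d \<bullet> (w - p)\<bar> \<le> r'" for w
  proof (cases "d \<bullet> (w - p) = 0")
    case True
    have "K \<noteq> 0" by (simp add: K_def)
    then show ?thesis using True min[OF w] by (simp add: inner_diff_right power_0_left)
  next
    case False
    let ?u = "d \<bullet> w"
    \<comment> \<open>The lowest point below \<open>w\<close> is on the frontier and has the same
      horizontal coordinate, so the bound for it carries over to \<open>w\<close>.\<close>
    define x where "x = pt d ?u (low d C ?u)"
    have x: "x \<in> C" "low d C ?u \<le> rot d \<bullet> w" using low_point[OF C d w] by (simp_all add: x_def)
    have xu: "d \<bullet> x = ?u" and xv: "rot d \<bullet> x = low d C ?u" using d by (simp_all add: x_def)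
    have xf: "x \<in> frontier C" unfolding x_def by (rule low_frontier[OF C d x(1)[unfolded x_def]])
    have "x \<noteq> p" using False xu by (auto simp: inner_diff_right)
    then have "rot d \<bullet> x \<noteq> rot d \<bullet> p" using uniq[OF x(1)] by blast
    then have pos: "rot d \<bullet> (x - p) > 0" using min[OF x(1)] by (simp add: inner_diff_right)
    have "pt d (d \<bullet> (x - p)) (rot d \<bullet> (x - p)) + p = x" using d by simp
    then have "(d \<bullet> (x - p), rot d \<bullet> (x - p)) \<in> A" using xf pos by (simp add: A_def)
    moreover have "d \<bullet> (x - p) = d \<bullet> (w - p)" by (simp add: inner_diff_right xu)
    ultimately have "rot d \<bullet> (x - p) \<ge> c * \<bar>d \<bullet> (w - p)\<bar> ^ k" using ck u r' by fastforce
    moreover have "rot d \<bullet> (x - p) \<le> rot d \<bullet> (w - p)" using x(2) xv by (simp add: inner_diff_right)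
    moreover have "\<bar>d \<bullet> (w - p)\<bar> ^ K \<le> \<bar>d \<bullet> (w - p)\<bar> ^ k"
      by (rule power_decreasing) (use u r' in \<open>auto simp: K_def\<close>)
    then have "c * \<bar>d \<bullet> (w - p)\<bar> ^ K \<le> c * \<bar>d \<bullet> (w - p)\<bar> ^ k" using c by simp
    ultimately show ?thesis by linarith
  qed
  define E where "E = C \<inter> {w. \<bar>d \<bullet> (w - p)\<bar> \<ge> r'}"
  have cE: "compact E" unfolding E_def
    by (intro compact_Int_closed cC closed_Collect_le continuous_intros)
  obtain v0 where v0: "v0 > 0" "\<And>w. w \<in> E \<Longrightarrow> rot d \<bullet> (w - p) \<ge> v0"
  proof (cases "E = {}")
    case True
    then show ?thesis using that[of 1] by simp
  next
    case False
    have "continuous_on E (\<lambda>w. rot d \<bullet> (w - p))" by (intro continuous_intros)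
    then obtain w0 where w0: "w0 \<in> E" "\<And>w. w \<in> E \<Longrightarrow> rot d \<bullet> (w0 - p) \<le> rot d \<bullet> (w - p)"
      using continuous_attains_inf[OF cE False] by blast
    have "w0 \<in> C" "w0 \<noteq> p" using w0(1) r' by (auto simp: E_def)
    then have "rot d \<bullet> (w0 - p) > 0" using min[of w0] uniq[of w0] by (auto simp: inner_diff_right less_le)
    then show ?thesis using that w0(2) by blast
  qed
  define c' where "c' = min c (v0 / W ^ K)"
  have c': "c' > 0" using c v0(1) W by (simp add: c'_def)
  have "rot d \<bullet> (w - p) \<ge> c' * \<bar>d \<bullet> (w - p)\<bar> ^ K" if w: "w \<in> C" for w
  proof (cases "\<bar>d \<bullet> (w - p)\<bar> \<le> r'")
    case True
    have "c' * \<bar>d \<bullet> (w - p)\<bar> ^ K \<le> c * \<bar>d \<bullet> (w - p)\<bar> ^ K" by (rule mult_right_mono) (auto simp: c'_def)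
    then show ?thesis using near[OF w True] by linarith
  next
    case False
    have "c' * \<bar>d \<bullet> (w - p)\<bar> ^ K \<le> (v0 / W ^ K) * W ^ K"
      using dW(1)[OF w] W v0(1) by (intro mult_mono power_mono) (auto simp: c'_def)
    also have "\<dots> = v0" using W by simp
    also have "\<dots> \<le> rot d \<bullet> (w - p)" using v0(2) w False by (auto simp: E_def)
    finally show ?thesis .
  qed
  moreover have "K \<ge> 2" by (simp add: K_def)
  ultimately show ?thesis using c' by blast
qed

text \<open>Along the side the lower boundary of \<open>D\<close> is constant. Hence the slope and
  the bending term are 0, and a single support point of \<open>C\<close> serves for all
  contacts.\<close>

lemma packing_along_side:
  assumes C: "convex_body C" and D: "convex_body D" and bdc: "bounded_description_complexity C"
    and d: "norm d = 1" and sD: "has_side d D" and sC: "\<not> has_side d C"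
  shows "\<exists>\<sigma>::real. \<sigma> > 0 \<and> (\<forall>n::nat. n \<ge> 1 \<longrightarrow>
               (\<exists>P. boundary_homothet_packing C D n P \<and> total_perimeter P \<ge> \<sigma> * log 2 (real n)))"
proof -
  obtain p where p: "p \<in> C" "\<And>x. x \<in> C \<Longrightarrow> rot d \<bullet> x \<ge> rot d \<bullet> p" "\<And>x. \<lbrakk>x \<in> C; rot d \<bullet> x = rot d \<bullet> p\<rbrakk> \<Longrightarrow> x = p"
    using no_side_imp_unique_support[OF C d sC] by blast
  obtain c k where ck: "c > 0" "k \<ge> 2" "\<And>w. w \<in> C \<Longrightarrow> rot d \<bullet> (w - p) \<ge> c * \<bar>d \<bullet> (w - p)\<bar> ^ k"
    using unique_support_power_bound[OF C bdc d p] by blast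
  obtain l a b where l: "supporting_line d D l" "a \<noteq> b" "l \<inter> D = closed_segment a b"
    using sD by (auto simp: has_side_def)
  obtain r where r: "r \<in> D" "l = directed_line r d" "D \<subseteq> left_halfplane r d"
    using l(1) by (auto simp: supporting_line_def)
  have ab: "a \<in> D" "b \<in> D" "a \<in> directed_line r d" "b \<in> directed_line r d" using l(3) r(2) by auto
  have v: "rot d \<bullet> a = rot d \<bullet> r" "rot d \<bullet> b = rot d \<bullet> r"
    using supporting_line_section[OF d r(1)] ab by blast+
  have ge: "rot d \<bullet> x \<ge> rot d \<bullet> r" if "x \<in> D" for x using that r(3) left_halfplane_iff by blast
  have "d \<bullet> a \<noteq> d \<bullet> b"
  proof
    assume "d \<bullet> a = d \<bullet> b"
    then have "pt d (d \<bullet> a) (rot d \<bullet> a) = pt d (d \<bullet> b) (rot d \<bullet> b)" using v by simp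
    then show False using d l(2) by simp
  qed
  then obtain w1 w2 where w: "w1 \<in> D" "w2 \<in> D" "d \<bullet> w1 < d \<bullet> w2" "rot d \<bullet> w1 = rot d \<bullet> r" "rot d \<bullet> w2 = rot d \<bullet> r"
    using ab(1,2) v by (metis linorder_neqE_linordered_idom)
  have low: "low d D u = rot d \<bullet> r" if u: "d \<bullet> w1 \<le> u" "u \<le> d \<bullet> w2" for u
  proof -
    have in_D: "pt d u (low d D u) \<in> D" by (rule low_defined_between[OF D d w(1,2) u])
    have "rot d \<bullet> r \<le> low d D u" using ge[OF in_D] d by simp
    moreover have "low d D u \<le> rot d \<bullet> r"
    proof -
      define s where "s = (u - d \<bullet> w1) / (d \<bullet> w2 - d \<bullet> w1)"
      have s: "0 \<le> s" "s \<le> 1" using u w(3) by (auto simp: s_def field_simps)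
      have "s * (d \<bullet> w2 - d \<bullet> w1) = u - d \<bullet> w1" using w(3) by (simp add: s_def)
      then have e: "(1 - s) * (d \<bullet> w1) + s * (d \<bullet> w2) = u" by (simp add: algebra_simps)
      have "pt d (d \<bullet> w1) (rot d \<bullet> w1) \<in> D" "pt d (d \<bullet> w2) (rot d \<bullet> w2) \<in> D"
        unfolding pt_inner[OF d] using w by blast+
      from low_convex_combination(2)[OF D d s this]
      have "low d D u \<le> (1 - s) * (rot d \<bullet> r) + s * (rot d \<bullet> r)" using e w(4,5) by simp
      then show ?thesis by (simp add: algebra_simps)
    qed
    ultimately show ?thesis by simp
  qed
  \<comment> \<open>Five equal parts: contacts use the middle one, copies may spread over its two
    neighbours, and the outer two keep away from the ends of the side.\<close>
  define h where "h = (d \<bullet> w2 - d \<bullet> w1) / 5"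
  have h: "h > 0" "d \<bullet> w2 = d \<bullet> w1 + 5 * h" using w(3) by (simp_all add: h_def field_simps)
  show ?thesis
  proof (rule low_tangent_packing[OF C D d w(1,2), of "d \<bullet> w1 + h" "d \<bullet> w1 + 2 * h" "d \<bullet> w1 + 3 * h" "d \<bullet> w1 + 4 * h" k c 0
        "\<lambda>_. 0" "\<lambda>_. p" 0])
    show "low d D t + 0 * (u - t) \<le> low d D u \<and> low d D u \<le> low d D t + 0 * (u - t) + 0 * \<bar>u - t\<bar> ^ k"
      if "t \<in> {d \<bullet> w1 + 2 * h..d \<bullet> w1 + 3 * h}" "u \<in> {d \<bullet> w1 + h..d \<bullet> w1 + 4 * h}" for t u
      using low[of t] low[of u] that h by simp
    show "0 * (d \<bullet> (w - p)) + c * \<bar>d \<bullet> (w - p)\<bar> ^ k \<le> rot d \<bullet> (w - p)" if "w \<in> C" for w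
      using ck(3)[OF that] by simp
  qed (use h ck p in auto)
qed

section \<open>Containers that are not polygons\<close>

lemma pt_in_open_segment:
  assumes d: "norm d = 1" and "u1 \<noteq> u2 \<or> v1 \<noteq> v2" "0 < s" "s < 1"
    and "u = (1 - s) * u1 + s * u2" "v = (1 - s) * v1 + s * v2"
  shows "pt d u v \<in> open_segment (pt d u1 v1) (pt d u2 v2)"
proof -
  have "pt d u1 v1 \<noteq> pt d u2 v2" using inner_pt[OF d] assms(2) by metis
  moreover have "pt d u v = (1 - s) *\<^sub>R pt d u1 v1 + s *\<^sub>R pt d u2 v2"
    unfolding assms(5,6) by (rule pt_affine)
  ultimately show ?thesis using assms(3,4) by (auto simp: in_segment)
qed

lemma pt_minus: "pt (- d) u v = pt d (- u) (- v)" "rot (- d) = - rot d"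
proof -
  show "rot (- d) = - rot d" by (simp add: vec_eq_iff forall_2)
  then show "pt (- d) u v = pt d (- u) (- v)" by (simp add: pt_def)
qed

text \<open>Any other point of \<open>D\<close> lies strictly between the lower and the upper
  boundary point on its vertical line, so it is not extreme.\<close>

lemma extreme_points_lower_or_upper:
  assumes D: "convex_body D" and d: "norm d = 1" and p: "p extreme_point_of D"
  shows "rot d \<bullet> p = low d D (d \<bullet> p) \<or> rot (- d) \<bullet> p = low (- d) D (- d \<bullet> p)"
proof (rule ccontr)
  assume neg: "\<not> ?thesis"
  have pD: "p \<in> D" using p by (simp add: extreme_point_of_def)
  have d': "norm (- d) = 1" using d by simp
  let ?u = "d \<bullet> p" and ?v = "rot d \<bullet> p" and ?v1 = "low d D (d \<bullet> p)" and ?v2 = "- low (- d) D (- d \<bullet> p)"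
  have 1: "pt d ?u ?v1 \<in> D" "?v1 < ?v" using low_point[OF D d pD] neg by auto
  have 2: "pt d ?u ?v2 \<in> D" "?v < ?v2" using low_point[OF D d' pD] neg by (auto simp: pt_minus)
  define s where "s = (?v - ?v1) / (?v2 - ?v1)"
  have s: "0 < s" "s < 1" using 1(2) 2(2) by (auto simp: s_def field_simps)
  have "s * (?v2 - ?v1) = ?v - ?v1" using 1(2) 2(2) by (simp add: s_def)
  then have "?v = (1 - s) * ?v1 + s * ?v2" by (simp add: algebra_simps)
  moreover have "?u = (1 - s) * ?u + s * ?u" by (simp add: algebra_simps)
  ultimately have "pt d ?u ?v \<in> open_segment (pt d ?u ?v1) (pt d ?u ?v2)"
    by (intro pt_in_open_segment[OF d _ s]) (use 1(2) 2(2) in linarith)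
  then have "p \<in> open_segment (pt d ?u ?v1) (pt d ?u ?v2)" using d by simp
  then show False using p 1(1) 2(1) by (auto simp: extreme_point_of_def)
qed

text \<open>Of three collinear points the middle one is not extreme, so a line carries at most two
  extreme points.\<close>

lemma finite_extreme_points_on_line:
  assumes d: "norm d = 1"
  shows "finite {p. p extreme_point_of D \<and> rot d \<bullet> p = m * (d \<bullet> p) + n}"
proof -
  have mid: "\<not> (d \<bullet> p < d \<bullet> q \<and> d \<bullet> q < d \<bullet> r)"
    if p: "p extreme_point_of D" "rot d \<bullet> p = m * (d \<bullet> p) + n"
      and q: "q extreme_point_of D" "rot d \<bullet> q = m * (d \<bullet> q) + n"
      and r: "r extreme_point_of D" "rot d \<bullet> r = m * (d \<bullet> r) + n" for p q r
  proof
    assume lt: "d \<bullet> p < d \<bullet> q \<and> d \<bullet> q < d \<bullet> r"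
    define s where "s = (d \<bullet> q - d \<bullet> p) / (d \<bullet> r - d \<bullet> p)"
    have s: "0 < s" "s < 1" using lt by (auto simp: s_def field_simps)
    have "s * (d \<bullet> r - d \<bullet> p) = d \<bullet> q - d \<bullet> p" using lt by (simp add: s_def)
    then have e: "d \<bullet> q = (1 - s) * (d \<bullet> p) + s * (d \<bullet> r)" by (simp add: algebra_simps)
    then have "rot d \<bullet> q = (1 - s) * (rot d \<bullet> p) + s * (rot d \<bullet> r)"
      unfolding p(2) q(2) r(2) e by (simp add: algebra_simps)
    then have "pt d (d \<bullet> q) (rot d \<bullet> q) \<in> open_segment (pt d (d \<bullet> p) (rot d \<bullet> p)) (pt d (d \<bullet> r) (rot d \<bullet> r))"
      using lt by (intro pt_in_open_segment[OF d _ s e]) auto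
    then have "q \<in> open_segment p r" using d by simp
    then show False using p(1) q(1) r(1) by (auto simp: extreme_point_of_def)
  qed
  have ne: "d \<bullet> p \<noteq> d \<bullet> q" if "p \<noteq> q" "rot d \<bullet> p = m * (d \<bullet> p) + n" "rot d \<bullet> q = m * (d \<bullet> q) + n" for p q
  proof
    assume "d \<bullet> p = d \<bullet> q"
    then have "pt d (d \<bullet> p) (rot d \<bullet> p) = pt d (d \<bullet> q) (rot d \<bullet> q)" using that by simp
    then show False using d that(1) by simp
  qed
  let ?A = "{p. p extreme_point_of D \<and> rot d \<bullet> p = m * (d \<bullet> p) + n}"
  have "finite ?A \<and> card ?A \<le> 2"
  proof (rule finite_card_le_2)
    fix x y z assume "x \<in> ?A" "y \<in> ?A" "z \<in> ?A" and neq: "x \<noteq> y" "y \<noteq> z" "x \<noteq> z"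
    then have A: "x extreme_point_of D" "rot d \<bullet> x = m * (d \<bullet> x) + n" "y extreme_point_of D" "rot d \<bullet> y = m * (d \<bullet> y) + n"
      "z extreme_point_of D" "rot d \<bullet> z = m * (d \<bullet> z) + n" by auto
    have "d \<bullet> x \<noteq> d \<bullet> y" "d \<bullet> y \<noteq> d \<bullet> z" "d \<bullet> x \<noteq> d \<bullet> z" using ne A neq by blast+
    then consider "d \<bullet> x < d \<bullet> y \<and> d \<bullet> y < d \<bullet> z" | "d \<bullet> x < d \<bullet> z \<and> d \<bullet> z < d \<bullet> y" | "d \<bullet> y < d \<bullet> x \<and> d \<bullet> x < d \<bullet> z"
      | "d \<bullet> y < d \<bullet> z \<and> d \<bullet> z < d \<bullet> x" | "d \<bullet> z < d \<bullet> x \<and> d \<bullet> x < d \<bullet> y" | "d \<bullet> z < d \<bullet> y \<and> d \<bullet> y < d \<bullet> x"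
      by linarith
    then show False using mid A by cases blast+
  qed
  then show ?thesis by blast
qed

text \<open>By the Krein-Milman theorem a body that is no polytope has infinitely many extreme
  points, and infinitely many of them lie on the lower boundary for \<open>d0\<close> or for
  \<open>- d0\<close>. One of these avoids the finitely many lines in the zero set, and the arc
  around it has no straight piece.\<close>

lemma non_polytope_has_nonlinear_arc:
  assumes D: "convex_body D" and bdc: "bounded_description_complexity D" and np: "\<not> polytope D"
  shows "\<exists>d w1 w2 Q a b. norm d = 1 \<and> w1 \<in> D \<and> w2 \<in> D \<and> d \<bullet> w1 < a \<and> a < b \<and> b < d \<bullet> w2 \<and> Q \<noteq> 0 \<and>
    (\<forall>x\<in>{a<..<b}. ev Q x (low d D x) = 0) \<and>
    (\<forall>c e m n. a \<le> c \<longrightarrow> c < e \<longrightarrow> e \<le> b \<longrightarrow> \<not> (\<forall>x\<in>{c<..<e}. low d D x = m * x + n))"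
proof -
  have cD: "compact D" "convex D" "D \<noteq> {}" using D interior_subset by (auto simp: convex_body_def)
  define E where "E = {p. p extreme_point_of D}"
  have infE: "infinite E"
  proof
    assume "finite E"
    then show False using np Krein_Milman_Minkowski[OF cD(1,2)] unfolding polytope_def E_def by metis
  qed
  define L where "L d = {p \<in> E. rot d \<bullet> p = low d D (d \<bullet> p)}" for d
  define d0 :: "real^2" where "d0 = axis 1 1"
  have d0: "norm d0 = 1" by (simp add: d0_def norm_axis_1)
  have "E \<subseteq> L d0 \<union> L (- d0)"
  proof
    fix p assume "p \<in> E"
    then show "p \<in> L d0 \<union> L (- d0)"
      using extreme_points_lower_or_upper[OF D d0, of p] by (auto simp: L_def E_def)
  qed
  then have "infinite (L d0) \<or> infinite (L (- d0))" using infE finite_subset by blast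
  moreover have "norm (- d0) = 1" using d0 by simp
  ultimately obtain d where d: "norm d = 1" and infL: "infinite (L d)" using d0 by blast
  have contd: "continuous_on D (\<lambda>x. d \<bullet> x)" by (intro continuous_intros)
  obtain w1 where w1: "w1 \<in> D" "\<And>x. x \<in> D \<Longrightarrow> d \<bullet> w1 \<le> d \<bullet> x"
    using continuous_attains_inf[OF cD(1,3) contd] by blast
  obtain w2 where w2: "w2 \<in> D" "\<And>x. x \<in> D \<Longrightarrow> d \<bullet> x \<le> d \<bullet> w2"
    using continuous_attains_sup[OF cD(1,3) contd] by blast
  obtain Q where Q: "Q \<noteq> 0" "\<And>u v. pt d u v + 0 \<in> frontier D \<Longrightarrow> ev Q u v = 0"
    using frontier_polynomial[OF bdc d, of 0] by blast
  let ?R = "affine_roots Q" and ?f = "low d D"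
  have finR: "finite ?R" by (rule finite_affine_roots[OF Q(1)])
  \<comment> \<open>Discarded are the points over the ends of the projection, in \<open>B1\<close>,
    and those on lines of the zero set, in \<open>B2\<close>. Both sets are finite.\<close>
  define B1 where "B1 = {p \<in> L d. d \<bullet> p \<in> {d \<bullet> w1, d \<bullet> w2}}"
  define B2 where "B2 = (\<Union>(m, n)\<in>?R. {p. p extreme_point_of D \<and> rot d \<bullet> p = m * (d \<bullet> p) + n})"
  have "finite B1"
  proof (rule finite_imageD)
    show "finite ((\<lambda>p. d \<bullet> p) ` B1)" by (rule finite_subset[of _ "{d \<bullet> w1, d \<bullet> w2}"]) (auto simp: B1_def)
    show "inj_on (\<lambda>p. d \<bullet> p) B1"
    proof (rule inj_onI)
      fix p q assume "p \<in> B1" "q \<in> B1" "d \<bullet> p = d \<bullet> q"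
      then have "pt d (d \<bullet> p) (rot d \<bullet> p) = pt d (d \<bullet> q) (rot d \<bullet> q)" by (simp add: B1_def L_def)
      then show "p = q" using d by simp
    qed
  qed
  moreover have "finite B2" unfolding B2_def using finR finite_extreme_points_on_line[OF d] by auto
  ultimately have "infinite (L d - (B1 \<union> B2))" using infL by (simp add: Diff_infinite_finite)
  then obtain p where p: "p \<in> L d" "p \<notin> B1" "p \<notin> B2" by (metis Diff_iff UnCI all_not_in_conv finite.emptyI)
  define u0 where "u0 = d \<bullet> p"
  have pD: "p \<in> D" and pE: "p extreme_point_of D" using p(1) by (auto simp: L_def E_def extreme_point_of_def)
  have u0: "d \<bullet> w1 < u0" "u0 < d \<bullet> w2"
    using w1(2)[OF pD] w2(2)[OF pD] p(1,2) unfolding B1_def u0_def by (auto simp: less_le)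
  have f0: "?f u0 = rot d \<bullet> p" using p(1) by (simp add: L_def u0_def)
  have conv: "convex_on {d \<bullet> w1<..<d \<bullet> w2} ?f" by (rule low_convex_on_open[OF D d w1(1) w2(1)]) simp_all
  have "continuous_on {d \<bullet> w1<..<d \<bullet> w2} ?f" by (rule convex_on_continuous[OF _ conv]) simp
  then have cont: "isCont ?f u0" using u0 by (simp add: continuous_on_eq_continuous_at)
  \<comment> \<open>By continuity the graph near \<open>u0\<close> stays off each of the finitely
    many lines that miss \<open>p\<close>. A straight piece near \<open>u0\<close> would have to lie
    on one of them.\<close>
  have "\<forall>mn\<in>?R. \<forall>\<^sub>F x in at u0. ?f x \<noteq> fst mn * x + snd mn"
  proof
    fix mn assume mn: "mn \<in> ?R"
    have "isCont (\<lambda>x. ?f x - (fst mn * x + snd mn)) u0" by (intro continuous_intros cont)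
    then have lim: "((\<lambda>x. ?f x - (fst mn * x + snd mn)) \<longlongrightarrow> ?f u0 - (fst mn * u0 + snd mn)) (at u0)"
      by (simp add: isCont_def)
    have "?f u0 \<noteq> fst mn * u0 + snd mn" using p(3) mn pE f0 by (auto simp: B2_def u0_def)
    then have "\<forall>\<^sub>F x in at u0. ?f x - (fst mn * x + snd mn) \<noteq> 0"
      by (intro tendsto_imp_eventually_ne[OF lim]) simp
    then show "\<forall>\<^sub>F x in at u0. ?f x \<noteq> fst mn * x + snd mn" by eventually_elim simp
  qed
  then have "\<forall>\<^sub>F x in at u0. \<forall>mn\<in>?R. ?f x \<noteq> fst mn * x + snd mn"
    by (rule eventually_ball_finite[OF finR])
  then obtain r where r: "r > 0" "\<And>x mn. \<lbrakk>x \<noteq> u0; dist x u0 < r; mn \<in> ?R\<rbrakk> \<Longrightarrow> ?f x \<noteq> fst mn * x + snd mn"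
    unfolding eventually_at by blast
  define e where "e = min (r / 2) (min ((u0 - d \<bullet> w1) / 2) ((d \<bullet> w2 - u0) / 2))"
  have e: "e > 0" "e < r" "d \<bullet> w1 < u0 - e" "u0 + e < d \<bullet> w2"
  proof -
    have m: "e \<le> min ((u0 - d \<bullet> w1) / 2) ((d \<bullet> w2 - u0) / 2)" unfolding e_def by (rule min.cobounded2)
    have le: "e \<le> r / 2" "e \<le> (u0 - d \<bullet> w1) / 2" "e \<le> (d \<bullet> w2 - u0) / 2"
      using order_trans[OF m min.cobounded1] order_trans[OF m min.cobounded2] by (simp_all add: e_def)
    show "e > 0" using r(1) u0 by (simp add: e_def)
    show "e < r" using le(1) r(1) by linarith
    show "d \<bullet> w1 < u0 - e" using le(2) u0(1) by argo
    show "u0 + e < d \<bullet> w2" using le(3) u0(2) by argo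
  qed
  have zero: "ev Q x (?f x) = 0" if "x \<in> {u0 - e<..<u0 + e}" for x
  proof -
    have "pt d x (?f x) \<in> D" by (rule low_defined_between[OF D d w1(1) w2(1)]) (use that e in auto)
    then show ?thesis using Q(2)[of x "?f x"] low_frontier[OF D d] by simp
  qed
  have nonaffine: "\<not> (\<forall>x\<in>{c<..<c'}. ?f x = m * x + n)" if c: "u0 - e \<le> c" "c < c'" "c' \<le> u0 + e" for c c' m n
  proof
    assume aff: "\<forall>x\<in>{c<..<c'}. ?f x = m * x + n"
    have "{c<..<c'} \<subseteq> {x. ev Q x (m * x + n) = 0}"
    proof
      fix x assume x: "x \<in> {c<..<c'}"
      then have "ev Q x (?f x) = 0" using c by (intro zero) auto
      then show "x \<in> {x. ev Q x (m * x + n) = 0}" using aff x by simp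
    qed
    then have "infinite {x. ev Q x (m * x + n) = 0}" using infinite_Ioo[OF c(2)] finite_subset by blast
    then have mn: "(m, n) \<in> ?R" by (rule affine_rootI)
    have "infinite ({c<..<c'} - {u0})" using infinite_Ioo[OF c(2)] by simp
    then obtain x where x: "x \<in> {c<..<c'}" "x \<noteq> u0" by (metis DiffE all_not_in_conv finite.emptyI singletonI)
    have "dist x u0 < r" using x(1) c e by (auto simp: dist_real_def abs_less_iff)
    then show False using r(2)[OF x(2) _ mn] aff x(1) by simp
  qed
  have "u0 - e < u0 + e" using e(1) by simp
  then show ?thesis using d w1(1) w2(1) e(3,4) Q(1) zero nonaffine by blast
qed

text \<open>The slopes along an arc of \<open>D\<close> fill an interval.
  \<open>curved_support_points\<close> cuts it down to slopes for which \<open>C\<close> has a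
  uniform quadratic gap, and the increasing function \<open>G\<close> carries the smaller interval
  back to the contacts in \<open>{t1..t2}\<close>.\<close>

lemma packing_along_curved_arc:
  assumes C: "convex_body C" and D: "convex_body D"
    and bdc: "bounded_description_complexity C" "bounded_description_complexity D" and np: "\<not> polytope D"
  shows "\<exists>\<sigma>::real. \<sigma> > 0 \<and> (\<forall>n::nat. n \<ge> 1 \<longrightarrow>
               (\<exists>P. boundary_homothet_packing C D n P \<and> total_perimeter P \<ge> \<sigma> * log 2 (real n)))"
proof -
  obtain d w1 w2 Q a0 b0 where d: "norm d = 1" and w: "w1 \<in> D" "w2 \<in> D" and ab0: "d \<bullet> w1 < a0" "a0 < b0" "b0 < d \<bullet> w2"
    and Q: "Q \<noteq> 0" and zero: "\<forall>x\<in>{a0<..<b0}. ev Q x (low d D x) = 0"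
    and na: "\<forall>c e m n. a0 \<le> c \<longrightarrow> c < e \<longrightarrow> e \<le> b0 \<longrightarrow> \<not> (\<forall>x\<in>{c<..<e}. low d D x = m * x + n)"
    using non_polytope_has_nonlinear_arc[OF D bdc(2) np] by blast
  let ?g = "low d D"
  have conv: "convex_on {a0<..<b0} ?g" by (rule low_convex_on_open[OF D d w]) (use ab0 in auto)
  obtain a b G l U where ab: "a0 < a" "a < b" "b < b0"
    and dG: "\<And>x. x \<in> {a..b} \<Longrightarrow> (?g has_real_derivative G x) (at x)" and l: "l > 0" and U: "U > 0"
    and lG: "\<And>x y. \<lbrakk>x \<in> {a..b}; y \<in> {a..b}; x \<le> y\<rbrakk> \<Longrightarrow> l * (y - x) \<le> G y - G x \<and> G y - G x \<le> U * (y - x)"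
    using algebraic_convex_arc[OF ab0(2) conv Q zero na] by blast
  have lipG: "\<bar>G y - G x\<bar> \<le> U * \<bar>y - x\<bar>" if "x \<in> {a..b}" "y \<in> {a..b}" for x y
  proof -
    have le: "\<bar>G y - G x\<bar> \<le> U * (y - x)" if "x \<in> {a..b}" "y \<in> {a..b}" "x \<le> y" for x y
    proof -
      have "0 \<le> l * (y - x)" using l that by simp
      then show ?thesis using lG[OF that] by linarith
    qed
    show ?thesis using le[of x y] le[of y x] that by (cases "x \<le> y") (auto simp: abs_minus_commute)
  qed
  have strict: "G x < G y" if "x \<in> {a..b}" "y \<in> {a..b}" "x < y" for x y
  proof -
    have "0 < l * (y - x)" using l that by simp
    then show ?thesis using lG[OF that(1,2)] that by linarith
  qed
  have contG: "continuous_on {a..b} G"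
    by (rule lipschitz_on_continuous_on[of U], rule lipschitz_onI)
      (use lipG U in \<open>auto simp: dist_real_def abs_minus_commute\<close>)
  \<comment> \<open>Contacts stay in the middle third, so that copies may spread over all of
    \<open>{a..b}\<close>, where the curvature bounds hold.\<close>
  define \<eta> where "\<eta> = (b - a) / 3"
  have \<eta>: "\<eta> > 0" "b = a + 3 * \<eta>" using ab by (simp_all add: \<eta>_def field_simps)
  have "G (a + \<eta>) < G (b - \<eta>)" by (rule strict) (use \<eta> in auto)
  then obtain \<sigma>1 \<sigma>2 c where \<sigma>: "G (a + \<eta>) \<le> \<sigma>1" "\<sigma>1 < \<sigma>2" "\<sigma>2 \<le> G (b - \<eta>)" and c: "c > 0"
    and supp: "\<forall>s\<in>{\<sigma>1..\<sigma>2}. \<exists>z\<in>C. \<forall>w\<in>C. rot d \<bullet> (w - z) \<ge> s * (d \<bullet> (w - z)) + c * \<bar>d \<bullet> (w - z)\<bar> ^ 2"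
    using curved_support_points[OF C bdc(1) d] by blast
  have ivt: "\<exists>x\<ge>a + \<eta>. x \<le> b - \<eta> \<and> G x = s" if "s \<in> {\<sigma>1..\<sigma>2}" for s
    by (rule IVT') (use that \<sigma> \<eta> contG in \<open>auto intro: continuous_on_subset\<close>)
  obtain t1 where t1: "a + \<eta> \<le> t1" "t1 \<le> b - \<eta>" "G t1 = \<sigma>1" using ivt[of \<sigma>1] \<sigma> by auto
  obtain t2 where t2: "a + \<eta> \<le> t2" "t2 \<le> b - \<eta>" "G t2 = \<sigma>2" using ivt[of \<sigma>2] \<sigma> by auto
  have tab: "t1 \<in> {a..b}" "t2 \<in> {a..b}" using t1 t2 \<eta> by auto
  have t12: "t1 < t2"
  proof (rule ccontr)
    assume "\<not> t1 < t2"
    then have "G t2 \<le> G t1" using strict[OF tab(2,1)] by (cases "t1 = t2") auto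
    then show False using t1(3) t2(3) \<sigma> by simp
  qed
  have Gt: "G t \<in> {\<sigma>1..\<sigma>2}" if t: "t \<in> {t1..t2}" for t
  proof -
    have "t \<in> {a..b}" using t tab by auto
    then show ?thesis
      using strict[OF tab(1), of t] strict[OF _ tab(2), of t] t t1(3) t2(3)
      by (cases "t = t1"; cases "t = t2") auto
  qed
  define z where "z t = (SOME z. z \<in> C \<and> (\<forall>w\<in>C. rot d \<bullet> (w - z) \<ge> G t * (d \<bullet> (w - z)) + c * \<bar>d \<bullet> (w - z)\<bar> ^ 2))" for t
  have z: "z t \<in> C \<and> (\<forall>w\<in>C. rot d \<bullet> (w - z t) \<ge> G t * (d \<bullet> (w - z t)) + c * \<bar>d \<bullet> (w - z t)\<bar> ^ 2)" if "t \<in> {t1..t2}" for t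
    unfolding z_def by (rule someI_ex) (use supp Gt[OF that] in blast)
  show ?thesis
  proof (rule low_tangent_packing[OF C D d w, of a t1 t2 b 2 c U G z "max \<bar>\<sigma>1\<bar> \<bar>\<sigma>2\<bar>"])
    show "d \<bullet> w1 < a" "a < t1" "t1 < t2" "t2 < b" "b < d \<bullet> w2" using ab0 ab t1 t2 t12 \<eta> by auto
    show "?g t + G t * (u - t) \<le> ?g u \<and> ?g u \<le> ?g t + G t * (u - t) + U * \<bar>u - t\<bar> ^ 2"
      if t: "t \<in> {t1..t2}" and u: "u \<in> {a..b}" for t u
    proof
      have tab': "t \<in> {a..b}" using t tab by auto
      show "?g t + G t * (u - t) \<le> ?g u"
        by (rule convex_on_deriv_le[OF conv]) (use tab' u ab dG in auto)
      \<comment> \<open>The tangent at \<open>u\<close>, evaluated at \<open>t\<close>, bounds the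
        departure from the tangent at \<open>t\<close> by the change of slope times the
        distance.\<close>
      have "?g t \<ge> ?g u + G u * (t - u)"
        by (rule convex_on_deriv_le[OF conv]) (use tab' u ab dG in auto)
      then have "?g u \<le> ?g t + G t * (u - t) + (G u - G t) * (u - t)" by (simp add: algebra_simps)
      moreover have "(G u - G t) * (u - t) \<le> U * \<bar>u - t\<bar> ^ 2"
      proof -
        have "(G u - G t) * (u - t) \<le> \<bar>G u - G t\<bar> * \<bar>u - t\<bar>" by (metis abs_ge_self abs_mult)
        also have "\<dots> \<le> (U * \<bar>u - t\<bar>) * \<bar>u - t\<bar>" by (rule mult_right_mono[OF lipG[OF tab' u]]) simp
        finally show ?thesis by (simp add: power2_eq_square)
      qed
      ultimately show "?g u \<le> ?g t + G t * (u - t) + U * \<bar>u - t\<bar> ^ 2" by linarith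
    qed
    show "\<bar>G t\<bar> \<le> max \<bar>\<sigma>1\<bar> \<bar>\<sigma>2\<bar>" if "t \<in> {t1..t2}" for t using Gt[OF that] by auto
  qed (use z c U in auto)
qed

theorem theorem2:
  fixes C D :: "(real^2) set"
  assumes "convex_body C" and "convex_body D"
    and "bounded_description_complexity C" and "bounded_description_complexity D"
  shows "(\<exists>\<rho>::real. \<forall>n::nat. n \<ge> 2 \<longrightarrow>
            (\<forall>S. boundary_homothet_packing C D n S \<longrightarrow>
                 total_perimeter S \<le> \<rho> * log 2 (real n))) \<and>
         (\<not> (convex_polygon D \<and> parallel_to D C) \<longrightarrow>
            (\<exists>\<sigma>::real. \<sigma> > 0 \<and> (\<forall>n::nat. n \<ge> 1 \<longrightarrow>
               (\<exists>S. boundary_homothet_packing C D n S \<and>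
                    total_perimeter S \<ge> \<sigma> * log 2 (real n)))))"
proof (intro conjI impI)
  show "\<exists>\<rho>::real. \<forall>n::nat. n \<ge> 2 \<longrightarrow>
            (\<forall>S. boundary_homothet_packing C D n S \<longrightarrow> total_perimeter S \<le> \<rho> * log 2 (real n))"
    by (rule total_perimeter_upper_bound[OF assms(1,2)])
next
  assume np: "\<not> (convex_polygon D \<and> parallel_to D C)"
  show "\<exists>\<sigma>::real. \<sigma> > 0 \<and> (\<forall>n::nat. n \<ge> 1 \<longrightarrow>
               (\<exists>S. boundary_homothet_packing C D n S \<and> total_perimeter S \<ge> \<sigma> * log 2 (real n)))"
  proof (cases "polytope D")
    case True
    then have "\<not> parallel_to D C" using np assms(2) by (simp add: convex_polygon_def convex_body_def)
    then obtain d where "norm d = 1" "has_side d D" "\<not> has_side d C" by (auto simp: parallel_to_def)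
    then show ?thesis by (rule packing_along_side[OF assms(1-3)])
  next
    case False
    then show ?thesis by (rule packing_along_curved_arc[OF assms])
  qed
qed

end
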